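(* Let $(\mathcal M,\tau)$ be a finite von Neumann algebra satisfying the weak Dixmier property and let $S,T\in\mathcal M$. If $|\!|\!|S|\!|\!|_{(t)}\le|\!|\!|T|\!|\!|_{(t)}$ for all Ky Fan $t$-th norms, $0\le t\le1$, then $|\!|\!|S|\!|\!|\le|\!|\!|T|\!|\!|$ for all tracial gauge norms $|\!|\!|\cdot|\!|\!|$ on $\mathcal M$.
   Context: A finite von Neumann algebra $(\mathcal M,\tau)$ means a von Neumann algebra $\mathcal M$ with a faithful normal tracial state $\tau$; $\|\cdot\|$ is the operator norm. For $T\in\mathcal M$ and $0\le s\le1$, $\mu_s(T)=\inf\{\|TE\|: E\in\mathcal M\text{ a projection with }\tau(1-E)\le s\}$. The Ky Fan $t$-th norm is $|\!|\!|T|\!|\!|_{(t)}=\frac1t\int_0^t\mu_s(T)\,ds$ for $0<t\le1$ and $|\!|\!|T|\!|\!|_{(0)}=\|T\|$. Positive operators $S,T\in\mathcal M$ are equi-measurable if $\tau(S^n)=\tau(T^n)$ for all $n=0,1,2,\dots$. $(\mathcal M,\tau)$ satisfies the weak Dixmier property if for every positive $T\in\mathcal M$, $\tau(T)1$ is in the operator norm closure of the convex hull of the set of (positive) $S\in\mathcal M$ that are equi-measurable with $T$. A tracial gauge norm on $(\mathcal M,\tau)$ is a norm on $\mathcal M$ with $|\!|\!|T|\!|\!|=|\!|\!|\,|T|\,|\!|\!|$ for all $T\in\mathcal M$, where $|T|=(T^*T)^{1/2}$, and $|\!|\!|S|\!|\!|=|\!|\!|T|\!|\!|$ whenever $S,T$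 are equi-measurable positive operators in $\mathcal M$. *)

theory Defs
  imports "HOL-Analysis.Analysis"
begin

text \<open>
  Complex Hilbert spaces, with the inner product linear in its first argument. The real inner
  product space structure of the superclass is the underlying one, so that the norm is the
  usual norm \<open>norm x = sqrt (Re (cinner x x))\<close>.
\<close>

class complex_hilbert = real_inner + banach +
  fixes scaleC :: "complex \<Rightarrow> 'a \<Rightarrow> 'a" (infixr "*\<^sub>C" 75)
    and cinner :: "'a \<Rightarrow> 'a \<Rightarrow> complex"
  assumes scaleC_add_right: "c *\<^sub>C (x + y) = c *\<^sub>C x + c *\<^sub>C y"
    and scaleC_add_left: "(c + d) *\<^sub>C x = c *\<^sub>C x + d *\<^sub>C x"
    and scaleC_scaleC: "c *\<^sub>C (d *\<^sub>C x) = (c * d) *\<^sub>C x"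
    and scaleC_complex_of_real: "complex_of_real r *\<^sub>C x = r *\<^sub>R x"
    and cinner_commute: "cinner x y = cnj (cinner y x)"
    and cinner_add_left: "cinner (x + y) z = cinner x z + cinner y z"
    and cinner_scaleC_left: "cinner (c *\<^sub>C x) y = c * cinner x y"
    and inner_eq_Re_cinner: "inner x y = Re (cinner x y)"

lemma norm_scaleC: "norm (c *\<^sub>C x) = cmod c * norm (x :: 'a :: complex_hilbert)"
proof -
  have "Im (cinner x x) = 0"
    using arg_cong[OF cinner_commute[of x x], of Im] by simp
  then have "cinner x x = complex_of_real (inner x x)"
    by (simp add: complex_eq_iff inner_eq_Re_cinner)
  moreover have "cinner (c *\<^sub>C x) (c *\<^sub>C x) = c * cnj c * cinner x x"
    using cinner_commute[of x "c *\<^sub>C x"] cinner_commute[of x x]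
    by (simp add: cinner_scaleC_left)
  ultimately have "inner (c *\<^sub>C x) (c *\<^sub>C x) = (cmod c)\<^sup>2 * inner x x"
    by (metis Re_complex_of_real complex_norm_square inner_eq_Re_cinner of_real_mult)
  then show ?thesis
    by (simp add: norm_eq_sqrt_inner real_sqrt_mult)
qed

lemma bounded_linear_scaleC: "bounded_linear (\<lambda>x :: 'a :: complex_hilbert. c *\<^sub>C x)"
proof (rule bounded_linear_intro)
  show "c *\<^sub>C (r *\<^sub>R x) = r *\<^sub>R (c *\<^sub>C x)" for r and x :: 'a
    by (simp add: scaleC_complex_of_real[symmetric] scaleC_scaleC mult.commute)
  show "norm (c *\<^sub>C x) \<le> norm x * cmod c" for x :: 'a
    by (simp add: norm_scaleC mult.commute)
qed (rule scaleC_add_right)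

text \<open>
  The bounded operators on \<open>'h\<close> are the complex-linear elements of \<open>'h \<Rightarrow>\<^sub>L 'h\<close>, a type whose
  elements are merely real-linear. The norm of \<open>'h \<Rightarrow>\<^sub>L 'h\<close> is the operator norm.
\<close>

type_synonym 'h op = "'h \<Rightarrow>\<^sub>L 'h"

definition clinear_op :: "'h::complex_hilbert op \<Rightarrow> bool"
  where "clinear_op A \<longleftrightarrow> (\<forall>c x. A (c *\<^sub>C x) = c *\<^sub>C A x)"

definition scaleC_op :: "complex \<Rightarrow> 'h::complex_hilbert op \<Rightarrow> 'h op"
  where "scaleC_op c A = Blinfun (\<lambda>x. c *\<^sub>C A x)"

lemma scaleC_op_apply: "scaleC_op c A x = c *\<^sub>C A x"
proof -
  have "bounded_linear (\<lambda>x. c *\<^sub>C A x)"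
    using bounded_linear_compose[OF bounded_linear_scaleC blinfun.bounded_linear_right] .
  then show ?thesis
    by (simp add: scaleC_op_def bounded_linear_Blinfun_apply)
qed

definition op_power :: "'h::complex_hilbert op \<Rightarrow> nat \<Rightarrow> 'h op"
  where "op_power A n = ((\<lambda>B. A o\<^sub>L B) ^^ n) id_blinfun"

definition op_adjoint :: "'h::complex_hilbert op \<Rightarrow> 'h op"
  where "op_adjoint A = (THE B :: 'h op. \<forall>x y. cinner (A x) y = cinner x (B y))"

text \<open>
  On a complex Hilbert space, the reality of \<open>cinner (A x) x\<close> for all \<open>x\<close> makes \<open>A\<close> self-adjoint.
\<close>

definition positive_op :: "'h::complex_hilbert op \<Rightarrow> bool"
  where "positive_op A \<longleftrightarrow> clinear_op A \<and> (\<forall>x. cinner (A x) x \<in> \<real>\<^sub>\<ge>\<^sub>0)"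

definition projection_op :: "'h::complex_hilbert op \<Rightarrow> bool"
  where "projection_op E \<longleftrightarrow> clinear_op E \<and> E o\<^sub>L E = E \<and> op_adjoint E = E"

text \<open>The absolute value: the positive square root of \<open>A\<^sup>* A\<close>.\<close>

definition op_abs :: "'h::complex_hilbert op \<Rightarrow> 'h op"
  where "op_abs A = (THE B. positive_op B \<and> B o\<^sub>L B = op_adjoint A o\<^sub>L A)"

definition commutant :: "'h::complex_hilbert op set \<Rightarrow> 'h op set"
  where "commutant M = {A. clinear_op A \<and> (\<forall>B\<in>M. A o\<^sub>L B = B o\<^sub>L A)}"

text \<open>
  A von Neumann algebra is a self-adjoint set of operators that equals its double commutant;
  this makes it a unital algebra of complex-linear operators.
\<close>

locale von_neumann_algebra =
  fixes M :: "'h::complex_hilbert op set"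
  assumes adjoint_closed: "A \<in> M \<Longrightarrow> op_adjoint A \<in> M"
    and double_commutant: "commutant (commutant M) = M"

text \<open>
  In \<open>trace_normal\<close>, \<open>D\<close> is an upward directed set of positive operators with least upper
  bound \<open>A\<close> in \<open>M\<close>, where \<open>X\<close> is below \<open>Y\<close> iff \<open>Y - X\<close> is positive. Values of \<open>\<tau>\<close> outside of \<open>M\<close>
  are irrelevant.
\<close>

locale finite_von_neumann_algebra = von_neumann_algebra M
  for M :: "'h::complex_hilbert op set" +
  fixes \<tau> :: "'h op \<Rightarrow> complex"
  assumes trace_add: "A \<in> M \<Longrightarrow> B \<in> M \<Longrightarrow> \<tau> (A + B) = \<tau> A + \<tau> B"
    and trace_scale: "A \<in> M \<Longrightarrow> \<tau> (scaleC_op c A) = c * \<tau> A"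
    and trace_positive: "A \<in> M \<Longrightarrow> positive_op A \<Longrightarrow> \<tau> A \<in> \<real>\<^sub>\<ge>\<^sub>0"
    and trace_one: "\<tau> id_blinfun = 1"
    and trace_commute: "A \<in> M \<Longrightarrow> B \<in> M \<Longrightarrow> \<tau> (A o\<^sub>L B) = \<tau> (B o\<^sub>L A)"
    and trace_faithful: "A \<in> M \<Longrightarrow> \<tau> (op_adjoint A o\<^sub>L A) = 0 \<Longrightarrow> A = 0"
    and trace_normal:
      "\<lbrakk>D \<noteq> {}; D \<subseteq> M; \<And>X. X \<in> D \<Longrightarrow> positive_op X;
        \<And>X Y. X \<in> D \<Longrightarrow> Y \<in> D \<Longrightarrow> \<exists>Z\<in>D. positive_op (Z - X) \<and> positive_op (Z - Y);
        A \<in> M; \<And>X. X \<in> D \<Longrightarrow> positive_op (A - X);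
        \<And>B. B \<in> M \<Longrightarrow> (\<And>X. X \<in> D \<Longrightarrow> positive_op (B - X)) \<Longrightarrow> positive_op (B - A)\<rbrakk>
       \<Longrightarrow> Re (\<tau> A) = (SUP X\<in>D. Re (\<tau> X))"

definition singular_number ::
    "'h::complex_hilbert op set \<Rightarrow> ('h op \<Rightarrow> complex) \<Rightarrow> real \<Rightarrow> 'h op \<Rightarrow> real"
  where "singular_number M \<tau> s T =
    Inf {norm (T o\<^sub>L E) | E. E \<in> M \<and> projection_op E \<and> Re (\<tau> (id_blinfun - E)) \<le> s}"

definition ky_fan_norm ::
    "'h::complex_hilbert op set \<Rightarrow> ('h op \<Rightarrow> complex) \<Rightarrow> real \<Rightarrow> 'h op \<Rightarrow> real"
  where "ky_fan_norm M \<tau> t T =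
    (if t = 0 then norm T else 1 / t * integral {0..t} (\<lambda>s. singular_number M \<tau> s T))"

definition equi_measurable ::
    "'h::complex_hilbert op set \<Rightarrow> ('h op \<Rightarrow> complex) \<Rightarrow> 'h op \<Rightarrow> 'h op \<Rightarrow> bool"
  where "equi_measurable M \<tau> S T \<longleftrightarrow>
    S \<in> M \<and> T \<in> M \<and> positive_op S \<and> positive_op T \<and>
    (\<forall>n. \<tau> (op_power S n) = \<tau> (op_power T n))"

definition weak_dixmier_property ::
    "'h::complex_hilbert op set \<Rightarrow> ('h op \<Rightarrow> complex) \<Rightarrow> bool"
  where "weak_dixmier_property M \<tau> \<longleftrightarrow>
    (\<forall>T\<in>M. positive_op T \<longrightarrow>
      scaleC_op (\<tau> T) id_blinfun \<in> closure (convex hull {S. equi_measurable M \<tau> S T}))"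

locale tracial_gauge_norm =
  fixes M :: "'h::complex_hilbert op set"
    and \<tau> :: "'h op \<Rightarrow> complex"
    and N :: "'h op \<Rightarrow> real"
  assumes gauge_nonneg: "T \<in> M \<Longrightarrow> 0 \<le> N T"
    and gauge_eq_zero: "T \<in> M \<Longrightarrow> N T = 0 \<longleftrightarrow> T = 0"
    and gauge_scale: "T \<in> M \<Longrightarrow> N (scaleC_op c T) = cmod c * N T"
    and gauge_triangle: "S \<in> M \<Longrightarrow> T \<in> M \<Longrightarrow> N (S + T) \<le> N S + N T"
    and gauge_abs: "T \<in> M \<Longrightarrow> N T = N (op_abs T)"
    and gauge_equi_measurable: "equi_measurable M \<tau> S T \<Longrightarrow> N S = N T"

end

theory Submission
  imports Defs
begin

text \<open>
  The theorem reduces to moving finitely many values between projections. Since \<open>S\<close> and \<open>|S|\<close> have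
  the same gauge norms and the same singular numbers, both operators may be taken to be positive.
  Spectral projections approximate a positive operator in norm by simple operators
  \<open>\<Sum> s\<^sub>k E\<^sub>k\<close>, where the \<open>E\<^sub>k\<close> are orthogonal projections with sum \<open>1\<close> (\<open>spectral_approximation\<close>). A
  gauge norm is dominated by the operator norm, because a self-adjoint contraction is the mean of two
  unitaries (\<open>gauge_le_norm\<close>); so the error is harmless. Two simple operators can be written over
  partitions of \<open>1\<close> with equal traces (\<open>common_refinement_exists\<close>), and then, up to
  equi-measurability, over one partition. The Ky Fan inequalities at the points
  \<open>t = \<tau> (E\<^sub>1 + \<dots> + E\<^sub>k)\<close> compare partial sums of the two decreasing sequences of values, weighted by
  the traces. The Robin Hood argument of Hardy, Littlewood and Polya (\<open>submajorization_induct\<close>)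
  produces the smaller sequence from the larger one by lowering single values and by transferring
  mass from a larger to a smaller value. Neither operation increases a gauge norm
  (\<open>gauge_lower\<close>, \<open>gauge_transfer\<close>).

  Lowering is easy: \<open>R + c E\<close> with \<open>0 \<le> c \<le> p\<close> is a convex combination of \<open>R \<plusminus> p E\<close>, which have the
  same absolute value. A transfer is a convex combination of the identity and of the replacement of
  two values by their weighted mean. If, up to a remainder of small trace, the two projections are sums
  of pieces of one common trace, then cyclic permutations of the values on the pieces give
  equi-measurable operators, and their average carries the mean (\<open>gauge_equal_average\<close>).

  The weak Dixmier property is needed only to produce these pieces. Given a nonzero projection \<open>E\<close>
  and a minimal projection \<open>F\<close>, the closed convex hull of the projections with the trace of \<open>E\<close>
  contains the scalar \<open>\<tau> E\<close>, so one of them, \<open>E'\<close>, does not annihilate \<open>F\<close>. Then \<open>F E' F\<close> is bounded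
  below on the range of \<open>F\<close>, which forces \<open>\<tau> F \<le> \<tau> E' = \<tau> E\<close> (\<open>minimal_prj_tr_le\<close>). Hence there are two
  cases. Without minimal projections every projection has subprojections of every smaller
  trace. Otherwise all minimal projections have one trace, and the traces of all projections are
  its integer multiples. The predicate \<open>admissible\<close> treats both cases at once, and
  \<open>sub_prj_of_trace\<close> cuts a projection at any admissible trace.

  Operators are studied through the real inner product \<open>Re \<langle>x, y\<rangle>\<close>. Adjoints and projections onto
  closed subspaces come from nearest points in Hilbert space, square roots from an iteration that
  converges in norm, and membership in the algebra from the double commutant.
\<close>

section \<open>Nearest points and adjoints in a Hilbert space\<close>

text \<open>
  By the parallelogram law, vectors of \<open>V\<close> whose distance to \<open>x\<close> is nearly minimal are close to each
  other, so a minimizing sequence converges. The difference of \<open>x\<close> and the limit is orthogonal to \<open>V\<close>,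
  since otherwise a step along \<open>V\<close> would come closer.
\<close>

lemma closed_subspace_orthogonal_projection:
  fixes V :: "'a::{real_inner, banach} set"
  assumes V: "subspace V" "closed V"
  shows "\<exists>p\<in>V. \<forall>v\<in>V. inner (x - p) v = 0"
proof -
  define d where "d = infdist x V"
  have ne: "V \<noteq> {}" using V(1) subspace_0 by blast
  have d0: "0 \<le> d" by (simp add: d_def infdist_nonneg)
  have dle: "d \<le> norm (x - v)" if "v \<in> V" for v
    using infdist_le[OF that, of x] by (simp add: d_def dist_norm)
  have "\<exists>v\<in>V. norm (x - v) < d + inverse (real (Suc n))" for n
  proof -
    have "(INF v\<in>V. dist x v) < d + inverse (real (Suc n))"
      using ne by (simp add: d_def infdist_def del: of_nat_Suc)
    then show ?thesis
      using ne by (subst (asm) cINF_less_iff) (auto simp: dist_norm intro!: bdd_belowI2[of _ 0])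
  qed
  then obtain v where vV: "\<And>n. v n \<in> V"
    and vd: "\<And>n. norm (x - v n) < d + inverse (real (Suc n))" by metis
  have close: "(norm (a - b))\<^sup>2 \<le> 8 * d * e + 4 * e\<^sup>2"
    if "a \<in> V" "b \<in> V" "norm (x - a) \<le> d + e" "norm (x - b) \<le> d + e" for a b e
  proof -
    have "(1/2) *\<^sub>R (a + b) \<in> V" using V(1) that by (simp add: subspace_add subspace_scale)
    then have "d \<le> norm (x - (1/2) *\<^sub>R (a + b))" by (rule dle)
    then have "d\<^sup>2 \<le> (norm (x - (1/2) *\<^sub>R (a + b)))\<^sup>2" using d0 by (intro power_mono)
    moreover have "(norm (a - b))\<^sup>2 =
        2 * (norm (x - a))\<^sup>2 + 2 * (norm (x - b))\<^sup>2 - 4 * (norm (x - (1/2) *\<^sub>R (a + b)))\<^sup>2"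
      by (simp add: power2_norm_eq_inner inner_diff_left inner_diff_right inner_add_left
          inner_add_right inner_commute algebra_simps)
    moreover have "(norm (x - a))\<^sup>2 \<le> (d + e)\<^sup>2" "(norm (x - b))\<^sup>2 \<le> (d + e)\<^sup>2"
      using that by (auto intro!: power_mono)
    ultimately have "(norm (a - b))\<^sup>2 \<le> 4 * (d + e)\<^sup>2 - 4 * d\<^sup>2" by linarith
    then show ?thesis by (simp add: power2_eq_square algebra_simps)
  qed
  have "Cauchy v"
  proof (rule CauchyI)
    fix r :: real assume r: "0 < r"
    \<comment> \<open>chosen so that \<open>8 d e + 4 e\<^sup>2 < r\<^sup>2\<close>\<close>
    define e where "e = min 1 (r\<^sup>2 / (8 * d + 5))"
    have "e \<le> r\<^sup>2 / (8 * d + 5)" by (simp add: e_def)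
    then have "e * (8 * d + 5) \<le> r\<^sup>2"
      using d0 pos_le_divide_eq[of "8 * d + 5" e "r\<^sup>2"] by simp
    moreover have "0 < e" "e \<le> 1" using r d0 by (simp_all add: e_def)
    ultimately have e: "0 < e" "e \<le> 1" "e * (8 * d + 5) \<le> r\<^sup>2" by simp_all
    obtain K where K: "inverse (real (Suc K)) < e" using reals_Archimedean[OF e(1)] by blast
    have near: "norm (x - v n) \<le> d + e" if "n \<ge> K" for n
    proof -
      have "inverse (real (Suc n)) \<le> inverse (real (Suc K))"
        using that by (intro le_imp_inverse_le) auto
      then show ?thesis using vd[of n] K by linarith
    qed
    have "norm (v m - v n) < r" if "m \<ge> K" "n \<ge> K" for m n
    proof -
      have "(norm (v m - v n))\<^sup>2 \<le> 8 * d * e + 4 * e\<^sup>2"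
        using close[OF vV vV near near] that by blast
      also have "\<dots> \<le> 8 * d * e + 4 * e"
        using e by (simp add: power2_eq_square mult_left_le)
      also have "\<dots> < e * (8 * d + 5)" using e by (simp add: algebra_simps)
      finally have "(norm (v m - v n))\<^sup>2 < r\<^sup>2" using e(3) by linarith
      then show ?thesis using r by (simp add: power_less_imp_less_base)
    qed
    then show "\<exists>K. \<forall>m\<ge>K. \<forall>n\<ge>K. norm (v m - v n) < r" by blast
  qed
  then obtain p where lim: "v \<longlonglongrightarrow> p" using Cauchy_convergent convergent_def by blast
  have pV: "p \<in> V" using V(2) vV lim closed_sequentially by blast
  have "(\<lambda>n. d + inverse (real (Suc n))) \<longlonglongrightarrow> d + 0"
    by (intro tendsto_intros LIMSEQ_inverse_real_of_nat)
  moreover have "(\<lambda>n. norm (x - v n)) \<longlonglongrightarrow> norm (x - p)" using lim by (intro tendsto_intros)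
  ultimately have npd: "norm (x - p) \<le> d"
    using LIMSEQ_le[of "\<lambda>n. norm (x - v n)" _ "\<lambda>n. d + inverse (real (Suc n))" "d + 0"] vd
    by (auto intro: less_imp_le)
  have "inner (x - p) w = 0" if w: "w \<in> V" for w
  proof (cases "w = 0")
    case False
    \<comment> \<open>\<open>c\<close> minimizes the distance of \<open>x\<close> to \<open>p + c w\<close>\<close>
    define c where "c = inner (x - p) w / inner w w"
    have "p + c *\<^sub>R w \<in> V" using V(1) pV w by (simp add: subspace_add subspace_scale)
    then have "norm (x - p) \<le> norm (x - (p + c *\<^sub>R w))" using dle npd by fastforce
    then have "(norm (x - p))\<^sup>2 \<le> (norm ((x - p) - c *\<^sub>R w))\<^sup>2"
      by (intro power_mono) (auto simp: algebra_simps)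
    also have "\<dots> = (norm (x - p))\<^sup>2 - 2 * c * inner (x - p) w + c * (c * inner w w)"
      by (simp add: power2_norm_eq_inner inner_diff_left inner_diff_right inner_commute
          algebra_simps)
    also have "c * inner w w = inner (x - p) w" using False by (simp add: c_def)
    finally have "c * inner (x - p) w \<le> 0" by simp
    moreover have "c * inner (x - p) w = (inner (x - p) w)\<^sup>2 / inner w w"
      by (simp add: c_def power2_eq_square)
    ultimately have "(inner (x - p) w)\<^sup>2 / inner w w \<le> 0" by simp
    moreover have "inner w w > 0" using False by simp
    ultimately have "(inner (x - p) w)\<^sup>2 \<le> 0" by (simp add: divide_le_0_iff)
    then show ?thesis by simp
  qed simp
  then show ?thesis using pV by blast
qed

text \<open>
  The representing vector is orthogonal to the kernel of \<open>f\<close>.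
\<close>

lemma riesz_representation:
  fixes f :: "'a::{real_inner, banach} \<Rightarrow> real"
  assumes f: "bounded_linear f"
  shows "\<exists>y. \<forall>x. f x = inner x y"
proof (cases "\<forall>x. f x = 0")
  case True
  then show ?thesis by (intro exI[of _ 0]) simp
next
  case False
  interpret f: bounded_linear f by fact
  let ?V = "{x. f x = 0}"
  have V: "subspace ?V"
    by (auto simp: subspace_def f.add f.scale f.zero)
  have "closed ?V" 
    by (intro closed_Collect_eq continuous_intros f.continuous_on)
  obtain x0 where x0: "f x0 \<noteq> 0" using False by blast
  obtain p where p: "f p = 0" "\<And>v. f v = 0 \<Longrightarrow> inner (x0 - p) v = 0"
    using closed_subspace_orthogonal_projection[OF V \<open>closed ?V\<close>, of x0] by auto
  define w where "w = x0 - p"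
  have fw: "f w \<noteq> 0" using x0 p by (simp add: w_def f.diff)
  then have w0: "inner w w > 0" using f.zero by auto
  have "f x = inner x ((f w / inner w w) *\<^sub>R w)" for x
  proof -
    have "f (x - (f x / f w) *\<^sub>R w) = 0" using fw by (simp add: f.diff f.scale)
    then have "inner w (x - (f x / f w) *\<^sub>R w) = 0" using p(2) by (simp add: w_def)
    then have "inner w x = f x / f w * inner w w" by (simp add: inner_diff_right)
    then show ?thesis using fw w0 by (simp add: inner_commute)
  qed
  then show ?thesis by blast
qed

lemma real_adjoint_exists:
  fixes A :: "'a::{real_inner, banach} \<Rightarrow>\<^sub>L 'a"
  shows "\<exists>B :: 'a \<Rightarrow>\<^sub>L 'a. \<forall>x y. inner (A x) y = inner x (B y)"
proof -
  have "\<exists>z. \<forall>x. inner (A x) y = inner x z" for y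
    by (intro riesz_representation bounded_linear_compose[OF bounded_linear_inner_left]
        blinfun.bounded_linear_right)
  then obtain b where b: "\<And>x y. inner (A x) y = inner x (b y)" by metis
  have eq: "u = v" if "\<And>x. inner x u = inner x v" for u v :: 'a
    using that vector_eq_ldot by blast
  have "bounded_linear b"
  proof (rule bounded_linear_intro)
    show "b (x + y) = b x + b y" for x y
      by (rule eq) (simp add: inner_add_right b[symmetric])
    show "b (r *\<^sub>R x) = r *\<^sub>R b x" for r x
      by (rule eq) (simp add: b[symmetric])
    show "norm (b x) \<le> norm x * norm A" for x
    proof (cases "b x = 0")
      case False
      have "(norm (b x))\<^sup>2 = inner (A (b x)) x" by (simp add: b power2_norm_eq_inner)
      also have "\<dots> \<le> norm (A (b x)) * norm x" by (rule norm_cauchy_schwarz)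
      also have "\<dots> \<le> (norm A * norm (b x)) * norm x"
        by (intro mult_right_mono norm_blinfun) auto
      finally show ?thesis using False by (simp add: power2_eq_square algebra_simps)
    qed (simp add: norm_ge_zero)
  qed
  then have "\<forall>x y. inner (A x) y = inner x (Blinfun b y)"
    by (simp add: b bounded_linear_Blinfun_apply)
  then show ?thesis by blast
qed

section \<open>Complex structure, adjoints and positivity\<close>

lemma scaleC_eq_scaleR: "c *\<^sub>C x = Re c *\<^sub>R x + Im c *\<^sub>R (\<i> *\<^sub>C (x :: 'a::complex_hilbert))"
proof -
  have "c = complex_of_real (Re c) + complex_of_real (Im c) * \<i>"
    by (simp add: complex_eq_iff)
  then have "c *\<^sub>C x = (complex_of_real (Re c) + complex_of_real (Im c) * \<i>) *\<^sub>C x" by (rule arg_cong)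
  then show ?thesis by (simp only: scaleC_add_left scaleC_scaleC[symmetric] scaleC_complex_of_real)
qed

text \<open>
  The real inner product determines the complex one. A real-linear operator is complex-linear when it
  commutes with multiplication by \<open>\<i>\<close>, so adjoints and self-adjointness can be treated entirely with the
  real inner product.
\<close>

lemma inner_i_right: "inner x (\<i> *\<^sub>C y) = Im (cinner x (y :: 'a::complex_hilbert))"
  using cinner_commute[of x "\<i> *\<^sub>C y"] cinner_commute[of x y]
  by (simp add: inner_eq_Re_cinner cinner_scaleC_left)

lemma inner_i_left: "inner (\<i> *\<^sub>C x) y = - inner x (\<i> *\<^sub>C (y :: 'a::complex_hilbert))"
  by (simp add: inner_i_right) (simp add: inner_eq_Re_cinner cinner_scaleC_left)

lemma i_i: "\<i> *\<^sub>C \<i> *\<^sub>C x = - (x :: 'a::complex_hilbert)"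
  using scaleC_complex_of_real[of "-1" x] by (simp add: scaleC_scaleC)

lemma scaleC_simps:
  fixes x y :: "'a::complex_hilbert"
  shows "c *\<^sub>C (0::'a) = 0" "c *\<^sub>C (- x) = - (c *\<^sub>C x)" "c *\<^sub>C (x - y) = c *\<^sub>C x - c *\<^sub>C y"
    "c *\<^sub>C (r *\<^sub>R x) = r *\<^sub>R (c *\<^sub>C x)"
proof -
  have "linear (\<lambda>x::'a. c *\<^sub>C x)" by (rule bounded_linear_scaleC[THEN bounded_linear.linear])
  from linear_0[OF this] linear_neg[OF this] linear_diff[OF this] linear_scale[OF this]
  show "c *\<^sub>C (0::'a) = 0" "c *\<^sub>C (- x) = - (c *\<^sub>C x)" "c *\<^sub>C (x - y) = c *\<^sub>C x - c *\<^sub>C y"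
    "c *\<^sub>C (r *\<^sub>R x) = r *\<^sub>R (c *\<^sub>C x)" by auto
qed

lemma cinner_eq: "cinner x y = Complex (inner x y) (inner x (\<i> *\<^sub>C (y :: 'a::complex_hilbert)))"
  by (simp add: complex_eq_iff inner_i_right) (simp add: inner_eq_Re_cinner)

lemma clinear_op_iff: "clinear_op A \<longleftrightarrow> (\<forall>x. A (\<i> *\<^sub>C x) = \<i> *\<^sub>C A x)"
proof
  assume A: "\<forall>x. A (\<i> *\<^sub>C x) = \<i> *\<^sub>C A x"
  have "A (c *\<^sub>C x) = c *\<^sub>C A x" for c x
    by (subst (1 2) scaleC_eq_scaleR[of c]) (simp add: A blinfun.bilinear_simps)
  then show "clinear_op A" by (simp add: clinear_op_def)
qed (simp add: clinear_op_def)

lemma clinear_op_intros: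
  "clinear_op id_blinfun" "clinear_op 0"
  "clinear_op A \<Longrightarrow> clinear_op B \<Longrightarrow> clinear_op (A + B)"
  "clinear_op A \<Longrightarrow> clinear_op B \<Longrightarrow> clinear_op (A - B)"
  "clinear_op A \<Longrightarrow> clinear_op B \<Longrightarrow> clinear_op (A o\<^sub>L B)"
  "clinear_op A \<Longrightarrow> clinear_op (scaleC_op c A)"
  by (auto simp: clinear_op_def blinfun.add_left blinfun.diff_left scaleC_add_right scaleC_simps
      scaleC_op_apply scaleC_scaleC mult.commute)

lemma adjoint_inner:
  assumes A: "clinear_op A"
  shows "inner (A x) y = inner x (op_adjoint A y)"
proof -
  obtain B :: "'a op" where B: "\<And>x y. inner (A x) y = inner x (B y)"
    using real_adjoint_exists by metis
  have "cinner (A x) y = cinner x (B y)" for x y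
  proof -
    have "inner (A x) (\<i> *\<^sub>C y) = - inner (A (\<i> *\<^sub>C x)) y"
      using A by (simp add: clinear_op_iff inner_i_left)
    then show ?thesis by (simp add: cinner_eq B inner_i_left)
  qed
  moreover have "C = B" if "\<forall>x y. cinner (A x) y = cinner x (C y)" for C :: "'a op"
  proof (rule blinfun_eqI)
    fix y
    have "inner x (C y) = inner x (B y)" for x
      using that by (metis B inner_eq_Re_cinner)
    then show "C y = B y" using vector_eq_ldot by blast
  qed
  ultimately have "op_adjoint A = B" unfolding op_adjoint_def by (intro the_equality) auto
  then show ?thesis by (simp add: B)
qed

lemma adjoint_unique:
  fixes A B :: "'a::complex_hilbert op"
  assumes "clinear_op A" "\<And>x y. inner (A x) y = inner x (B y)"
  shows "op_adjoint A = B"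
proof (rule blinfun_eqI)
  fix y
  show "op_adjoint A y = B y"
    using assms adjoint_inner[OF assms(1)] by (metis vector_eq_ldot)
qed

lemma adjoint_inner_right:
  assumes A: "clinear_op A"
  shows "inner x (A y) = inner (op_adjoint A x) y"
  using adjoint_inner[OF A, of y x] by (simp add: inner_commute)

lemma clinear_adjoint:
  assumes A: "clinear_op A"
  shows "clinear_op (op_adjoint A)"
  unfolding clinear_op_iff
proof
  fix y
  have "inner x (op_adjoint A (\<i> *\<^sub>C y)) = inner x (\<i> *\<^sub>C op_adjoint A y)" for x
  proof -
    have "inner x (op_adjoint A (\<i> *\<^sub>C y)) = inner (A x) (\<i> *\<^sub>C y)" by (simp add: adjoint_inner[OF A])
    also have "\<dots> = - inner (A (\<i> *\<^sub>C x)) y" using A by (simp add: inner_i_left clinear_op_iff)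
    also have "\<dots> = inner x (\<i> *\<^sub>C op_adjoint A y)" by (simp add: adjoint_inner[OF A] inner_i_left)
    finally show ?thesis .
  qed
  then show "op_adjoint A (\<i> *\<^sub>C y) = \<i> *\<^sub>C op_adjoint A y" using vector_eq_ldot by blast
qed

definition selfadjoint :: "'h::real_inner op \<Rightarrow> bool"
  where "selfadjoint A \<longleftrightarrow> (\<forall>x y. inner (A x) y = inner x (A y))"

lemma selfadjointD: "selfadjoint A \<Longrightarrow> inner (A x) y = inner x (A y)"
  by (simp add: selfadjoint_def)

lemma selfadjoint_iff: "clinear_op A \<Longrightarrow> selfadjoint A \<longleftrightarrow> op_adjoint A = A"
  by (metis adjoint_inner adjoint_unique selfadjoint_def)

lemma selfadjoint_intros:
  "selfadjoint id_blinfun" "selfadjoint 0"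
  "selfadjoint A \<Longrightarrow> selfadjoint B \<Longrightarrow> selfadjoint (A + B)"
  "selfadjoint A \<Longrightarrow> selfadjoint B \<Longrightarrow> selfadjoint (A - B)"
  "selfadjoint A \<Longrightarrow> selfadjoint (- A)"
  "selfadjoint A \<Longrightarrow> selfadjoint (r *\<^sub>R A)"
  by (auto simp: selfadjoint_def blinfun.bilinear_simps inner_add_left inner_add_right inner_diff_left
      inner_diff_right)

lemma selfadjoint_sum: "(\<And>i. i \<in> I \<Longrightarrow> selfadjoint (f i)) \<Longrightarrow> selfadjoint (\<Sum>i\<in>I. f i)"
  by (induction I rule: infinite_finite_induct) (auto intro: selfadjoint_intros)

lemma selfadjoint_compose_commute:
  assumes "selfadjoint A" "selfadjoint B" "A o\<^sub>L B = B o\<^sub>L A"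
  shows "selfadjoint (A o\<^sub>L B)"
  using assms by (metis (no_types, lifting) blinfun_apply_blinfun_compose selfadjoint_def)

lemma selfadjoint_sandwich:
  assumes "selfadjoint A" "selfadjoint B"
  shows "selfadjoint (A o\<^sub>L B o\<^sub>L A)"
  using assms by (simp add: selfadjoint_def)

lemma selfadjoint_adjoint_compose:
  assumes "clinear_op A"
  shows "selfadjoint (op_adjoint A o\<^sub>L A)"
  unfolding selfadjoint_def
  by (simp add: adjoint_inner[OF assms, symmetric] adjoint_inner_right[OF assms, symmetric])

lemma quadratic_form_zero_imp_antisymmetric:
  fixes A :: "'a::real_inner \<Rightarrow>\<^sub>L 'a"
  assumes "\<And>x. inner (A x) x = 0"
  shows "inner (A x) y = - inner (A y) x"
  using assms[of "x + y"] by (simp add: blinfun.add_right inner_add_left inner_add_right assms)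

text \<open>
  If \<open>\<langle>A x, x\<rangle>\<close> is real for all \<open>x\<close>, the real quadratic form of \<open>A \<i>\<close> vanishes, so its bilinear form is
  antisymmetric; substituting \<open>\<i> x\<close> turns this into the symmetry of \<open>A\<close>.
\<close>

lemma positive_op_iff:
  "positive_op A \<longleftrightarrow> clinear_op A \<and> selfadjoint A \<and> (\<forall>x. 0 \<le> inner (A x) x)"
proof -
  have eq: "cinner (A x) x \<in> \<real>\<^sub>\<ge>\<^sub>0 \<longleftrightarrow> inner (A x) x \<ge> 0 \<and> inner (A x) (\<i> *\<^sub>C x) = 0" for x
    by (simp add: complex_nonneg_Reals_iff cinner_eq)
  have sa: "selfadjoint A"
    if A: "clinear_op A" and z: "\<And>x. inner (A x) (\<i> *\<^sub>C x) = 0"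
  proof -
    define J :: "'a op" where "J = scaleC_op \<i> id_blinfun"
    have J: "J x = \<i> *\<^sub>C x" for x by (simp add: J_def scaleC_op_apply)
    have AJ: "A (J x) = \<i> *\<^sub>C A x" for x using A by (simp add: J clinear_op_iff)
    have "inner ((A o\<^sub>L J) x) x = 0" for x using z[of x] by (simp add: AJ inner_i_left)
    then have *: "inner (A (J x)) y = - inner (A (J y)) x" for x y
      using quadratic_form_zero_imp_antisymmetric[of "A o\<^sub>L J" x y] by simp
    have "inner (A x) y = inner x (A y)" for x y
    proof -
      have "inner (A x) y = - inner (A (J (J x))) y" by (simp add: J i_i blinfun.minus_right)
      also have "\<dots> = inner (A (J y)) (J x)" using *[of "J x" y] by simp
      also have "\<dots> = inner (\<i> *\<^sub>C A y) (\<i> *\<^sub>C x)" by (simp only: AJ J[of x])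
      also have "\<dots> = inner (A y) x" by (simp add: inner_i_left i_i)
      finally show ?thesis by (simp add: inner_commute)
    qed
    then show ?thesis by (simp add: selfadjoint_def)
  qed
  have im: "inner (A x) (\<i> *\<^sub>C x) = 0" if A: "clinear_op A" "selfadjoint A" for x
  proof -
    have "inner (A x) (\<i> *\<^sub>C x) = inner x (A (\<i> *\<^sub>C x))" by (rule selfadjointD[OF A(2)])
    also have "\<dots> = inner x (\<i> *\<^sub>C A x)" using A(1) by (simp add: clinear_op_iff)
    also have "\<dots> = - inner (\<i> *\<^sub>C x) (A x)" using inner_i_left[of x "A x"] by simp
    also have "\<dots> = - inner (A x) (\<i> *\<^sub>C x)" by (simp only: inner_commute)
    finally show ?thesis by simp
  qed
  show ?thesis
  proof
    assume "positive_op A"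
    then have A: "clinear_op A" "\<forall>x. inner (A x) x \<ge> 0 \<and> inner (A x) (\<i> *\<^sub>C x) = 0"
      by (simp_all add: positive_op_def eq)
    moreover have "selfadjoint A" using A by (intro sa) auto
    ultimately show "clinear_op A \<and> selfadjoint A \<and> (\<forall>x. 0 \<le> inner (A x) x)" by simp
  next
    assume "clinear_op A \<and> selfadjoint A \<and> (\<forall>x. 0 \<le> inner (A x) x)"
    then show "positive_op A" using im by (simp add: positive_op_def eq)
  qed
qed

lemma positive_opD:
  "positive_op A \<Longrightarrow> clinear_op A" "positive_op A \<Longrightarrow> selfadjoint A"
  "positive_op A \<Longrightarrow> 0 \<le> inner (A x) x"
  by (simp_all add: positive_op_iff)

lemma positive_op_adjoint_compose:
  assumes "clinear_op A"
  shows "positive_op (op_adjoint A o\<^sub>L A)"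
  by (simp add: positive_op_iff clinear_op_intros assms clinear_adjoint selfadjoint_adjoint_compose
      adjoint_inner_right[OF assms, symmetric])

text \<open>
  Polarization bounds \<open>\<langle>A x, y\<rangle>\<close> by \<open>c\<close> times the mean of \<open>\<parallel>x\<parallel>\<^sup>2\<close> and \<open>\<parallel>y\<parallel>\<^sup>2\<close>. The bound is applied to the
  multiple \<open>y\<close> of \<open>A x\<close> with \<open>\<parallel>y\<parallel> = \<parallel>x\<parallel>\<close>.
\<close>

lemma norm_selfadjoint_le:
  fixes A :: "'a::real_inner op"
  assumes A: "selfadjoint A" and c: "\<And>x. \<bar>inner (A x) x\<bar> \<le> c * (norm x)\<^sup>2" and c0: "0 \<le> c"
  shows "norm A \<le> c"
proof (rule norm_blinfun_bound[OF c0])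
  fix x
  have bil: "2 * inner (A x) y \<le> c * ((norm x)\<^sup>2 + (norm y)\<^sup>2)" for x y
  proof -
    have "4 * inner (A x) y = inner (A (x + y)) (x + y) - inner (A (x - y)) (x - y)"
      using A by (simp add: selfadjoint_def blinfun.bilinear_simps inner_add_left inner_add_right
          inner_diff_left inner_diff_right) (metis inner_commute)
    also have "\<dots> \<le> c * (norm (x + y))\<^sup>2 + c * (norm (x - y))\<^sup>2"
      using c[of "x + y"] c[of "x - y"] by linarith
    also have "\<dots> = 2 * (c * ((norm x)\<^sup>2 + (norm y)\<^sup>2))"
      by (simp add: power2_norm_eq_inner inner_add_left inner_add_right
          inner_diff_left inner_diff_right algebra_simps)
    finally show ?thesis by simp
  qed
  show "norm (A x) \<le> c * norm x"
  proof (cases "A x = 0")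
    case False
    then have x0: "x \<noteq> 0" by (auto simp: blinfun.zero_right)
    let ?r = "norm x / norm (A x)"
    have "2 * (?r * (norm (A x))\<^sup>2) \<le> c * ((norm x)\<^sup>2 + (norm (?r *\<^sub>R A x))\<^sup>2)"
      using bil[of x "?r *\<^sub>R A x"] by (simp add: power2_norm_eq_inner)
    also have "norm (?r *\<^sub>R A x) = norm x" using False by simp
    also have "?r * (norm (A x))\<^sup>2 = norm x * norm (A x)" using False by (simp add: power2_eq_square)
    finally have "norm x * norm (A x) \<le> norm x * (c * norm x)"
      by (simp add: power2_eq_square algebra_simps)
    then show ?thesis using x0 by simp
  qed (simp add: c0)
qed

section \<open>Square roots, absolute values and spectral projections\<close>

lemma scaleR_eq_scaleC_op: "r *\<^sub>R A = scaleC_op (complex_of_real r) A"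
  by (rule blinfun_eqI) (simp add: scaleC_op_apply scaleC_complex_of_real blinfun.scaleR_left)

lemma clinear_op_scaleR: "clinear_op A \<Longrightarrow> clinear_op (r *\<^sub>R A)"
  by (simp add: scaleR_eq_scaleC_op clinear_op_intros)

lemma clinear_op_limit:
  assumes "Y \<longlonglongrightarrow> L" "\<And>n. clinear_op (Y n)"
  shows "clinear_op L"
  unfolding clinear_op_def
proof (intro allI)
  fix c x
  have "(\<lambda>n. Y n (c *\<^sub>C x)) \<longlonglongrightarrow> L (c *\<^sub>C x)" "(\<lambda>n. c *\<^sub>C Y n x) \<longlonglongrightarrow> c *\<^sub>C L x"
    using assms(1)
    by (auto intro!: tendsto_intros bounded_linear.tendsto[OF bounded_linear_scaleC])
  moreover have "(\<lambda>n. Y n (c *\<^sub>C x)) = (\<lambda>n. c *\<^sub>C Y n x)"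
    using assms(2) by (simp add: clinear_op_def)
  ultimately show "L (c *\<^sub>C x) = c *\<^sub>C L x" using LIMSEQ_unique by metis
qed

lemma selfadjoint_limit:
  assumes "Y \<longlonglongrightarrow> L" "\<And>n. selfadjoint (Y n)"
  shows "selfadjoint L"
  unfolding selfadjoint_def
proof (intro allI)
  fix x y
  have "(\<lambda>n. inner (Y n x) y) \<longlonglongrightarrow> inner (L x) y" "(\<lambda>n. inner x (Y n y)) \<longlonglongrightarrow> inner x (L y)"
    using assms(1) by (auto intro!: tendsto_intros)
  moreover have "(\<lambda>n. inner (Y n x) y) = (\<lambda>n. inner x (Y n y))"
    using assms(2) by (auto simp: selfadjointD)
  ultimately show "inner (L x) y = inner x (L y)" using LIMSEQ_unique by metis
qed

lemma commute_limit:
  assumes "Y \<longlonglongrightarrow> L" "\<And>n. X o\<^sub>L Y n = Y n o\<^sub>L X"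
  shows "X o\<^sub>L L = L o\<^sub>L X"
proof -
  have "(\<lambda>n. X o\<^sub>L Y n) \<longlonglongrightarrow> (X o\<^sub>L L)" "(\<lambda>n. Y n o\<^sub>L X) \<longlonglongrightarrow> (L o\<^sub>L X)"
    using assms(1) by (auto intro!: bounded_bilinear.tendsto[OF bounded_bilinear_blinfun_compose])
  moreover have "(\<lambda>n. X o\<^sub>L Y n) = (\<lambda>n. Y n o\<^sub>L X)" by (rule ext) (rule assms(2))
  ultimately show ?thesis using LIMSEQ_unique by metis
qed

lemma positive_op_intros:
  "positive_op id_blinfun" "positive_op 0"
  "positive_op A \<Longrightarrow> positive_op B \<Longrightarrow> positive_op (A + B)"
  "positive_op A \<Longrightarrow> 0 \<le> r \<Longrightarrow> positive_op (r *\<^sub>R A)"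
  by (auto simp: positive_op_iff selfadjoint_intros clinear_op_intros clinear_op_scaleR
      blinfun.bilinear_simps inner_add_left)

lemma commute_apply: "A o\<^sub>L B = B o\<^sub>L A \<Longrightarrow> A (B x) = B (A x)"
  by (metis blinfun_apply_blinfun_compose)

lemma inner_le_norm_op:
  fixes A :: "'a::real_inner op"
  shows "inner (A x) x \<le> norm A * (norm x)\<^sup>2"
proof -
  have "inner (A x) x \<le> norm (A x) * norm x" by (rule norm_cauchy_schwarz)
  also have "\<dots> \<le> (norm A * norm x) * norm x" by (intro mult_right_mono norm_blinfun) auto
  finally show ?thesis by (simp add: power2_eq_square algebra_simps)
qed

text \<open>
  For \<open>0 \<le> A \<le> 1\<close> the root is \<open>1 - Y\<close>, where \<open>Y\<close> solves \<open>Y = (K + Y\<^sup>2) / 2\<close> with \<open>K = 1 - A\<close>. The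
  fixed point iteration started at \<open>0\<close> converges in norm, because its increments are dominated by
  those of the scalar iteration for \<open>K = 1\<close>, an increasing sequence bounded by \<open>1\<close>. Norm
  convergence keeps the root in every norm closed algebra that contains \<open>A\<close>.
\<close>

lemma contraction_sqrt_exists:
  fixes A :: "'h::complex_hilbert op"
  assumes A: "positive_op A" and n1: "norm A \<le> 1"
  shows "\<exists>B. positive_op B \<and> B o\<^sub>L B = A \<and> (\<forall>X. X o\<^sub>L A = A o\<^sub>L X \<longrightarrow> X o\<^sub>L B = B o\<^sub>L X)"
proof -
  define K where "K = id_blinfun - A"
  have sK: "selfadjoint K" "clinear_op K"
    using A by (auto simp: K_def positive_op_iff intro: selfadjoint_intros clinear_op_intros)
  have nK: "norm K \<le> 1"
  proof (rule norm_selfadjoint_le[OF sK(1)])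
    fix x
    have "inner (A x) x \<le> (norm x)\<^sup>2"
      using inner_le_norm_op[of A x] n1 mult_right_mono[OF n1, of "(norm x)\<^sup>2"] by simp
    moreover have "inner (K x) x = (norm x)\<^sup>2 - inner (A x) x"
      by (simp add: K_def blinfun.diff_left inner_diff_left power2_norm_eq_inner)
    moreover have "0 \<le> inner (A x) x" using A by (rule positive_opD)
    ultimately show "\<bar>inner (K x) x\<bar> \<le> 1 * (norm x)\<^sup>2" by simp
  qed simp
  define a :: "nat \<Rightarrow> real" where "a = rec_nat 0 (\<lambda>_ z. (1 + z\<^sup>2) / 2)"
  define Y where "Y = rec_nat 0 (\<lambda>_ Z. (1 / 2) *\<^sub>R (K + (Z o\<^sub>L Z)))"
  have a: "a 0 = 0" "a (Suc n) = (1 + (a n)\<^sup>2) / 2" for n by (simp_all add: a_def)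
  have Y: "Y 0 = 0" "Y (Suc n) = (1 / 2) *\<^sub>R (K + (Y n o\<^sub>L Y n))" for n by (simp_all add: Y_def)
  have a01: "0 \<le> a n \<and> a n \<le> 1" for n
  proof (induction n)
    case (Suc n)
    then have "(a n)\<^sup>2 \<le> 1" by (simp add: power_le_one)
    then show ?case by (simp add: a)
  qed (simp add: a)
  have "a (Suc n) - a n = (1 - a n)\<^sup>2 / 2" for n by (simp add: a power2_eq_square field_simps)
  then have "a n \<le> a (Suc n)" for n by (smt (verit) zero_le_power2 field_sum_of_halves)
  then have inca: "incseq a" by (rule incseq_SucI)
  have nY: "norm (Y n) \<le> a n" for n
  proof (induction n)
    case (Suc n)
    have "norm (Y n o\<^sub>L Y n) \<le> norm (Y n) * norm (Y n)" by (rule norm_blinfun_compose)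
    also have "\<dots> \<le> a n * a n" using Suc a01 by (intro mult_mono) auto
    finally have "norm (K + (Y n o\<^sub>L Y n)) \<le> 1 + (a n)\<^sup>2"
      using nK norm_triangle_ineq[of K "Y n o\<^sub>L Y n"] unfolding power2_eq_square by linarith
    then show ?case by (simp add: Y a)
  qed (simp add: Y a)
  have commY: "X o\<^sub>L Y n = Y n o\<^sub>L X" if X: "X o\<^sub>L K = K o\<^sub>L X" for X n
  proof (induction n)
    case (Suc n)
    have "X (K x) = K (X x)" "X (Y n x) = Y n (X x)" for x
      using commute_apply[OF X] commute_apply[OF Suc] by auto
    then show ?case by (intro blinfun_eqI) (simp add: Y blinfun.bilinear_simps)
  qed (simp add: Y)
  have YY: "Y m o\<^sub>L Y n = Y n o\<^sub>L Y m" for m n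
    using commY commY[of K] by metis
  have inc: "norm (Y (Suc n) - Y n) \<le> a (Suc n) - a n" for n
  proof (induction n)
    case 0
    then show ?case using nK by (simp add: Y a)
  next
    case (Suc n)
    have c: "Y n (Y (Suc n) x) = Y (Suc n) (Y n x)" for x using commute_apply[OF YY] .
    have "Y (Suc (Suc n)) - Y (Suc n) =
        (1/2) *\<^sub>R ((Y (Suc n) - Y n) o\<^sub>L (Y (Suc n) + Y n))"
      by (rule blinfun_eqI)
        (simp only: Y(2)[of "Suc n"] Y(2)[of n, symmetric] c blinfun.bilinear_simps
          blinfun_apply_blinfun_compose, subst Y(2)[of n],
          simp add: c[unfolded Y(2)] blinfun.bilinear_simps algebra_simps)
    then have "norm (Y (Suc (Suc n)) - Y (Suc n)) \<le>
        (1/2) * (norm (Y (Suc n) - Y n) * norm (Y (Suc n) + Y n))"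
      by (simp add: norm_blinfun_compose)
    also have "\<dots> \<le> (1/2) * ((a (Suc n) - a n) * (a (Suc n) + a n))"
      using Suc nY[of "Suc n"] nY[of n] norm_triangle_ineq[of "Y (Suc n)" "Y n"] inca
      by (intro mult_left_mono mult_mono) (auto simp: incseq_Suc_iff)
    also have "\<dots> = a (Suc (Suc n)) - a (Suc n)"
      by (simp add: a(2)[of "Suc n"]) (simp add: a(2)[of n] power2_eq_square field_simps)
    finally show ?case .
  qed
  have diff: "norm (Y m - Y n) \<le> a m - a n" if "n \<le> m" for m n
    using that
  proof (induction rule: dec_induct)
    case (step m)
    then show ?case using inc[of m] norm_triangle_ineq[of "Y (Suc m) - Y m" "Y m - Y n"] by simp
  qed simp
  have "convergent a"
    using a01 inca by (intro Bseq_monoseq_convergent BseqI'[of _ 1] incseq_imp_monoseq) auto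
  then have Ca: "Cauchy a" by (rule convergent_Cauchy)
  have "Cauchy Y"
  proof (rule CauchyI)
    fix e :: real assume "0 < e"
    then obtain N where N: "\<And>m n. m \<ge> N \<Longrightarrow> n \<ge> N \<Longrightarrow> norm (a m - a n) < e"
      using CauchyD[OF Ca] by blast
    have "norm (Y m - Y n) < e" if "m \<ge> N" "n \<ge> N" for m n
    proof (cases "n \<le> m")
      case True
      then show ?thesis using diff[OF True] N[OF that] by auto
    next
      case False
      then show ?thesis using diff[of m n] N[OF that] by (auto simp: norm_minus_commute)
    qed
    then show "\<exists>N. \<forall>m\<ge>N. \<forall>n\<ge>N. norm (Y m - Y n) < e" by blast
  qed
  then obtain L where L: "Y \<longlonglongrightarrow> L" using Cauchy_convergent convergent_def by blast
  have sY: "selfadjoint (Y n) \<and> clinear_op (Y n)" for n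
    using sK by (induction n)
      (auto simp: Y intro!: selfadjoint_intros clinear_op_intros clinear_op_scaleR
        selfadjoint_compose_commute)
  have sL: "selfadjoint L" "clinear_op L"
    using selfadjoint_limit[OF L] clinear_op_limit[OF L] sY by auto
  have nL: "norm L \<le> 1"
    using nY a01 by (intro LIMSEQ_le_const2[OF tendsto_norm[OF L]]) (meson order_trans)
  have "(\<lambda>n. (1 / 2) *\<^sub>R (K + (Y n o\<^sub>L Y n))) \<longlonglongrightarrow> (1 / 2) *\<^sub>R (K + (L o\<^sub>L L))"
    by (intro tendsto_intros bounded_bilinear.tendsto[OF bounded_bilinear_blinfun_compose] L)
  then have "(\<lambda>n. Y (Suc n)) \<longlonglongrightarrow> (1 / 2) *\<^sub>R (K + (L o\<^sub>L L))" by (simp only: Y)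
  then have fix_L: "L = (1 / 2) *\<^sub>R (K + (L o\<^sub>L L))" using LIMSEQ_Suc[OF L] LIMSEQ_unique by blast
  define B where "B = id_blinfun - L"
  have r1: "B o\<^sub>L B = A"
  proof (rule blinfun_eqI)
    fix x
    have "L x = (1 / 2) *\<^sub>R (K x + L (L x))"
      using fix_L by (metis blinfun.add_left blinfun.scaleR_left blinfun_apply_blinfun_compose)
    moreover have "k = 2 *\<^sub>R w - z" if "w = (1 / 2) *\<^sub>R (k + z)" for w k z :: 'h
      using that by simp
    ultimately have "K x = 2 *\<^sub>R L x - L (L x)" by blast
    moreover have "A x = x - K x" by (simp add: K_def blinfun.diff_left)
    ultimately have "A x = x - 2 *\<^sub>R L x + L (L x)" by (metis diff_diff_eq2 add_diff_eq diff_add_eq)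
    then show "(B o\<^sub>L B) x = A x"
      by (simp add: B_def blinfun.bilinear_simps scaleR_2)
  qed
  have r2: "positive_op B"
    unfolding positive_op_iff
  proof (intro conjI allI)
    show "clinear_op B" "selfadjoint B" using sL by (auto simp: B_def intro: clinear_op_intros selfadjoint_intros)
    show "0 \<le> inner (B x) x" for x
      using inner_le_norm_op[of L x] mult_right_mono[OF nL, of "(norm x)\<^sup>2"]
      by (simp add: B_def blinfun.diff_left inner_diff_left power2_norm_eq_inner)
  qed
  have r3: "X o\<^sub>L B = B o\<^sub>L X" if X: "X o\<^sub>L A = A o\<^sub>L X" for X
  proof -
    have "X (A x) = A (X x)" for x using commute_apply[OF X] .
    then have "X o\<^sub>L K = K o\<^sub>L X" by (intro blinfun_eqI) (simp add: K_def blinfun.bilinear_simps)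
    then have "X o\<^sub>L L = L o\<^sub>L X" by (intro commute_limit[OF L] commY)
    then have "X (L x) = L (X x)" for x by (rule commute_apply)
    then show ?thesis by (intro blinfun_eqI) (simp add: B_def blinfun.bilinear_simps)
  qed
  show ?thesis by (intro exI[of _ B] conjI allI impI r1 r2 r3)
qed

lemma sqrt_exists:
  fixes A :: "'h::complex_hilbert op"
  assumes A: "positive_op A"
  shows "\<exists>B. positive_op B \<and> B o\<^sub>L B = A \<and> (\<forall>X. X o\<^sub>L A = A o\<^sub>L X \<longrightarrow> X o\<^sub>L B = B o\<^sub>L X)"
proof (cases "A = 0")
  case True
  then show ?thesis by (intro exI[of _ 0]) (auto simp: positive_op_intros)
next
  case False
  define c where "c = norm A"
  have c: "c > 0" using False by (simp add: c_def)
  have "positive_op ((1 / c) *\<^sub>R A)" using A c by (intro positive_op_intros) auto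
  moreover have "norm ((1 / c) *\<^sub>R A) \<le> 1" using c by (simp add: c_def)
  ultimately obtain B where B: "positive_op B" "B o\<^sub>L B = (1 / c) *\<^sub>R A"
    "\<And>X. X o\<^sub>L ((1 / c) *\<^sub>R A) = ((1 / c) *\<^sub>R A) o\<^sub>L X \<Longrightarrow> X o\<^sub>L B = B o\<^sub>L X"
    using contraction_sqrt_exists[of "(1 / c) *\<^sub>R A"] by blast
  have BB: "B (B x) = (1 / c) *\<^sub>R A x" for x
    using B(2) by (metis blinfun.scaleR_left blinfun_apply_blinfun_compose)
  have r1: "(sqrt c *\<^sub>R B) o\<^sub>L (sqrt c *\<^sub>R B) = A"
    using c by (intro blinfun_eqI) (simp add: blinfun.bilinear_simps BB)
  have r2: "positive_op (sqrt c *\<^sub>R B)" using B(1) c by (intro positive_op_intros) auto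
  have r3: "X o\<^sub>L (sqrt c *\<^sub>R B) = (sqrt c *\<^sub>R B) o\<^sub>L X" if X: "X o\<^sub>L A = A o\<^sub>L X" for X
  proof -
    have "X (A x) = A (X x)" for x using commute_apply[OF X] .
    then have "X o\<^sub>L B = B o\<^sub>L X" by (intro B(3) blinfun_eqI) (simp add: blinfun.bilinear_simps)
    then have "X (B x) = B (X x)" for x by (rule commute_apply)
    then show ?thesis by (intro blinfun_eqI) (simp add: blinfun.bilinear_simps)
  qed
  show ?thesis by (intro exI[of _ "sqrt c *\<^sub>R B"] conjI allI impI r1 r2 r3)
qed

text \<open>
  With \<open>B = D\<^sup>2\<close> the hypothesis says \<open>\<parallel>D y\<parallel>\<^sup>2 = 0\<close>.
\<close>

lemma positive_op_null:
  assumes "positive_op B" "inner (B y) y = 0"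
  shows "B y = 0"
proof -
  obtain D where D: "positive_op D" "D o\<^sub>L D = B" using sqrt_exists[OF assms(1)] by blast
  then have DB: "D (D x) = B x" for x by auto
  have "inner (D y) (D y) = 0"
    using assms(2) D(1) by (simp add: DB[symmetric] positive_op_iff selfadjointD)
  then show ?thesis using DB[of y] by (simp add: blinfun.zero_right)
qed

text \<open>
  For \<open>y = (B - C) x\<close> one has \<open>(B + C) y = 0\<close>, so both \<open>B\<close> and \<open>C\<close> annihilate \<open>y\<close>, and then
  \<open>\<parallel>y\<parallel>\<^sup>2 = \<langle>x, (B - C) y\<rangle> = 0\<close>.
\<close>

lemma positive_sqrt_unique:
  assumes B: "positive_op B" and C: "positive_op C" and eq: "B o\<^sub>L B = C o\<^sub>L C"
    and comm: "B o\<^sub>L C = C o\<^sub>L B"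
  shows "B = C"
proof (rule blinfun_eqI)
  fix x
  have BC: "B (C z) = C (B z)" for z using commute_apply[OF comm] .
  have sq: "B (B z) = C (C z)" for z using eq by (metis blinfun_apply_blinfun_compose)
  define y where "y = B x - C x"
  have "B y + C y = 0" by (simp add: y_def blinfun.diff_right BC sq)
  then have "inner (B y) y + inner (C y) y = 0" by (metis inner_add_left inner_zero_left)
  then have "inner (B y) y = 0" "inner (C y) y = 0"
    using positive_opD(3)[OF B, of y] positive_opD(3)[OF C, of y] by auto
  then have "B y = 0" "C y = 0" using positive_op_null B C by auto
  moreover have "inner y y = inner x (B y - C y)"
    using positive_opD(2)[OF B] positive_opD(2)[OF C]
    by (subst y_def) (simp add: inner_diff_left inner_diff_right selfadjointD)
  ultimately have "inner y y = 0" by simp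
  then show "B x = C x" by (simp add: y_def)
qed

text \<open>
  Any positive root of \<open>A\<^sup>* A\<close> commutes with \<open>A\<^sup>* A\<close>, hence with the root constructed above, and so
  equals it.
\<close>

lemma op_abs_eqI:
  assumes A: "clinear_op A" and B: "positive_op B" "B o\<^sub>L B = op_adjoint A o\<^sub>L A"
  shows "op_abs A = B"
proof -
  obtain D where D: "positive_op D" "D o\<^sub>L D = op_adjoint A o\<^sub>L A"
    "\<And>X. X o\<^sub>L (op_adjoint A o\<^sub>L A) = (op_adjoint A o\<^sub>L A) o\<^sub>L X \<Longrightarrow> X o\<^sub>L D = D o\<^sub>L X"
    using sqrt_exists[OF positive_op_adjoint_compose[OF A]] by blast
  have "C = D" if C: "positive_op C" "C o\<^sub>L C = op_adjoint A o\<^sub>L A" for C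
  proof (rule positive_sqrt_unique[OF C(1) D(1)])
    show "C o\<^sub>L C = D o\<^sub>L D" by (simp only: C(2) D(2))
    show "C o\<^sub>L D = D o\<^sub>L C"
      by (rule D(3)) (simp add: C(2)[symmetric] blinfun_eqI)
  qed
  then have eqB: "C = B" if "positive_op C \<and> C o\<^sub>L C = op_adjoint A o\<^sub>L A" for C
    using that B by blast
  show ?thesis unfolding op_abs_def by (rule the_equality) (intro conjI B, erule eqB)
qed

lemma op_abs_exists:
  assumes A: "clinear_op A"
  shows "positive_op (op_abs A)" "op_abs A o\<^sub>L op_abs A = op_adjoint A o\<^sub>L A"
    and "X o\<^sub>L (op_adjoint A o\<^sub>L A) = (op_adjoint A o\<^sub>L A) o\<^sub>L X \<Longrightarrow> X o\<^sub>L op_abs A = op_abs A o\<^sub>L X"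
proof -
  obtain D where D: "positive_op D" "D o\<^sub>L D = op_adjoint A o\<^sub>L A"
    "\<And>X. X o\<^sub>L (op_adjoint A o\<^sub>L A) = (op_adjoint A o\<^sub>L A) o\<^sub>L X \<Longrightarrow> X o\<^sub>L D = D o\<^sub>L X"
    using sqrt_exists[OF positive_op_adjoint_compose[OF A]] by blast
  have eq: "op_abs A = D" by (rule op_abs_eqI[OF A D(1,2)])
  show "positive_op (op_abs A)" "op_abs A o\<^sub>L op_abs A = op_adjoint A o\<^sub>L A"
    unfolding eq by (fact D)+
  show "X o\<^sub>L (op_adjoint A o\<^sub>L A) = (op_adjoint A o\<^sub>L A) o\<^sub>L X \<Longrightarrow> X o\<^sub>L op_abs A = op_abs A o\<^sub>L X"
    unfolding eq by (fact D(3))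
qed

lemma norm_op_abs_apply:
  assumes A: "clinear_op A"
  shows "norm (op_abs A x) = norm (A x)"
proof -
  have "inner (op_abs A x) (op_abs A x) = inner ((op_abs A o\<^sub>L op_abs A) x) x"
    using op_abs_exists(1)[OF A] by (simp add: positive_op_iff selfadjointD)
  also have "\<dots> = inner (A x) (A x)"
    by (simp add: op_abs_exists(2)[OF A] adjoint_inner_right[OF A])
  finally show ?thesis by (simp add: norm_eq_sqrt_inner)
qed

lemma projection_op_iff:
  "projection_op E \<longleftrightarrow> clinear_op E \<and> selfadjoint E \<and> E o\<^sub>L E = E"
  by (auto simp: projection_op_def selfadjoint_iff)

lemma projection_onto_exists:
  fixes V :: "'h::complex_hilbert set"
  assumes V: "subspace V" "closed V" and i: "\<And>x. x \<in> V \<Longrightarrow> \<i> *\<^sub>C x \<in> V"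
  shows "\<exists>P. projection_op P \<and> (\<forall>x. P x \<in> V) \<and> (\<forall>x\<in>V. P x = x)"
proof -
  obtain p where p: "\<And>x. p x \<in> V" "\<And>x v. v \<in> V \<Longrightarrow> inner (x - p x) v = 0"
    using closed_subspace_orthogonal_projection[OF V] by metis
  have uniq: "p x = q" if q: "q \<in> V" "\<And>v. v \<in> V \<Longrightarrow> inner (x - q) v = 0" for x q
  proof -
    have "p x - q \<in> V" using p q V(1) by (simp add: subspace_diff)
    then have "inner (x - q) (p x - q) - inner (x - p x) (p x - q) = 0" using p q by simp
    then have "inner (p x - q) (p x - q) = 0" by (simp add: inner_diff_left)
    then show ?thesis by simp
  qed
  have "bounded_linear p"
  proof (rule bounded_linear_intro)
    show "p (x + y) = p x + p y" for x y
    proof (rule uniq)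
      show "p x + p y \<in> V" using p V(1) by (simp add: subspace_add)
      show "inner (x + y - (p x + p y)) v = 0" if "v \<in> V" for v
        using p(2)[OF that, of x] p(2)[OF that, of y] by (simp add: inner_add_left inner_diff_left)
    qed
    show "p (r *\<^sub>R x) = r *\<^sub>R p x" for r x
    proof (rule uniq)
      show "r *\<^sub>R p x \<in> V" using p V(1) by (simp add: subspace_scale)
      show "inner (r *\<^sub>R x - r *\<^sub>R p x) v = 0" if "v \<in> V" for v
        using p(2)[OF that, of x] by (simp add: scaleR_diff_right[symmetric])
    qed
    show "norm (p x) \<le> norm x * 1" for x
    proof -
      have "inner (x - p x) (p x) = 0" using p by simp
      then have "(norm (p x))\<^sup>2 = inner x (p x)" by (simp add: power2_norm_eq_inner inner_diff_left)
      also have "\<dots> \<le> norm x * norm (p x)" by (rule norm_cauchy_schwarz)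
      finally show ?thesis by (cases "p x = 0") (auto simp: power2_eq_square)
    qed
  qed
  define P where "P = Blinfun p"
  have P: "P x = p x" for x using \<open>bounded_linear p\<close> by (simp add: P_def bounded_linear_Blinfun_apply)
  have idV: "p x = x" if "x \<in> V" for x using that by (intro uniq) auto
  have "p (\<i> *\<^sub>C x) = \<i> *\<^sub>C p x" for x
  proof (rule uniq)
    show "\<i> *\<^sub>C p x \<in> V" using p i by blast
    show "inner (\<i> *\<^sub>C x - \<i> *\<^sub>C p x) v = 0" if "v \<in> V" for v
      using p(2)[OF i[OF that], of x] by (simp add: scaleC_simps[symmetric] inner_i_left)
  qed
  then have "clinear_op P" by (simp add: clinear_op_iff P)
  moreover have "selfadjoint P"
    unfolding selfadjoint_def
  proof (intro allI)
    fix x y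
    have "inner (x - p x) (p y) = 0" "inner (y - p y) (p x) = 0" using p by auto
    then show "inner (P x) y = inner x (P y)"
      by (simp add: P inner_diff_left inner_commute[of "p x" y] inner_commute[of "p y" "p x"])
  qed
  moreover have "P o\<^sub>L P = P" using p idV by (intro blinfun_eqI) (simp add: P)
  ultimately show ?thesis using p idV by (auto simp: projection_op_iff P)
qed

text \<open>
  An operator commutes with a projection if it and its adjoint leave the range \<open>{x. P x = x}\<close>
  invariant.
\<close>

lemma projection_commute:
  assumes P: "projection_op P" and X: "clinear_op X"
    and inv: "\<And>x. P x = x \<Longrightarrow> P (X x) = X x" "\<And>x. P x = x \<Longrightarrow> P (op_adjoint X x) = op_adjoint X x"
  shows "X o\<^sub>L P = P o\<^sub>L X"
proof (rule blinfun_eqI)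
  fix x
  have PP: "P (P z) = P z" for z using P by (metis projection_op_def blinfun_apply_blinfun_compose)
  have sP: "selfadjoint P" using P by (simp add: projection_op_iff)
  have "inner (X (P x)) y = inner (P (X x)) y" for y
  proof -
    have "inner (X (P x)) y = inner (P (X (P x))) y" using inv(1)[OF PP] by simp
    also have "\<dots> = inner x (P (op_adjoint X (P y)))"
      using sP by (simp add: selfadjointD adjoint_inner[OF X])
    also have "\<dots> = inner x (op_adjoint X (P y))" using inv(2)[OF PP] by simp
    also have "\<dots> = inner (P (X x)) y" using sP by (simp add: selfadjointD adjoint_inner[OF X])
    finally show ?thesis .
  qed
  then show "(X o\<^sub>L P) x = (P o\<^sub>L X) x" using vector_eq_rdot by auto
qed

text \<open>
  \<open>P\<close> is the projection onto the kernel of \<open>|A| - A\<close>, twice the negative part of \<open>A\<close>. On this kernel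
  \<open>A = |A| \<ge> 0\<close>. The range of \<open>|A| + A\<close> lies in it, because \<open>(|A| - A) (|A| + A) = 0\<close>; so
  \<open>A = - |A|\<close> on the complement.
\<close>

lemma spectral_projection_exists:
  assumes A: "clinear_op A" "selfadjoint A"
  obtains P where "projection_op P"
    "\<And>x. 0 \<le> inner (A (P x)) (P x)" "\<And>x. inner (A (x - P x)) (x - P x) \<le> 0"
    "\<And>X. clinear_op X \<Longrightarrow> X o\<^sub>L A = A o\<^sub>L X \<Longrightarrow> op_adjoint X o\<^sub>L A = A o\<^sub>L op_adjoint X \<Longrightarrow>
      X o\<^sub>L P = P o\<^sub>L X"
proof -
  define B where "B = op_abs A"
  have adj: "op_adjoint A = A" using A by (simp add: selfadjoint_iff)
  have B: "positive_op B" "B o\<^sub>L B = A o\<^sub>L A" using op_abs_exists(1,2)[OF A(1)] by (simp_all only: B_def adj)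
  have BX: "X o\<^sub>L B = B o\<^sub>L X" if X: "X o\<^sub>L A = A o\<^sub>L X" for X
  proof -
    have "X (A x) = A (X x)" for x using commute_apply[OF X] .
    then have "X o\<^sub>L (A o\<^sub>L A) = (A o\<^sub>L A) o\<^sub>L X" by (intro blinfun_eqI) simp
    then show ?thesis using op_abs_exists(3)[OF A(1), of X] by (simp add: adj B_def)
  qed
  have AB: "A (B x) = B (A x)" for x using commute_apply[OF BX[of A]] by simp
  have BB: "B (B x) = A (A x)" for x using B(2) by (metis blinfun_apply_blinfun_compose)
  have cB: "clinear_op B" "selfadjoint B" using B by (auto simp: positive_op_iff)
  define V where "V = {x. B x - A x = 0}"
  have "subspace V" by (auto simp: V_def subspace_def blinfun.bilinear_simps)
  moreover have "closed V" unfolding V_def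
    by (intro closed_Collect_eq continuous_intros)
  moreover have "\<i> *\<^sub>C x \<in> V" if "x \<in> V" for x
    using that A cB by (auto simp: V_def clinear_op_iff)
  ultimately obtain P where P: "projection_op P" "\<And>x. P x \<in> V" "\<And>x. x \<in> V \<Longrightarrow> P x = x"
    using projection_onto_exists[of V] by metis
  have V_iff: "P x = x \<longleftrightarrow> B x = A x" for x using P(2)[of x] P(3)[of x] by (auto simp: V_def)
  have PV: "B (P x) = A (P x)" for x using P(2)[of x] by (simp add: V_def)
  have sP: "selfadjoint P" using P by (simp add: projection_op_iff)
  show thesis
  proof (rule that[OF P(1)])
    show "0 \<le> inner (A (P x)) (P x)" for x
      using positive_opD(3)[OF B(1)] by (simp add: PV[symmetric])
    show "inner (A (x - P x)) (x - P x) \<le> 0" for x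
    proof -
      let ?y = "x - P x"
      have PP: "P (P x) = P x" using P by blast
      have "P (B ?y + A ?y) = B ?y + A ?y"
        by (rule V_iff[THEN iffD2]) (simp add: blinfun.add_right BB AB add.commute)
      then have "inner (B ?y + A ?y) ?y = inner (B ?y + A ?y) (P ?y)"
        using sP by (metis selfadjointD)
      also have "P ?y = 0" by (simp add: blinfun.diff_right PP)
      finally have "inner (A ?y) ?y = - inner (B ?y) ?y" by (simp add: inner_add_left)
      then show ?thesis using positive_opD(3)[OF B(1), of ?y] by simp
    qed
    show "X o\<^sub>L P = P o\<^sub>L X" if X: "clinear_op X" "X o\<^sub>L A = A o\<^sub>L X" "op_adjoint X o\<^sub>L A = A o\<^sub>L op_adjoint X"
      for X
    proof (rule projection_commute[OF P(1) X(1)])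
      show "P (X x) = X x" if "P x = x" for x
        using that commute_apply[OF X(2), of x] commute_apply[OF BX[OF X(2)], of x]
        by (simp add: V_iff)
      show "P (op_adjoint X x) = op_adjoint X x" if "P x = x" for x
        using that commute_apply[OF X(3), of x] commute_apply[OF BX[OF X(3)], of x]
        by (simp add: V_iff)
    qed
  qed
qed

section \<open>Closure properties of von Neumann algebras\<close>

text \<open>
  The commutant is again self-adjoint; so \<open>projection_commute\<close> puts a projection into the algebra as
  soon as the commutant preserves its range.
\<close>

lemma commutant_adjoint:
  assumes M: "\<And>A. A \<in> M \<Longrightarrow> op_adjoint A \<in> M" "\<And>A. A \<in> M \<Longrightarrow> clinear_op A"
    and X: "X \<in> commutant M"
  shows "op_adjoint X \<in> commutant M"
proof -
  have cX: "clinear_op X" using X by (simp add: commutant_def)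
  have "op_adjoint X o\<^sub>L B = B o\<^sub>L op_adjoint X" if B: "B \<in> M" for B
  proof (rule blinfun_eqI)
    fix y
    have "X o\<^sub>L op_adjoint B = op_adjoint B o\<^sub>L X" using X M B by (simp add: commutant_def)
    then have "inner (X (op_adjoint B x)) y = inner (op_adjoint B (X x)) y" for x
      by (simp add: commute_apply)
    then have "inner x (B (op_adjoint X y)) = inner x (op_adjoint X (B y))" for x
      using cX M(2)[OF B]
      by (simp add: adjoint_inner[OF cX] adjoint_inner_right[OF M(2)[OF B], symmetric])
    then show "(op_adjoint X o\<^sub>L B) y = (B o\<^sub>L op_adjoint X) y"
      by (metis blinfun_apply_blinfun_compose vector_eq_ldot)
  qed
  then show ?thesis by (simp add: commutant_def clinear_adjoint[OF cX])
qed

context von_neumann_algebra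
begin

lemma in_algebra_iff: "A \<in> M \<longleftrightarrow> clinear_op A \<and> (\<forall>X\<in>commutant M. A o\<^sub>L X = X o\<^sub>L A)"
  using double_commutant by (auto simp: commutant_def)

lemma clinear: "A \<in> M \<Longrightarrow> clinear_op A"
  by (simp add: in_algebra_iff)

lemma commutant_clinear: "X \<in> commutant M \<Longrightarrow> clinear_op X"
  by (simp add: commutant_def)

lemma commutant_commute: "X \<in> commutant M \<Longrightarrow> A \<in> M \<Longrightarrow> X o\<^sub>L A = A o\<^sub>L X"
  by (simp add: commutant_def)

lemma commutant_adjoint_closed: "X \<in> commutant M \<Longrightarrow> op_adjoint X \<in> commutant M"
  by (rule commutant_adjoint) (auto simp: adjoint_closed clinear)

lemma commutant_apply: "X \<in> commutant M \<Longrightarrow> A \<in> M \<Longrightarrow> X (A x) = A (X x)"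
  by (rule commute_apply) (rule commutant_commute)

lemma algebra_closed:
  shows id_closed: "id_blinfun \<in> M" and zero_closed: "0 \<in> M"
    and add_closed: "A \<in> M \<Longrightarrow> B \<in> M \<Longrightarrow> A + B \<in> M"
    and diff_closed: "A \<in> M \<Longrightarrow> B \<in> M \<Longrightarrow> A - B \<in> M"
    and compose_closed: "A \<in> M \<Longrightarrow> B \<in> M \<Longrightarrow> A o\<^sub>L B \<in> M"
    and scaleC_closed: "A \<in> M \<Longrightarrow> scaleC_op c A \<in> M"
    and scaleR_closed: "A \<in> M \<Longrightarrow> r *\<^sub>R A \<in> M"
proof -
  have *: "A \<in> M" if "clinear_op A" "\<And>X x. X \<in> commutant M \<Longrightarrow> A (X x) = X (A x)" for A
    using that by (auto simp: in_algebra_iff intro: blinfun_eqI)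
  show "id_blinfun \<in> M" "0 \<in> M"
    by (rule *; simp add: clinear_op_intros blinfun.zero_right)+
  show "A + B \<in> M" "A - B \<in> M" "A o\<^sub>L B \<in> M" if "A \<in> M" "B \<in> M"
    using clinear[OF that(1)] clinear[OF that(2)]
    by (rule_tac[!] *) (simp_all add: clinear_op_intros blinfun.bilinear_simps
        commutant_apply[OF _ that(1), symmetric] commutant_apply[OF _ that(2), symmetric])
  show sc: "scaleC_op c A \<in> M" if "A \<in> M" for c A
    using clinear[OF that]
    by (intro *) (simp_all add: clinear_op_intros scaleC_op_apply commutant_apply[OF _ that, symmetric]
        commutant_clinear[unfolded clinear_op_def])
  show "r *\<^sub>R A \<in> M" if "A \<in> M" for r A using sc that by (simp add: scaleR_eq_scaleC_op)
qed

lemma sum_closed: "(\<And>i. i \<in> I \<Longrightarrow> f i \<in> M) \<Longrightarrow> (\<Sum>i\<in>I. f i) \<in> M"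
  by (induction I rule: infinite_finite_induct) (auto intro: zero_closed add_closed)

lemma op_abs_closed: "A \<in> M \<Longrightarrow> op_abs A \<in> M"
  unfolding in_algebra_iff[of "op_abs A"]
  using op_abs_exists(1)[of A] op_abs_exists(3)[of A] commutant_commute compose_closed adjoint_closed
  by (metis clinear positive_opD(1))

lemma sqrt_closed:
  assumes "A \<in> M" "positive_op A"
  shows "\<exists>B\<in>M. positive_op B \<and> B o\<^sub>L B = A \<and> (\<forall>X. X o\<^sub>L A = A o\<^sub>L X \<longrightarrow> X o\<^sub>L B = B o\<^sub>L X)"
  using sqrt_exists[OF assms(2)] commutant_commute[OF _ assms(1)]
  by (metis in_algebra_iff positive_opD(1))

lemma spectral_projection:
  assumes A: "A \<in> M" "selfadjoint A"
  obtains P where "P \<in> M" "projection_op P"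
    "\<And>x. 0 \<le> inner (A (P x)) (P x)" "\<And>x. inner (A (x - P x)) (x - P x) \<le> 0"
    "\<And>X. clinear_op X \<Longrightarrow> selfadjoint X \<Longrightarrow> X o\<^sub>L A = A o\<^sub>L X \<Longrightarrow> X o\<^sub>L P = P o\<^sub>L X"
proof (rule spectral_projection_exists[OF clinear[OF A(1)] A(2)])
  fix P
  assume P: "projection_op P" "\<And>x. 0 \<le> inner (A (P x)) (P x)"
    "\<And>x. inner (A (x - P x)) (x - P x) \<le> 0"
    "\<And>X. clinear_op X \<Longrightarrow> X o\<^sub>L A = A o\<^sub>L X \<Longrightarrow> op_adjoint X o\<^sub>L A = A o\<^sub>L op_adjoint X \<Longrightarrow>
      X o\<^sub>L P = P o\<^sub>L X"
  have "P \<in> M"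
    using P(1,4) commutant_commute[OF _ A(1)] commutant_adjoint_closed commutant_clinear
    by (metis in_algebra_iff projection_op_def)
  then show thesis using P by (intro that[of P]) (auto simp: selfadjoint_iff)
qed

end

section \<open>Projections and the trace\<close>

lemma projection_opD:
  assumes "projection_op E"
  shows "clinear_op E" "selfadjoint E" "E (E x) = E x" "inner (E x) x = (norm (E x))\<^sup>2"
    "norm (E x) \<le> norm x" "positive_op E"
proof -
  show E: "clinear_op E" "selfadjoint E" and idem: "E (E x) = E x" for x
    using assms by (auto simp: projection_op_iff) (metis blinfun_apply_blinfun_compose)
  show sq: "inner (E x) x = (norm (E x))\<^sup>2" for x
    by (metis E(2) idem power2_norm_eq_inner selfadjointD)
  have "(norm (E x))\<^sup>2 \<le> norm (E x) * norm x" using sq[of x] norm_cauchy_schwarz[of "E x" x] by simp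
  then show "norm (E x) \<le> norm x" by (cases "E x = 0") (auto simp: power2_eq_square)
  show "positive_op E" by (simp add: positive_op_iff E sq)
qed

lemma projection_op_compl: "projection_op E \<Longrightarrow> projection_op (id_blinfun - E)"
  using projection_opD(3)[of E]
  by (auto simp: projection_op_iff blinfun.bilinear_simps intro!: blinfun_eqI clinear_op_intros
      selfadjoint_intros)

lemma selfadjoint_annihilate_sym:
  assumes "selfadjoint A" "selfadjoint B" "\<And>x. A (B x) = 0"
  shows "B (A x) = 0"
proof -
  have "inner (B (A x)) y = 0" for y using assms by (simp add: selfadjointD)
  then show ?thesis using inner_eq_zero_iff by blast
qed

lemma op_power_simps: "op_power A 0 = id_blinfun" "op_power A (Suc n) = A o\<^sub>L op_power A n"
  by (simp_all add: op_power_def)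

lemma op_power_add: "op_power A (m + n) = op_power A m o\<^sub>L op_power A n"
  by (induction m) (auto simp: op_power_simps intro: blinfun_eqI)

lemma op_power_commute: "A (op_power A n x) = op_power A n (A x)"
  by (induction n) (simp_all add: op_power_simps)

lemma selfadjoint_op_power: "selfadjoint A \<Longrightarrow> selfadjoint (op_power A n)"
  by (induction n) (simp_all add: op_power_simps selfadjoint_def op_power_commute)

lemma norm_op_power_le: "norm (op_power A (Suc n)) \<le> norm A ^ Suc n"
proof (induction n)
  case 0
  have "op_power A (Suc 0) = A" by (rule blinfun_eqI) (simp add: op_power_simps)
  then show ?case by simp
next
  case (Suc n)
  have "norm (op_power A (Suc (Suc n))) \<le> norm A * norm (op_power A (Suc n))"
    by (subst op_power_simps(2)) (rule norm_blinfun_compose)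
  also have "\<dots> \<le> norm A * norm A ^ Suc n" by (intro mult_left_mono Suc) auto
  finally show ?case by simp
qed

lemma subspace_closure:
  fixes U :: "'a::real_normed_vector set"
  assumes U: "subspace U"
  shows "subspace (closure U)"
  unfolding subspace_def
proof (intro conjI ballI allI)
  show "0 \<in> closure U" using U subspace_0 closure_subset by blast
  show "x + y \<in> closure U" if xy: "x \<in> closure U" "y \<in> closure U" for x y
  proof -
    obtain f g where "\<And>n. f n \<in> U" "f \<longlonglongrightarrow> x" "\<And>n. g n \<in> U" "g \<longlonglongrightarrow> y"
      using xy unfolding closure_sequential by blast
    then have "\<forall>n. f n + g n \<in> U" "(\<lambda>n. f n + g n) \<longlonglongrightarrow> x + y"
      using U by (auto intro: tendsto_add subspace_add)
    then show ?thesis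
      unfolding closure_sequential by (intro exI[of _ "\<lambda>n. f n + g n"] conjI)
  qed
  show "c *\<^sub>R x \<in> closure U" if x: "x \<in> closure U" for c x
  proof -
    obtain f where "\<And>n. f n \<in> U" "f \<longlonglongrightarrow> x" using x unfolding closure_sequential by blast
    then have "\<forall>n. c *\<^sub>R f n \<in> U" "(\<lambda>n. c *\<^sub>R f n) \<longlonglongrightarrow> c *\<^sub>R x"
      using U by (auto intro: tendsto_intros subspace_scale)
    then show ?thesis
      unfolding closure_sequential by (intro exI[of _ "\<lambda>n. c *\<^sub>R f n"] conjI)
  qed
qed

context finite_von_neumann_algebra
begin

lemma op_power_closed: "A \<in> M \<Longrightarrow> op_power A n \<in> M"
  by (induction n) (simp_all add: op_power_simps id_closed compose_closed)

definition tr :: "'h op \<Rightarrow> real"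
  where "tr A = Re (\<tau> A)"

lemma tau_scaleR: "A \<in> M \<Longrightarrow> \<tau> (r *\<^sub>R A) = of_real r * \<tau> A"
  by (simp add: scaleR_eq_scaleC_op trace_scale)

lemma tau_zero: "\<tau> 0 = 0"
  using tau_scaleR[OF zero_closed, of 0] by simp

lemma tau_diff: "A \<in> M \<Longrightarrow> B \<in> M \<Longrightarrow> \<tau> (A - B) = \<tau> A - \<tau> B"
  using trace_add[OF diff_closed, of A B B] by simp

lemma tau_sum: "(\<And>i. i \<in> I \<Longrightarrow> f i \<in> M) \<Longrightarrow> \<tau> (\<Sum>i\<in>I. f i) = (\<Sum>i\<in>I. \<tau> (f i))"
  by (induction I rule: infinite_finite_induct) (simp_all add: tau_zero trace_add sum_closed)

lemma tau_positive: "A \<in> M \<Longrightarrow> positive_op A \<Longrightarrow> \<tau> A = of_real (tr A)"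
  using trace_positive[of A] by (auto simp: tr_def complex_nonneg_Reals_iff complex_eq_iff)

lemma tr_simps:
  shows tr_zero: "tr 0 = 0" and tr_one: "tr id_blinfun = 1"
    and tr_add: "A \<in> M \<Longrightarrow> B \<in> M \<Longrightarrow> tr (A + B) = tr A + tr B"
    and tr_diff: "A \<in> M \<Longrightarrow> B \<in> M \<Longrightarrow> tr (A - B) = tr A - tr B"
    and tr_scaleR: "A \<in> M \<Longrightarrow> tr (r *\<^sub>R A) = r * tr A"
  by (simp_all add: tr_def tau_zero trace_one trace_add tau_diff tau_scaleR)

lemma tr_commute: "A \<in> M \<Longrightarrow> B \<in> M \<Longrightarrow> tr (A o\<^sub>L B) = tr (B o\<^sub>L A)"
  by (simp add: tr_def trace_commute)

lemma tr_nonneg: "A \<in> M \<Longrightarrow> positive_op A \<Longrightarrow> 0 \<le> tr A"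
  using trace_positive[of A] by (simp add: tr_def complex_nonneg_Reals_iff)

lemma tr_mono: "A \<in> M \<Longrightarrow> B \<in> M \<Longrightarrow> positive_op (B - A) \<Longrightarrow> tr A \<le> tr B"
  using tr_nonneg[of "B - A"] by (simp add: diff_closed tr_diff)

lemma tr_le_norm:
  assumes "A \<in> M" "selfadjoint A"
  shows "tr A \<le> norm A"
proof -
  have "positive_op (norm A *\<^sub>R id_blinfun - A)"
    using assms inner_le_norm_op[of A] clinear[OF assms(1)]
    by (auto simp: positive_op_iff blinfun.bilinear_simps inner_diff_left power2_norm_eq_inner
        intro!: clinear_op_intros clinear_op_scaleR selfadjoint_intros)
  from tr_mono[OF assms(1) scaleR_closed[OF id_closed] this] show ?thesis
    by (simp add: tr_scaleR id_closed tr_one)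
qed

definition prj :: "'h op \<Rightarrow> bool"
  where "prj E \<longleftrightarrow> E \<in> M \<and> projection_op E"

lemma prjD: "prj E \<Longrightarrow> E \<in> M" "prj E \<Longrightarrow> projection_op E"
  by (simp_all add: prj_def)

lemma prj_apply:
  assumes "prj E"
  shows "E (E x) = E x" "inner (E x) y = inner x (E y)" "inner (E x) x = (norm (E x))\<^sup>2"
    "norm (E x) \<le> norm x"
  using projection_opD[OF prjD(2)[OF assms]] by (auto simp: selfadjointD)

lemma prjI:
  assumes "E \<in> M" "\<And>x. E (E x) = E x" "selfadjoint E"
  shows "prj E"
  using assms clinear[OF assms(1)] by (auto simp: prj_def projection_op_iff intro: blinfun_eqI)

lemma prj_selfadjoint: "prj E \<Longrightarrow> selfadjoint E"
  by (simp add: prj_def projection_op_iff)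

lemma prj_positive: "prj E \<Longrightarrow> positive_op E"
  by (simp add: prj_def projection_opD)

lemma prj_zero: "prj 0" and prj_one: "prj id_blinfun"
  by (auto intro!: prjI zero_closed id_closed selfadjoint_intros)

lemma tr_prj_nonneg: "prj E \<Longrightarrow> 0 \<le> tr E"
  by (simp add: prjD prj_positive tr_nonneg)

text \<open>
  Faithfulness of the trace, as \<open>E = E\<^sup>* E\<close>.
\<close>

lemma tr_prj_eq_zero:
  assumes "prj E" "tr E \<le> 0"
  shows "E = 0"
proof (rule trace_faithful)
  show "E \<in> M" using assms by (simp add: prjD)
  have "op_adjoint E o\<^sub>L E = E" using prjD(2)[OF assms(1)] by (simp add: projection_op_def)
  then show "\<tau> (op_adjoint E o\<^sub>L E) = 0"
    using tau_positive[OF prjD(1)[OF assms(1)] prj_positive[OF assms(1)]] assms tr_prj_nonneg[OF assms(1)]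
    by simp
qed

lemma tr_prj_pos: "prj E \<Longrightarrow> E \<noteq> 0 \<Longrightarrow> 0 < tr E"
  using tr_prj_eq_zero[of E] by force

text \<open>The order \<open>F \<le> E\<close> of projections is expressed as \<open>E o\<^sub>L F = F\<close> throughout.\<close>

lemma sub_prj:
  assumes E: "prj E" and F: "prj F" and sub: "E o\<^sub>L F = F"
  shows "F (E x) = F x" "E (F x) = F x" "prj (E - F)" "tr (E - F) = tr E - tr F" "tr F \<le> tr E"
    "(E - F) o\<^sub>L F = 0" "F o\<^sub>L (E - F) = 0"
proof -
  show EF: "E (F x) = F x" for x using sub by (metis blinfun_apply_blinfun_compose)
  show FE: "F (E x) = F x" for x
  proof -
    have "inner (F (E x)) y = inner (F x) y" for y by (simp add: prj_apply(2) E F EF)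
    then show ?thesis using vector_eq_rdot by blast
  qed
  show p: "prj (E - F)"
    using E F by (intro prjI diff_closed selfadjoint_intros)
      (auto simp: prjD prj_selfadjoint blinfun.bilinear_simps EF FE prj_apply)
  show t: "tr (E - F) = tr E - tr F" using E F by (simp add: prjD tr_diff)
  show "tr F \<le> tr E" using tr_prj_nonneg[OF p] t by simp
  show "(E - F) o\<^sub>L F = 0" "F o\<^sub>L (E - F) = 0"
    using F by (auto intro!: blinfun_eqI simp: blinfun.bilinear_simps EF FE prj_apply)
qed

lemma orth_prj:
  assumes E: "prj E" and F: "prj F" and orth: "E o\<^sub>L F = 0"
  shows "E (F x) = 0" "F (E x) = 0" "prj (E + F)" "tr (E + F) = tr E + tr F"
    "(E + F) o\<^sub>L E = E" "(E + F) o\<^sub>L F = F"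
proof -
  show EF: "E (F x) = 0" for x using orth by (metis blinfun_apply_blinfun_compose zero_blinfun.rep_eq)
  show FE: "F (E x) = 0" for x
    using selfadjoint_annihilate_sym[OF prj_selfadjoint[OF E] prj_selfadjoint[OF F] EF] .
  show "prj (E + F)"
    using E F by (intro prjI add_closed selfadjoint_intros)
      (auto simp: prjD prj_selfadjoint blinfun.bilinear_simps EF FE prj_apply)
  show "tr (E + F) = tr E + tr F" using E F by (simp add: prjD tr_add)
  show "(E + F) o\<^sub>L E = E" "(E + F) o\<^sub>L F = F"
    using E F by (auto intro!: blinfun_eqI simp: blinfun.bilinear_simps EF FE prj_apply)
qed

lemma prj_compl: "prj E \<Longrightarrow> prj (id_blinfun - E)" "prj E \<Longrightarrow> tr (id_blinfun - E) = 1 - tr E"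
  by (auto simp: prj_def projection_op_compl diff_closed id_closed tr_diff tr_one)

text \<open>
  With \<open>K = F - FGF\<close> and \<open>L = G - GFG\<close> one has \<open>K (FG) = (FG) L\<close>, so the trace property gives
  \<open>\<tau> F - \<tau> (K\<^sup>n) = \<tau> G - \<tau> (L\<^sup>n)\<close> for all \<open>n \<ge> 1\<close> by telescoping. The hypothesis makes \<open>K\<close> a strict
  contraction, hence \<open>\<tau> (K\<^sup>n) \<rightarrow> 0\<close>, while \<open>\<tau> (L\<^sup>n) \<ge> 0\<close> for even \<open>n\<close>. This avoids the partial isometry
  in the polar decomposition of \<open>G F\<close>.
\<close>

lemma tr_le_of_bounded_below:
  assumes F: "prj F" and G: "prj G" and d: "0 < d"
    and below: "\<And>x. F x = x \<Longrightarrow> d * (norm x)\<^sup>2 \<le> (norm (G x))\<^sup>2"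
  shows "tr F \<le> tr G"
proof -
  define K where "K = F - (F o\<^sub>L G o\<^sub>L F)"
  define L where "L = G - (G o\<^sub>L F o\<^sub>L G)"
  have FM: "F \<in> M" and GM: "G \<in> M" using F G by (simp_all add: prjD)
  have KM: "K \<in> M" and LM: "L \<in> M" by (simp_all add: K_def L_def diff_closed compose_closed FM GM)
  have sK: "selfadjoint K" and sL: "selfadjoint L"
    using F G by (simp_all add: K_def L_def prj_selfadjoint selfadjoint_intros selfadjoint_sandwich)
  \<comment> \<open>\<open>d > 1\<close> is possible when \<open>F = 0\<close>\<close>
  define c where "c = max 0 (1 - d)"
  have c: "0 \<le> c" "c < 1" using d by (simp_all add: c_def)
  have nK: "norm K \<le> c"
  proof (rule norm_selfadjoint_le[OF sK _ c(1)])
    fix x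
    have "inner (K x) x = (norm (F x))\<^sup>2 - (norm (G (F x)))\<^sup>2"
      using prj_apply(2)[OF F, of "G (F x)" x]
      by (simp add: K_def blinfun.diff_left inner_diff_left prj_apply(3)[OF F] prj_apply(3)[OF G])
    moreover have "(norm (G (F x)))\<^sup>2 \<le> (norm (F x))\<^sup>2" by (intro power_mono prj_apply(4)[OF G]) auto
    moreover have "d * (norm (F x))\<^sup>2 \<le> (norm (G (F x)))\<^sup>2" by (rule below) (rule prj_apply(1)[OF F])
    ultimately have "\<bar>inner (K x) x\<bar> \<le> (norm (F x))\<^sup>2 - d * (norm (F x))\<^sup>2" by linarith
    also have "\<dots> = (1 - d) * (norm (F x))\<^sup>2" by (simp add: algebra_simps)
    also have "\<dots> \<le> c * (norm (F x))\<^sup>2" by (intro mult_right_mono) (auto simp: c_def)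
    also have "\<dots> \<le> c * (norm x)\<^sup>2" by (intro mult_left_mono power_mono prj_apply(4)[OF F] c) auto
    finally show "\<bar>inner (K x) x\<bar> \<le> c * (norm x)\<^sup>2" .
  qed
  have FF: "F (F x) = F x" and GG: "G (G x) = G x" for x using F G by (simp_all add: prj_apply)
  have KW: "K (F (G x)) = F (G (L x))" for x
    by (simp add: K_def L_def blinfun.bilinear_simps FF GG)
  have KnW: "op_power K n (F (G x)) = F (G (op_power L n x))" for n x
    by (induction n arbitrary: x) (simp_all add: op_power_simps KW)
  have step: "tr (F o\<^sub>L G o\<^sub>L F o\<^sub>L op_power K n) = tr (G o\<^sub>L F o\<^sub>L G o\<^sub>L op_power L n)" for n
  proof -
    have "tr (F o\<^sub>L G o\<^sub>L F o\<^sub>L op_power K n) = tr ((F o\<^sub>L G) o\<^sub>L (G o\<^sub>L F o\<^sub>L op_power K n))"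
      by (rule arg_cong[of _ _ tr]) (auto intro!: blinfun_eqI simp: GG)
    also have "\<dots> = tr ((G o\<^sub>L F o\<^sub>L op_power K n) o\<^sub>L (F o\<^sub>L G))"
      by (intro tr_commute compose_closed FM GM op_power_closed KM)
    also have "\<dots> = tr (G o\<^sub>L F o\<^sub>L G o\<^sub>L op_power L n)"
      by (rule arg_cong[of _ _ tr]) (auto intro!: blinfun_eqI simp: KnW FF)
    finally show ?thesis .
  qed
  have FK: "F (K x) = K x" and GL: "G (L x) = L x" for x
    by (simp_all add: K_def L_def blinfun.bilinear_simps FF GG)
  have telescope: "tr (F o\<^sub>L op_power K n) - tr (G o\<^sub>L op_power L n) = tr F - tr G" for n
  proof (induction n)
    case 0
    have "F o\<^sub>L op_power K 0 = F" "G o\<^sub>L op_power L 0 = G"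
      by (auto intro!: blinfun_eqI simp: op_power_simps)
    then show ?case by simp
  next
    case (Suc n)
    have "F o\<^sub>L op_power K (Suc n) = (F o\<^sub>L op_power K n) - (F o\<^sub>L G o\<^sub>L F o\<^sub>L op_power K n)"
      by (rule blinfun_eqI) (simp add: op_power_simps FK, simp add: K_def blinfun.bilinear_simps)
    moreover have "G o\<^sub>L op_power L (Suc n) = (G o\<^sub>L op_power L n) - (G o\<^sub>L F o\<^sub>L G o\<^sub>L op_power L n)"
      by (rule blinfun_eqI) (simp add: op_power_simps GL, simp add: L_def blinfun.bilinear_simps)
    ultimately show ?case
      using Suc step[of n]
      by (simp add: tr_diff compose_closed FM GM KM LM op_power_closed)
  qed
  \<comment> \<open>the exponent is even, so that \<open>L\<^sup>n\<close> is a square, and positive, so that \<open>F K\<^sup>n = K\<^sup>n\<close>\<close>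
  have "tr F \<le> tr G + c ^ n" if "n = Suc m + Suc m" for n m
  proof -
    have "F o\<^sub>L op_power K n = op_power K n" "G o\<^sub>L op_power L n = op_power L n"
      using that by (auto intro!: blinfun_eqI simp: op_power_simps FK GL)
    then have "tr F = tr G + tr (op_power K n) - tr (op_power L n)" using telescope[of n] by simp
    moreover have "tr (op_power K n) \<le> c ^ n"
    proof -
      have "tr (op_power K n) \<le> norm (op_power K n)"
        by (intro tr_le_norm op_power_closed selfadjoint_op_power KM sK)
      also have "\<dots> \<le> norm K ^ n" using that norm_op_power_le[of K "m + Suc m"] by simp
      also have "\<dots> \<le> c ^ n" by (intro power_mono nK) simp
      finally show ?thesis .
    qed
    moreover have "0 \<le> tr (op_power L n)"
    proof (rule tr_nonneg)
      show "op_power L n \<in> M" by (intro op_power_closed LM)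
      have "0 \<le> inner (op_power L n x) x" for x
        unfolding that op_power_add[of L "Suc m" "Suc m"]
        using selfadjointD[OF selfadjoint_op_power[OF sL], of "Suc m" "op_power L (Suc m) x" x]
        by simp
      then show "positive_op (op_power L n)"
        by (simp add: positive_op_iff clinear op_power_closed LM selfadjoint_op_power sL)
    qed
    ultimately show ?thesis by simp
  qed
  then have bound: "tr F \<le> tr G + c ^ (Suc m + Suc m)" for m by blast
  have "(\<lambda>n. c ^ n) \<longlonglongrightarrow> 0" using c by (intro LIMSEQ_power_zero) simp
  then have "(\<lambda>m. c ^ (Suc m + Suc m)) \<longlonglongrightarrow> 0"
    using LIMSEQ_subseq_LIMSEQ[of "\<lambda>n. c ^ n" 0 "\<lambda>m. Suc m + Suc m"]
    by (simp add: o_def strict_mono_def)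
  then have "(\<lambda>m. tr G + c ^ (Suc m + Suc m)) \<longlonglongrightarrow> tr G + 0" by (intro tendsto_intros)
  then show ?thesis using bound LIMSEQ_le_const[of _ "tr G + 0" "tr F"] by auto
qed

text \<open>
  \<open>P\<close> is the projection onto the closure of the union of the ranges, a subspace since \<open>C\<close> is a chain.
  It is the least upper bound of \<open>C\<close> in the algebra, as normality of the trace requires.
\<close>

lemma chain_supremum:
  assumes ne: "C \<noteq> {}" and C: "\<And>G. G \<in> C \<Longrightarrow> prj G"
    and chain: "\<And>G H. G \<in> C \<Longrightarrow> H \<in> C \<Longrightarrow> G o\<^sub>L H = H \<or> H o\<^sub>L G = G"
  shows "\<exists>P. prj P \<and> (\<forall>G\<in>C. P o\<^sub>L G = G) \<and>
    (\<forall>E. prj E \<longrightarrow> (\<forall>G\<in>C. E o\<^sub>L G = G) \<longrightarrow> E o\<^sub>L P = P) \<and> tr P = (SUP G\<in>C. tr G)"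
proof -
  define U where "U = {x. \<exists>G\<in>C. G x = x}"
  have "subspace U"
    unfolding subspace_def
  proof (intro conjI ballI allI)
    show "0 \<in> U" using ne by (auto simp: U_def blinfun.zero_right)
    show "c *\<^sub>R x \<in> U" if "x \<in> U" for c x using that by (auto simp: U_def blinfun.scaleR_right)
    show "x + y \<in> U" if xy: "x \<in> U" "y \<in> U" for x y
    proof -
      obtain G H where GH: "G \<in> C" "G x = x" "H \<in> C" "H y = y" using xy by (auto simp: U_def)
      then have "(G x = x \<and> G y = y) \<or> (H x = x \<and> H y = y)"
        using chain[OF GH(1,3)] by (metis blinfun_apply_blinfun_compose)
      then show ?thesis using GH unfolding U_def mem_Collect_eq by (metis blinfun.add_right)
    qed
  qed
  then have V: "subspace (closure U)" by (rule subspace_closure)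
  have inv: "f x \<in> closure U" if "x \<in> closure U" "\<And>x. x \<in> U \<Longrightarrow> f x \<in> U" "continuous_on UNIV f" for f x
  proof -
    have "f ` closure U \<subseteq> closure (f ` U)"
      using that(3) by (intro continuous_image_closure_subset) auto
    also have "\<dots> \<subseteq> closure U" using that(2) by (intro closure_mono) auto
    finally show ?thesis using that(1) by auto
  qed
  have "\<i> *\<^sub>C x \<in> closure U" if "x \<in> closure U" for x
  proof (rule inv[OF that])
    show "\<i> *\<^sub>C x \<in> U" if "x \<in> U" for x
      using that clinear[OF prjD(1)[OF C]] unfolding U_def clinear_op_iff by auto metis
    show "continuous_on UNIV (\<lambda>x::'h. \<i> *\<^sub>C x)"
      by (intro linear_continuous_on bounded_linear_scaleC)
  qed
  then obtain P where P: "projection_op P" "\<And>x. P x \<in> closure U" "\<And>x. x \<in> closure U \<Longrightarrow> P x = x"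
    using projection_onto_exists[OF V closed_closure] by metis
  have XU: "P (X x) = X x" if "X \<in> commutant M" "P x = x" for X x
  proof (rule P(3), rule inv[of x "blinfun_apply X"])
    show "x \<in> closure U" using that(2) P(2)[of x] by simp
    show "X x \<in> U" if "x \<in> U" for x
      using that commutant_apply[OF \<open>X \<in> commutant M\<close> prjD(1)[OF C]] by (auto simp: U_def) metis
    show "continuous_on UNIV X" by (intro linear_continuous_on blinfun.bounded_linear_right)
  qed
  have "P \<in> M"
    unfolding in_algebra_iff
  proof (intro conjI ballI)
    show "clinear_op P" using P(1) by (simp add: projection_op_def)
    show "P o\<^sub>L X = X o\<^sub>L P" if "X \<in> commutant M" for X
      using that by (intro projection_commute[OF P(1), symmetric] commutant_clinear XU
          commutant_adjoint_closed)
  qed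
  with P have prjP: "prj P" by (simp add: prj_def)
  have PG: "P (G x) = G x" if "G \<in> C" for G x
  proof (rule P(3), rule closure_subset[THEN subsetD])
    show "G x \<in> U" using that prj_apply(1)[OF C[OF that]] by (auto simp: U_def)
  qed
  then have sub: "P o\<^sub>L G = G" if "G \<in> C" for G using that by (auto intro: blinfun_eqI)
  have least: "E o\<^sub>L P = P" if E: "prj E" "\<And>G. G \<in> C \<Longrightarrow> E o\<^sub>L G = G" for E
  proof (rule blinfun_eqI)
    fix x
    have "closure U \<subseteq> {x. E x = x}"
    proof (rule closure_minimal)
      show "U \<subseteq> {x. E x = x}" using E(2) by (auto simp: U_def) (metis blinfun_apply_blinfun_compose)
      show "closed {x. E x = x}" by (intro closed_Collect_eq continuous_intros)
    qed
    then show "(E o\<^sub>L P) x = P x" using P(2) by auto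
  qed
  have lub: "positive_op (B - P)" if B: "B \<in> M" "\<And>G. G \<in> C \<Longrightarrow> positive_op (B - G)" for B
  proof -
    obtain G0 where G0: "G0 \<in> C" using ne by blast
    have "B = (B - G0) + G0" by simp
    then have sB: "selfadjoint B"
      using positive_opD(2)[OF B(2)[OF G0]] prj_selfadjoint[OF C[OF G0]] selfadjoint_intros(3) by metis
    have ge: "(norm (G x))\<^sup>2 \<le> inner (B x) x" if "G \<in> C" for G x
      using positive_opD(3)[OF B(2)[OF that], of x] prj_apply(3)[OF C[OF that], of x]
      by (simp add: blinfun.diff_left inner_diff_left)
    have "(norm (P x))\<^sup>2 \<le> inner (B x) x" for x
    proof -
      define b where "b = sqrt (inner (B x) x)"
      have b0: "0 \<le> inner (B x) x" using ge[OF G0, of x] by (meson order_trans zero_le_power2)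
      have Gb: "norm (G x) \<le> b" if "G \<in> C" for G
        using ge[OF that, of x] real_le_rsqrt by (simp add: b_def)
      have "norm (P x) \<le> b + e" if e: "0 < e" for e
      proof -
        obtain y where y: "y \<in> U" "dist y (P x) < e" using P(2)[of x] e by (meson closure_approachable)
        then obtain G where G: "G \<in> C" "G y = y" by (auto simp: U_def)
        have "G (P x) = G x" using sub_prj(1)[OF prjP C[OF G(1)] sub[OF G(1)]] .
        then have "norm (P x) \<le> norm (G x) + norm ((P x - y) - G (P x - y))"
          using norm_triangle_ineq[of "G x" "P x - G x"] G by (simp add: blinfun.diff_right)
        also have "norm ((P x - y) - G (P x - y)) \<le> norm (P x - y)"
          using prj_apply(4)[OF prj_compl(1)[OF C[OF G(1)]], of "P x - y"]
          by (simp add: blinfun.diff_left)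
        finally show ?thesis using y(2) Gb[OF G(1)] by (simp add: dist_norm norm_minus_commute)
      qed
      then have "norm (P x) \<le> b" by (rule field_le_epsilon)
      then have "(norm (P x))\<^sup>2 \<le> b\<^sup>2" by (intro power_mono) auto
      then show ?thesis using b0 by (simp add: b_def)
    qed
    then show ?thesis
      using clinear[OF B(1)] clinear[OF \<open>P \<in> M\<close>] sB prj_selfadjoint[OF prjP]
      by (simp add: positive_op_iff clinear_op_intros selfadjoint_intros blinfun.diff_left
          inner_diff_left prj_apply(3)[OF prjP])
  qed
  have "Re (\<tau> P) = (SUP G\<in>C. Re (\<tau> G))"
  proof (rule trace_normal)
    show "C \<noteq> {}" by (fact ne)
    show "C \<subseteq> M" using C prjD by blast
    show "positive_op X" if "X \<in> C" for X using C[OF that] by (rule prj_positive)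
    show "\<exists>Z\<in>C. positive_op (Z - X) \<and> positive_op (Z - Y)" if XY: "X \<in> C" "Y \<in> C" for X Y
    proof -
      have "positive_op (X - X)" "positive_op (Y - Y)" by (simp_all add: positive_op_intros)
      then show ?thesis
        using chain[OF XY] XY prj_positive[OF sub_prj(3)[OF C[OF XY(1)] C[OF XY(2)]]]
          prj_positive[OF sub_prj(3)[OF C[OF XY(2)] C[OF XY(1)]]] by blast
    qed
    show "P \<in> M" by fact
    show "positive_op (P - X)" if "X \<in> C" for X
      using prj_positive[OF sub_prj(3)[OF prjP C[OF that] sub[OF that]]] .
  qed (rule lub)
  then have "tr P = (SUP G\<in>C. tr G)" by (simp only: tr_def)
  then show ?thesis
    by (intro exI[of _ P] conjI ballI allI impI prjP) (simp_all add: sub least)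
qed

end

section \<open>Traces of projections under the weak Dixmier property\<close>

lemma compose_eq_iff: "A o\<^sub>L B = C \<longleftrightarrow> (\<forall>x. A (B x) = C x)"
  by (metis blinfun_apply_blinfun_compose blinfun_eqI)

context finite_von_neumann_algebra
begin

lemma op_power_projection:
  assumes "projection_op E"
  shows "op_power E (Suc n) = E"
proof (induction n)
  case (Suc n)
  have "E o\<^sub>L E = E" using assms by (simp add: projection_op_def)
  then show ?case using Suc by (subst op_power_simps(2)) simp
qed (auto simp: op_power_simps intro: blinfun_eqI)

text \<open>
  All powers of \<open>S\<close> have the trace of \<open>E\<close>, so \<open>(S\<^sup>2 - S)\<^sup>2 = S\<^sup>4 - 2 S\<^sup>3 + S\<^sup>2\<close> has trace \<open>0\<close>;
  by faithfulness \<open>S\<^sup>2 = S\<close>.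
\<close>

lemma equi_measurable_projection:
  assumes E: "prj E" and eq: "equi_measurable M \<tau> S E"
  shows "prj S" "tr S = tr E"
proof -
  have S: "S \<in> M" "positive_op S" using eq by (simp_all add: equi_measurable_def)
  have t: "\<tau> (op_power S (Suc n)) = \<tau> E" for n
    using eq op_power_projection[OF prjD(2)[OF E], of n] by (simp add: equi_measurable_def)
  have S1: "op_power S (Suc 0) = S" by (auto simp: op_power_simps intro: blinfun_eqI)
  then show "tr S = tr E" using t[of 0] by (simp add: tr_def)
  define D where "D = (S o\<^sub>L S) - S"
  have sD: "D \<in> M" "selfadjoint D"
    using S by (auto simp: D_def positive_op_iff intro!: diff_closed compose_closed
        selfadjoint_intros selfadjoint_compose_commute)
  have "op_adjoint D o\<^sub>L D = op_power S (Suc (Suc (Suc (Suc 0))))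
      - 2 *\<^sub>R op_power S (Suc (Suc (Suc 0))) + op_power S (Suc (Suc 0))"
  proof -
    have "op_adjoint D = D" using sD clinear[OF sD(1)] by (simp add: selfadjoint_iff)
    then show ?thesis
      by (auto intro!: blinfun_eqI simp: op_power_simps D_def blinfun.bilinear_simps scaleR_2)
  qed
  then have "\<tau> (op_adjoint D o\<^sub>L D) = 0"
    using S by (simp add: trace_add tau_diff tau_scaleR diff_closed scaleR_closed op_power_closed t
        del: op_power_simps)
  then have "D = 0" using trace_faithful sD by blast
  then have "S o\<^sub>L S = S" by (simp add: D_def)
  then show "prj S" using S by (simp add: prj_def projection_op_iff positive_op_iff)
qed

definition minimal_prj :: "'h op \<Rightarrow> bool"
  where "minimal_prj F \<longleftrightarrow> prj F \<and> F \<noteq> 0 \<and> (\<forall>G. prj G \<longrightarrow> F o\<^sub>L G = G \<longrightarrow> G = 0 \<or> G = F)"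

text \<open>
  The traces available for cutting projections: all nonnegative numbers if there is no minimal
  projection, and the integer multiples of the trace of a minimal projection otherwise.
\<close>

definition admissible :: "real \<Rightarrow> bool"
  where "admissible a \<longleftrightarrow> 0 \<le> a \<and> (\<forall>F. minimal_prj F \<longrightarrow> (\<exists>n::nat. a = real n * tr F))"

lemma minimal_prjD: "minimal_prj F \<Longrightarrow> prj F" "minimal_prj F \<Longrightarrow> F \<noteq> 0" "minimal_prj F \<Longrightarrow> 0 < tr F"
  by (simp_all add: minimal_prj_def tr_prj_pos)

lemma sub_prj_trans:
  assumes "prj E" "prj F" "E o\<^sub>L F = F" "F o\<^sub>L G = G"
  shows "E o\<^sub>L G = G"
  using assms by (intro blinfun_eqI) (metis blinfun_apply_blinfun_compose)

lemma minimal_prj_subI: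
  assumes E: "prj E" "E \<noteq> 0" "\<not> minimal_prj E"
  obtains F where "prj F" "E o\<^sub>L F = F" "F \<noteq> 0" "E - F \<noteq> 0"
  using assms by (auto simp: minimal_prj_def)

end

locale weak_dixmier_algebra = finite_von_neumann_algebra M \<tau>
  for M :: "'h::complex_hilbert op set" and \<tau> :: "'h op \<Rightarrow> complex" +
  assumes weak_dixmier: "weak_dixmier_property M \<tau>"
begin

text \<open>
  If every projection with the trace of \<open>E\<close> annihilated \<open>F\<close>, then so would the closed convex hull of
  these projections, which contains a nonzero multiple of the identity.
\<close>

lemma equi_measurable_projection_meets:
  assumes E: "prj E" "E \<noteq> 0" and F: "prj F" "F \<noteq> 0"
  obtains E' where "prj E'" "tr E' = tr E" "E' o\<^sub>L F \<noteq> 0"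
proof -
  have "\<exists>S. equi_measurable M \<tau> S E \<and> S o\<^sub>L F \<noteq> 0"
  proof (rule ccontr)
    assume "\<not> ?thesis"
    then have sub: "{S. equi_measurable M \<tau> S E} \<subseteq> {X :: 'h op. X o\<^sub>L F = 0}" by blast
    have "convex {X :: 'h op. X o\<^sub>L F = 0}"
    proof (rule convexI)
      fix X Y :: "'h op" and u v :: real
      assume "X \<in> {X :: 'h op. X o\<^sub>L F = 0}" "Y \<in> {X :: 'h op. X o\<^sub>L F = 0}"
      then show "u *\<^sub>R X + v *\<^sub>R Y \<in> {X :: 'h op. X o\<^sub>L F = 0}"
        by (simp add: compose_eq_iff blinfun.bilinear_simps)
    qed
    moreover have "closed {X :: 'h op. X o\<^sub>L F = 0}"
      by (intro closed_Collect_eq continuous_intros linear_continuous_on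
          bounded_bilinear.bounded_linear_left[OF bounded_bilinear_blinfun_compose])
    ultimately have "closure (convex hull {S. equi_measurable M \<tau> S E}) \<subseteq> {X :: 'h op. X o\<^sub>L F = 0}"
      using sub by (intro closure_minimal hull_minimal)
    moreover have "scaleC_op (\<tau> E) id_blinfun \<in> closure (convex hull {S. equi_measurable M \<tau> S E})"
      using weak_dixmier E(1) by (auto simp: weak_dixmier_property_def prjD prj_positive)
    ultimately have "scaleC_op (\<tau> E) id_blinfun o\<^sub>L F = 0" by blast
    then have "tr E *\<^sub>R F = 0"
      unfolding tau_positive[OF prjD(1)[OF E(1)] prj_positive[OF E(1)]] scaleR_eq_scaleC_op[symmetric]
      by (metis blinfun.scaleR_left blinfun_apply_blinfun_compose blinfun_apply_id_blinfun blinfun_eqI)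
    then show False using F(2) tr_prj_pos[OF E] by simp
  qed
  then show thesis using that equi_measurable_projection[OF E(1)] by blast
qed

text \<open>
  Choose \<open>E'\<close> with the trace of \<open>E\<close> and \<open>E' F \<noteq> 0\<close>. By minimality the part below \<open>F\<close> of the spectral
  projection of \<open>F E' F\<close> for the values above a small \<open>d\<close> is \<open>0\<close> or \<open>F\<close>. It is not \<open>0\<close>, so \<open>E'\<close> is
  bounded below on the range of \<open>F\<close> and \<open>tr_le_of_bounded_below\<close> applies.
\<close>

lemma minimal_prj_tr_le:
  assumes F: "minimal_prj F" and E: "prj E" "E \<noteq> 0"
  shows "tr F \<le> tr E"
proof -
  have pF: "prj F" using F by (rule minimal_prjD)
  obtain E' where E': "prj E'" "tr E' = tr E" "E' o\<^sub>L F \<noteq> 0"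
    using equi_measurable_projection_meets[OF E pF minimal_prjD(2)[OF F]] .
  then obtain x0 where x0: "E' (F x0) \<noteq> 0"
    by (metis blinfun_apply_blinfun_compose blinfun_eqI zero_blinfun.rep_eq)
  then have Fx0: "F x0 \<noteq> 0" by (auto simp: blinfun.zero_right)
  \<comment> \<open>half of the value of the quadratic form of \<open>F E' F\<close> at \<open>F x0\<close>, normalized\<close>
  define d where "d = (norm (E' (F x0)))\<^sup>2 / (2 * (norm (F x0))\<^sup>2)"
  have d: "0 < d" "2 * (d * (norm (F x0))\<^sup>2) = (norm (E' (F x0)))\<^sup>2"
    using x0 Fx0 by (simp_all add: d_def)
  define A where "A = (F o\<^sub>L E' o\<^sub>L F) - d *\<^sub>R id_blinfun"
  have "A \<in> M" "selfadjoint A"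
    using pF E'(1) by (auto simp: A_def prjD prj_selfadjoint intro!: diff_closed compose_closed
        scaleR_closed id_closed selfadjoint_intros selfadjoint_sandwich)
  then obtain P where P: "P \<in> M" "projection_op P"
    "\<And>x. 0 \<le> inner (A (P x)) (P x)" "\<And>x. inner (A (x - P x)) (x - P x) \<le> 0"
    "\<And>X. clinear_op X \<Longrightarrow> selfadjoint X \<Longrightarrow> X o\<^sub>L A = A o\<^sub>L X \<Longrightarrow> X o\<^sub>L P = P o\<^sub>L X"
    using spectral_projection by metis
  have AF: "inner (A x) x = (norm (E' x))\<^sup>2 - d * (norm x)\<^sup>2" if "F x = x" for x
  proof -
    have "inner (F (E' x)) x = inner (E' x) x" using prj_apply(2)[OF pF, of "E' x" x] that by simp
    then show ?thesis
      by (simp add: A_def blinfun.bilinear_simps that inner_diff_left prj_apply(3)[OF E'(1)]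
          power2_norm_eq_inner[of x])
  qed
  have "F o\<^sub>L A = A o\<^sub>L F"
    by (rule blinfun_eqI) (simp add: A_def blinfun.bilinear_simps prj_apply[OF pF])
  then have comm: "F o\<^sub>L P = P o\<^sub>L F"
    using pF by (intro P(5)) (auto simp: clinear prjD prj_selfadjoint)
  then have FP: "F (P x) = P (F x)" for x by (rule commute_apply)
  have pP: "prj P" using P by (simp add: prj_def)
  have "prj (F o\<^sub>L P)"
    using pF pP comm by (intro prjI compose_closed selfadjoint_compose_commute)
      (auto simp: prjD prj_selfadjoint FP[symmetric] prj_apply)
  moreover have "F o\<^sub>L (F o\<^sub>L P) = F o\<^sub>L P" by (rule blinfun_eqI) (simp add: prj_apply[OF pF])
  ultimately consider "F o\<^sub>L P = 0" | "F o\<^sub>L P = F" using F by (auto simp: minimal_prj_def)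
  then show ?thesis
  proof cases
    case 1
    have FF: "F (F x0) = F x0" by (rule prj_apply[OF pF])
    have "P (F x0) = 0" using 1 FP[of x0] by (metis blinfun_apply_blinfun_compose zero_blinfun.rep_eq)
    then have "inner (A (F x0)) (F x0) \<le> 0" using P(4)[of "F x0"] by simp
    then have "(norm (E' (F x0)))\<^sup>2 \<le> d * (norm (F x0))\<^sup>2" by (simp add: AF[OF FF])
    then have "(norm (E' (F x0)))\<^sup>2 \<le> 0" using d(2) by linarith
    then show ?thesis using x0 by simp
  next
    case 2
    have "tr F \<le> tr E'"
    proof (rule tr_le_of_bounded_below[OF pF E'(1) d(1)])
      fix x assume x: "F x = x"
      have "P x = x" using 2 FP[of x] x by (metis blinfun_apply_blinfun_compose)
      then show "d * (norm x)\<^sup>2 \<le> (norm (E' x))\<^sup>2" using P(3)[of x] AF[OF x] by simp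
    qed
    then show ?thesis using E' by simp
  qed
qed

lemma minimal_prj_tr_eq: "minimal_prj F \<Longrightarrow> minimal_prj G \<Longrightarrow> tr F = tr G"
  by (intro antisym minimal_prj_tr_le) (auto simp: minimal_prjD)

text \<open>
  Splitting off a nonzero part costs at least \<open>\<tau> F\<close> of the trace, so this stops after finitely many
  steps; \<open>k\<close> bounds their number.
\<close>

lemma contains_minimal_prj:
  assumes F: "minimal_prj F"
  shows "prj E \<Longrightarrow> E \<noteq> 0 \<Longrightarrow> tr E \<le> real k * tr F \<Longrightarrow> \<exists>G. minimal_prj G \<and> E o\<^sub>L G = G"
proof (induction k arbitrary: E)
  case 0
  then show ?case using tr_prj_pos[of E] by simp
next
  case (Suc k)
  show ?case
  proof (cases "minimal_prj E")
    case True
    then have "E o\<^sub>L E = E" by (simp add: minimal_prj_def prj_def projection_op_def)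
    then show ?thesis using True by blast
  next
    case False
    then obtain H where H: "prj H" "E o\<^sub>L H = H" "H \<noteq> 0" "E - H \<noteq> 0"
      using minimal_prj_subI Suc.prems by metis
    have "tr F \<le> tr (E - H)"
      using sub_prj(3)[OF Suc.prems(1) H(1,2)] H(4) by (intro minimal_prj_tr_le[OF F])
    then have "tr H \<le> real k * tr F"
      using Suc.prems(3) sub_prj(4)[OF Suc.prems(1) H(1,2)] by (simp add: algebra_simps)
    then obtain G where "minimal_prj G" "H o\<^sub>L G = G" using Suc.IH[OF H(1,3)] by blast
    then show ?thesis using sub_prj_trans[OF Suc.prems(1) H(1,2)] by blast
  qed
qed

lemma contains_minimal_prj':
  assumes F: "minimal_prj F" and E: "prj E" "E \<noteq> 0"
  obtains G where "minimal_prj G" "E o\<^sub>L G = G"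
proof -
  obtain k :: nat where "tr E / tr F < real k" using reals_Archimedean2 by blast
  then have "tr E \<le> real k * tr F" using minimal_prjD(3)[OF F] by (simp add: pos_divide_less_eq)
  then show thesis using contains_minimal_prj[OF F E] that by blast
qed

text \<open>
  One of the two parts of a projection that is not minimal has at most half of its trace.
\<close>

lemma contains_small_prj:
  assumes none: "\<And>F. \<not> minimal_prj F" and E: "prj E" "E \<noteq> 0"
  shows "\<exists>G. prj G \<and> G \<noteq> 0 \<and> E o\<^sub>L G = G \<and> tr G \<le> tr E / 2 ^ n"
proof (induction n)
  case 0
  have "E o\<^sub>L E = E" using E(1) by (simp add: prj_def projection_op_def)
  then show ?case using E by auto
next
  case (Suc n)
  then obtain G where G: "prj G" "G \<noteq> 0" "E o\<^sub>L G = G" "tr G \<le> tr E / 2 ^ n" by blast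
  obtain H where H: "prj H" "G o\<^sub>L H = H" "H \<noteq> 0" "G - H \<noteq> 0"
    using minimal_prj_subI[OF G(1,2) none] .
  note GH = sub_prj[OF G(1) H(1,2)]
  have GH': "G o\<^sub>L (G - H) = G - H" by (rule blinfun_eqI) (simp add: blinfun.bilinear_simps GH prj_apply[OF G(1)])
  show ?case
  proof (cases "tr H \<le> tr G / 2")
    case True
    moreover have "tr G / 2 \<le> tr E / 2 ^ Suc n" using G(4) by simp
    ultimately show ?thesis using H sub_prj_trans[OF E(1) G(1,3) H(2)] by (meson order_trans)
  next
    case False
    then have "tr (G - H) \<le> tr G / 2" using GH(4) by (simp add: field_simps)
    moreover have "tr G / 2 \<le> tr E / 2 ^ Suc n" using G(4) by simp
    ultimately show ?thesis using H GH(3) sub_prj_trans[OF E(1) G(1,3) GH'] by (meson order_trans)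
  qed
qed

lemma contains_prj_tr_le:
  assumes E: "prj E" "E \<noteq> 0" and a: "admissible a" "0 < a"
  obtains G where "prj G" "G \<noteq> 0" "E o\<^sub>L G = G" "tr G \<le> a"
proof (cases "\<exists>F. minimal_prj F")
  case True
  then obtain F where F: "minimal_prj F" by blast
  obtain G where G: "minimal_prj G" "E o\<^sub>L G = G" using contains_minimal_prj'[OF F E] .
  obtain n :: nat where n: "a = real n * tr G" using a(1) G(1) by (auto simp: admissible_def)
  then have "n \<noteq> 0" using a(2) by (cases "n = 0") auto
  then have "tr G \<le> a" using n minimal_prjD(3)[OF G(1)] by (simp add: Suc_leI)
  then show thesis using that G minimal_prjD by blast
next
  case False
  obtain n where n: "(1 / 2) ^ n < a / tr E"
    using real_arch_pow_inv[of "a / tr E" "1 / 2"] a(2) tr_prj_pos[OF E] by auto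
  obtain G where G: "prj G" "G \<noteq> 0" "E o\<^sub>L G = G" "tr G \<le> tr E / 2 ^ n"
    using contains_small_prj[of E n] E False by blast
  have "tr E / 2 ^ n \<le> a" using n tr_prj_pos[OF E] by (simp add: power_one_over field_simps)
  then show thesis using that G by (meson order_trans)
qed

text \<open>
  Minimal projections of the common trace are split off one by one.
\<close>

lemma admissible_prj:
  assumes E: "prj E"
  shows "admissible (tr E)"
proof -
  have "\<exists>n::nat. tr E = real n * tr F" if F: "minimal_prj F" for F
  proof -
    have "\<exists>n::nat. tr E = real n * tr F" if "prj E" "tr E \<le> real k * tr F" for k E
      using that
    proof (induction k arbitrary: E)
      case 0
      then show ?case using tr_prj_nonneg[of E] by (intro exI[of _ 0]) simp
    next
      case (Suc k)
      show ?case
      proof (cases "E = 0")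
        case True
        then show ?thesis by (intro exI[of _ 0]) (simp add: tr_zero)
      next
        case False
        then obtain G where G: "minimal_prj G" "E o\<^sub>L G = G"
          using contains_minimal_prj'[OF F Suc.prems(1)] by blast
        note EG = sub_prj[OF Suc.prems(1) minimal_prjD(1)[OF G(1)] G(2)]
        have eq: "tr (E - G) = tr E - tr F" using EG(4) minimal_prj_tr_eq[OF F G(1)] by simp
        then have "tr (E - G) \<le> real k * tr F" using Suc.prems(2) by (simp add: algebra_simps)
        then obtain n :: nat where "tr (E - G) = real n * tr F" using Suc.IH[OF EG(3)] by blast
        then have "tr E = real (Suc n) * tr F" using eq by (simp add: algebra_simps)
        then show ?thesis by blast
      qed
    qed
    moreover obtain k :: nat where "tr E / tr F < real k" using reals_Archimedean2 by blast
    then have "tr E \<le> real k * tr F" using minimal_prjD(3)[OF F] by (simp add: pos_divide_less_eq)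
    ultimately show ?thesis using E by blast
  qed
  then show ?thesis using tr_prj_nonneg[OF E] by (simp add: admissible_def)
qed

lemma admissible_diff:
  assumes "admissible a" "admissible b" "b \<le> a"
  shows "admissible (a - b)"
  unfolding admissible_def
proof (intro conjI allI impI)
  fix F assume F: "minimal_prj F"
  obtain m n :: nat where mn: "a = real m * tr F" "b = real n * tr F"
    using assms(1,2) F unfolding admissible_def by blast
  then have "n \<le> m" using assms(3) minimal_prjD(3)[OF F] by simp
  then show "\<exists>n::nat. a - b = real n * tr F"
    using mn by (intro exI[of _ "m - n"]) (simp add: of_nat_diff algebra_simps)
qed (use assms in simp)

text \<open>
  A maximal subprojection of trace at most \<open>a\<close> has trace exactly \<open>a\<close>, since a smaller one could
  be enlarged by a sufficiently small subprojection of its complement.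
\<close>

lemma sub_prj_of_trace:
  assumes E: "prj E" and a: "admissible a" "a \<le> tr E"
  obtains G where "prj G" "E o\<^sub>L G = G" "tr G = a"
proof -
  define S where "S = {G. prj G \<and> E o\<^sub>L G = G \<and> tr G \<le> a}"
  define le where "le G H \<longleftrightarrow> H o\<^sub>L G = G" for G H :: "'h op"
  have "partial_order_on S (relation_of le S)"
  proof (rule partial_order_on_relation_ofI)
    show "le G G" if "G \<in> S" for G using that by (simp add: S_def le_def prj_def projection_op_def)
    show "le G K" if "G \<in> S" "H \<in> S" "K \<in> S" "le G H" "le H K" for G H K
      using that sub_prj_trans[of K H G] by (simp add: S_def le_def)
    show "G = H" if "G \<in> S" "H \<in> S" "le G H" "le H G" for G H
    proof (rule blinfun_eqI)
      fix x
      have "G (H x) = G x" "G (H x) = H x"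
        using that sub_prj(1)[of H G x] sub_prj(2)[of G H x] by (simp_all add: S_def le_def)
      then show "G x = H x" by simp
    qed
  qed
  moreover have "\<exists>u\<in>S. \<forall>G\<in>C. le G u" if "C \<in> Chains (relation_of le S)" for C
  proof (cases "C = {}")
    case True
    have "0 \<in> S" using a by (auto simp: S_def prj_zero tr_zero admissible_def)
    then show ?thesis using True by blast
  next
    case False
    have CS: "C \<subseteq> S" using that by (auto simp: Chains_def relation_of_def)
    have prjC: "prj G" if "G \<in> C" for G using that CS by (auto simp: S_def)
    have chain: "G o\<^sub>L H = H \<or> H o\<^sub>L G = G" if "G \<in> C" "H \<in> C" for G H
      using that \<open>C \<in> Chains _\<close> by (auto simp: Chains_def relation_of_def le_def)
    have "\<exists>P. prj P \<and> (\<forall>G\<in>C. P o\<^sub>L G = G) \<and>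
        (\<forall>E. prj E \<longrightarrow> (\<forall>G\<in>C. E o\<^sub>L G = G) \<longrightarrow> E o\<^sub>L P = P) \<and> tr P = (SUP G\<in>C. tr G)"
      using False prjC chain by (rule chain_supremum)
    then obtain P where P: "prj P" "\<And>G. G \<in> C \<Longrightarrow> P o\<^sub>L G = G"
      "\<And>E. prj E \<Longrightarrow> (\<And>G. G \<in> C \<Longrightarrow> E o\<^sub>L G = G) \<Longrightarrow> E o\<^sub>L P = P" "tr P = (SUP G\<in>C. tr G)"
      by blast
    have "tr P \<le> a" unfolding P(4) using CS False by (intro cSUP_least) (auto simp: S_def)
    moreover have "E o\<^sub>L P = P" using CS by (intro P(3) E) (auto simp: S_def)
    ultimately have "P \<in> S" using P(1) by (simp add: S_def)
    then show ?thesis using P(2) by (auto simp: le_def)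
  qed
  ultimately obtain G where G: "G \<in> S" "\<And>H. H \<in> S \<Longrightarrow> le G H \<Longrightarrow> H = G"
    using predicate_Zorn[of S le] by blast
  then have G': "prj G" "E o\<^sub>L G = G" "tr G \<le> a" by (simp_all add: S_def)
  note EG = sub_prj[OF E G'(1,2)]
  have "tr G = a"
  proof (rule ccontr)
    assume "tr G \<noteq> a"
    then have lt: "0 < a - tr G" using G'(3) by simp
    have "E - G \<noteq> 0" using lt a(2) EG(4) by (auto simp: tr_zero)
    then obtain H where H: "prj H" "H \<noteq> 0" "(E - G) o\<^sub>L H = H" "tr H \<le> a - tr G"
      using contains_prj_tr_le[OF EG(3) _ admissible_diff[OF a(1) admissible_prj[OF G'(1)] G'(3)] lt]
      by blast
    have EH: "E (H x) = H x" "G (H x) = 0" for x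
    proof -
      have 1: "H x = E (H x) - G (H x)" using H(3) by (metis blinfun_apply_blinfun_compose blinfun.diff_left)
      have "G (H x) = G (E (H x)) - G (G (H x))" using 1 by (metis blinfun.diff_right)
      then show "G (H x) = 0" by (simp add: EG(1) prj_apply[OF G'(1)])
      then show "E (H x) = H x" using 1 by simp
    qed
    have "G o\<^sub>L H = 0" by (rule blinfun_eqI) (simp add: EH)
    note GH = orth_prj[OF G'(1) H(1) this]
    have "E o\<^sub>L (G + H) = G + H"
      by (rule blinfun_eqI) (simp add: blinfun.bilinear_simps EH EG(2))
    then have "G + H \<in> S" using GH(3,4) H(4) by (simp add: S_def)
    moreover have "le G (G + H)" using GH(5) by (simp add: le_def)
    ultimately have "G + H = G" by (rule G(2))
    then show False using H(2) by simp
  qed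
  then show thesis using that G' by blast
qed

lemma orthogonal_sub_prjs:
  assumes c: "admissible c"
  shows "prj E \<Longrightarrow> real r * c \<le> tr E \<Longrightarrow>
    \<exists>P. (\<forall>l<r. prj (P l) \<and> tr (P l) = c \<and> E o\<^sub>L P l = P l) \<and> (\<forall>l<r. \<forall>k<r. l \<noteq> k \<longrightarrow> P l o\<^sub>L P k = 0)"
proof (induction r arbitrary: E)
  case (Suc r)
  have c0: "0 \<le> c" using c by (simp add: admissible_def)
  then have "c \<le> tr E"
    using Suc.prems(2) mult_nonneg_nonneg[of "real r" c] unfolding of_nat_Suc distrib_right by linarith
  then obtain G where G: "prj G" "E o\<^sub>L G = G" "tr G = c" using sub_prj_of_trace[OF Suc.prems(1) c] by blast
  note EG = sub_prj[OF Suc.prems(1) G(1,2)]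
  have "real r * c \<le> tr (E - G)" using Suc.prems(2) EG(4) G(3) by (simp add: algebra_simps)
  then obtain P where P: "\<And>l. l < r \<Longrightarrow> prj (P l) \<and> tr (P l) = c \<and> (E - G) o\<^sub>L P l = P l"
    "\<And>l k. l < r \<Longrightarrow> k < r \<Longrightarrow> l \<noteq> k \<Longrightarrow> P l o\<^sub>L P k = 0"
    using Suc.IH[OF EG(3)] by blast
  have EGE: "E o\<^sub>L (E - G) = E - G"
    by (rule blinfun_eqI) (simp add: blinfun.bilinear_simps EG prj_apply[OF Suc.prems(1)])
  have sub: "E o\<^sub>L P l = P l" if "l < r" for l
    using sub_prj_trans[OF Suc.prems(1) EG(3) EGE] P(1)[OF that] by blast
  have GP: "G o\<^sub>L P l = 0" if "l < r" for l
  proof (rule blinfun_eqI)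
    fix x
    have "P l x = (E - G) (P l x)" using P(1)[OF that] by (metis blinfun_apply_blinfun_compose)
    then have "G (P l x) = G ((E - G) (P l x))" by (rule arg_cong)
    also have "\<dots> = 0" by (simp add: blinfun.bilinear_simps EG(1) prj_apply[OF G(1)])
    finally show "(G o\<^sub>L P l) x = blinfun_apply 0 x" by simp
  qed
  have PG: "P l o\<^sub>L G = 0" if "l < r" for l
    using orth_prj(2)[OF G(1) _ GP[OF that]] P(1)[OF that] by (simp add: compose_eq_iff)
  show ?case
    using P sub GP PG G by (intro exI[of _ "P(r := G)"]) (auto simp: less_Suc_eq)
qed simp

end

section \<open>Weighted submajorization of finite sequences\<close>

text \<open>
  The Robin Hood argument of Hardy, Littlewood and Polya with weights. Take the first \<open>j\<close> with
  \<open>f j > g j\<close> and the last \<open>i < j\<close> with \<open>f i < g i\<close>. Moving mass from \<open>i\<close> to \<open>j\<close> until \<open>g\<close> agrees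
  with \<open>f\<close> at one of them keeps \<open>g\<close> decreasing and its partial sums at least those of \<open>f\<close>, since \<open>f = g\<close> in between.
  Once no such \<open>j\<close> is left, \<open>f \<le> g\<close> pointwise.
\<close>

lemma submajorization_induct:
  fixes \<nu> :: "(nat \<Rightarrow> real) \<Rightarrow> real" and w f g :: "nat \<Rightarrow> real"
  assumes w: "\<And>k. k < m \<Longrightarrow> 0 < w k"
    and cong: "\<And>f g. (\<And>k. k < m \<Longrightarrow> f k = g k) \<Longrightarrow> \<nu> f = \<nu> g"
    and lower: "\<And>g k c. (\<And>k. k < m \<Longrightarrow> 0 \<le> g k) \<Longrightarrow> k < m \<Longrightarrow> 0 \<le> c \<Longrightarrow> c \<le> g k \<Longrightarrow>
      \<nu> (g(k := c)) \<le> \<nu> g"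
    and transfer: "\<And>g i j a b. (\<And>k. k < m \<Longrightarrow> 0 \<le> g k) \<Longrightarrow> i < j \<Longrightarrow> j < m \<Longrightarrow>
      g j \<le> b \<Longrightarrow> b \<le> a \<Longrightarrow> a \<le> g i \<Longrightarrow> w i * a + w j * b = w i * g i + w j * g j \<Longrightarrow>
      \<nu> (g(i := a, j := b)) \<le> \<nu> g"
    and f: "\<And>k. k < m \<Longrightarrow> 0 \<le> f k" "\<And>k l. k \<le> l \<Longrightarrow> l < m \<Longrightarrow> f l \<le> f k"
  shows "(\<And>k. k < m \<Longrightarrow> 0 \<le> g k) \<Longrightarrow> (\<And>k l. k \<le> l \<Longrightarrow> l < m \<Longrightarrow> g l \<le> g k) \<Longrightarrow>
    (\<And>k. k \<le> m \<Longrightarrow> (\<Sum>l<k. w l * f l) \<le> (\<Sum>l<k. w l * g l)) \<Longrightarrow> \<nu> f \<le> \<nu> g"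
proof (induction "card {k. k < m \<and> f k \<noteq> g k}" arbitrary: g rule: less_induct)
  case less
  note g0 = less.prems(1) and gdec = less.prems(2) and sums = less.prems(3)
  show ?case
  proof (cases "\<exists>j<m. f j > g j")
    case False
    have "\<nu> (\<lambda>k. if k < n then f k else g k) \<le> \<nu> g" if "n \<le> m" for n
      using that
    proof (induction n)
      case (Suc n)
      let ?h = "\<lambda>k. if k < n then f k else g k"
      have "\<nu> (?h(n := f n)) \<le> \<nu> ?h"
        using f(1) g0 Suc.prems False[unfolded not_ex, rule_format, of n] by (intro lower) auto
      moreover have "?h(n := f n) = (\<lambda>k. if k < Suc n then f k else g k)" by (auto simp: less_Suc_eq)
      ultimately show ?case using Suc by simp
    qed simp
    from this[of m] have "\<nu> (\<lambda>k. if k < m then f k else g k) \<le> \<nu> g" by simp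
    then show ?thesis using cong[of f "\<lambda>k. if k < m then f k else g k"] by simp
  next
    case True
    define j where "j = (LEAST j. j < m \<and> f j > g j)"
    have j: "j < m" "f j > g j" using LeastI_ex[OF True] by (simp_all add: j_def)
    have before: "f k \<le> g k" if "k < j" for k
      using not_less_Least[of k "\<lambda>j. j < m \<and> f j > g j"] that j by (auto simp: j_def)
    have "\<exists>i<j. f i < g i"
    proof (rule ccontr)
      assume "\<not> ?thesis"
      then have eq: "f k = g k" if "k < j" for k using before[OF that] that by force
      have "(\<Sum>l<Suc j. w l * f l) \<le> (\<Sum>l<Suc j. w l * g l)" using j by (intro sums) simp
      then have "w j * f j \<le> w j * g j" using eq by simp
      then show False using w[OF j(1)] j(2) by simp
    qed
    then have fin: "finite {i. i < j \<and> f i < g i}" "{i. i < j \<and> f i < g i} \<noteq> {}" by auto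
    define i where "i = Max {i. i < j \<and> f i < g i}"
    have i: "i < j" "f i < g i" using Max_in[OF fin] by (auto simp: i_def)
    have between: "f k = g k" if "i < k" "k < j" for k
    proof -
      have "\<not> f k < g k"
      proof
        assume "f k < g k"
        then have "k \<le> i" unfolding i_def using that by (intro Max_ge fin(1)) simp
        then show False using that by simp
      qed
      then show ?thesis using before[OF that(2)] by simp
    qed
    have wi: "0 < w i" and wj: "0 < w j" using w i j by auto
    define d where "d = min (w i * (g i - f i)) (w j * (f j - g j))"
    have d: "0 < d" "d \<le> w i * (g i - f i)" "d \<le> w j * (f j - g j)"
      using wi wj i j by (auto simp: d_def)
    define a where "a = g i - d / w i"
    define b where "b = g j + d / w j"
    have ab: "f i \<le> a" "a \<le> g i" "g j \<le> b" "b \<le> f j"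
      using d wi wj by (auto simp: a_def b_def field_simps)
    have ba: "b \<le> a" using ab f(2)[of i j] i j by linarith
    have cases: "a = f i \<or> b = f j"
    proof (cases "w i * (g i - f i) \<le> w j * (f j - g j)")
      case True
      then have "d = w i * (g i - f i)" by (simp add: d_def)
      then show ?thesis using wi by (simp add: a_def)
    next
      case False
      then have "d = w j * (f j - g j)" by (simp add: d_def)
      then show ?thesis using wj by (simp add: b_def)
    qed
    define h where "h = g(i := a, j := b)"
    have ij: "i \<noteq> j" using i by simp
    have h: "h i = a" "h j = b" "\<And>k. k \<noteq> i \<Longrightarrow> k \<noteq> j \<Longrightarrow> h k = g k" using ij by (auto simp: h_def)
    have "\<nu> h \<le> \<nu> g"
      unfolding h_def
    proof (rule transfer[OF g0 i(1) j(1) ab(3) ba ab(2)])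
      show "w i * a + w j * b = w i * g i + w j * g j"
        using wi wj by (simp add: a_def b_def algebra_simps)
    qed
    moreover have "\<nu> f \<le> \<nu> h"
    proof (rule less.hyps)
      have "{k. k < m \<and> f k \<noteq> h k} \<subset> {k. k < m \<and> f k \<noteq> g k}"
      proof
        show "{k. k < m \<and> f k \<noteq> h k} \<subseteq> {k. k < m \<and> f k \<noteq> g k}"
          using i j h by (auto; metis less_irrefl)
        have "(i \<in> {k. k < m \<and> f k \<noteq> g k} - {k. k < m \<and> f k \<noteq> h k}) \<or>
            (j \<in> {k. k < m \<and> f k \<noteq> g k} - {k. k < m \<and> f k \<noteq> h k})"
          using cases i j h by auto
        then show "{k. k < m \<and> f k \<noteq> h k} \<noteq> {k. k < m \<and> f k \<noteq> g k}" by blast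
      qed
      then show "card {k. k < m \<and> f k \<noteq> h k} < card {k. k < m \<and> f k \<noteq> g k}"
        by (intro psubset_card_mono) auto
      show "0 \<le> h k" if "k < m" for k
        using g0[OF that] f(1)[of i] ab g0[OF j(1)] i j h(3)[of k] h(1,2)
        by (cases "k = i"; cases "k = j") auto
      show "h l \<le> h k" if kl: "k \<le> l" "l < m" for k l
      proof -
        consider "k = l" | "k < l" "k = i" | "k < l" "k = j" | "k < l" "l = i" "k \<noteq> j"
          | "k < l" "l = j" "k \<noteq> i" | "k \<noteq> i" "l \<noteq> i" "k \<noteq> j" "l \<noteq> j"
          using kl(1) le_neq_implies_less by metis
        then show ?thesis
        proof cases
          case 2
          show ?thesis
          proof (cases l j rule: linorder_cases)
            case less
            then have "h l = f l" using 2 h(3)[of l] between[of l] by simp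
            then show ?thesis using 2 h(1) ab(1) f(2)[of i l] kl by simp
          next
            case equal
            then show ?thesis using 2 ba h by simp
          next
            case greater
            then have "h l = g l" using 2 by (intro h) auto
            then show ?thesis using greater 2 h(1) ab ba gdec[of j l] kl by simp
          qed
        next
          case 3
          then have "h l = g l" using i by (intro h) auto
          then show ?thesis using 3 h(2) ab(3) gdec[of j l] kl by simp
        next
          case 4
          then have "h k = g k" by (intro h) auto
          then show ?thesis using 4 h(1) ab(2) gdec[of k i] kl by simp
        next
          case 5
          show ?thesis
          proof (cases "k < i")
            case True
            then have "h k = g k" using i by (intro h) auto
            then show ?thesis using 5 True h(2) ba ab gdec[of k i] i j by simp
          next
            case False
            then have "h k = f k" using 5 h(3)[of k] between[of k] by simp
            then show ?thesis using 5 h(2) ab(4) f(2)[of k j] j by simp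
          qed
        next
          case 6
          then show ?thesis using h(3)[of k] h(3)[of l] gdec kl by simp
        qed simp
      qed
      show "(\<Sum>l<k. w l * f l) \<le> (\<Sum>l<k. w l * h l)" if k: "k \<le> m" for k
      proof -
        have "w i * a = w i * g i - d" "w j * b = w j * g j + d"
          using wi wj by (simp_all add: a_def b_def right_diff_distrib distrib_left)
        then have "w l * h l = w l * g l + ((if l = j then d else 0) - (if l = i then d else 0))" for l
          using h ij by (cases "l = i"; cases "l = j") auto
        then have "(\<Sum>l<k. w l * h l) =
            (\<Sum>l<k. w l * g l) + ((\<Sum>l<k. if l = j then d else 0) - (\<Sum>l<k. if l = i then d else 0))"
          by (simp add: sum.distrib sum_subtractf)
        then have hk: "(\<Sum>l<k. w l * h l) =
            (\<Sum>l<k. w l * g l) + ((if j < k then d else 0) - (if i < k then d else 0))"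
          by simp
        show ?thesis
        proof (cases "i < k \<and> k \<le> j")
          case True
          then have "Suc i \<le> k" by simp
          then have "(\<Sum>l<k. w l * f l) + w i * (g i - f i) \<le> (\<Sum>l<k. w l * g l)" using True
          proof (induction k rule: dec_induct)
            case base
            then show ?case using sums[of i] i j by (simp add: algebra_simps)
          next
            case (step n)
            then show ?case using between[of n] by simp
          qed
          then show ?thesis using hk True d(2) by simp
        next
          case False
          then show ?thesis using hk sums[OF k] i d(1) by auto
        qed
      qed
    qed
    ultimately show ?thesis by simp
  qed
qed

section \<open>Gauge norms of simple operators\<close>

context finite_von_neumann_algebra
begin

definition orth_family :: "nat \<Rightarrow> (nat \<Rightarrow> 'h op) \<Rightarrow> bool"
  where "orth_family n P \<longleftrightarrow>
    (\<forall>l<n. prj (P l)) \<and> (\<forall>l<n. \<forall>k<n. l \<noteq> k \<longrightarrow> P l o\<^sub>L P k = 0)"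

lemma orth_familyD:
  assumes "orth_family n P"
  shows "l < n \<Longrightarrow> prj (P l)" "l < n \<Longrightarrow> k < n \<Longrightarrow> l \<noteq> k \<Longrightarrow> P l (P k x) = 0"
    "l < n \<Longrightarrow> P l \<in> M"
  using assms unfolding orth_family_def by (simp_all add: compose_eq_iff prj_def)

lemma orth_family_apply:
  assumes "orth_family n P" "l < n"
  shows "P l (\<Sum>k<n. h k *\<^sub>R P k x) = h l *\<^sub>R P l x"
proof -
  have "P l (\<Sum>k<n. h k *\<^sub>R P k x) = (\<Sum>k<n. h k *\<^sub>R P l (P k x))"
    by (simp add: blinfun.sum_right blinfun.scaleR_right)
  also have "\<dots> = (\<Sum>k<n. if k = l then h l *\<^sub>R P l x else 0)"
    using assms orth_familyD[OF assms(1)] by (intro sum.cong) (auto simp: prj_apply)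
  finally show ?thesis using assms(2) by simp
qed

lemma simple_apply:
  fixes P :: "nat \<Rightarrow> 'h op"
  shows "blinfun_apply (\<Sum>l<n. h l *\<^sub>R P l) x = (\<Sum>l<n. h l *\<^sub>R P l x)"
  by (simp add: blinfun.sum_left blinfun.scaleR_left)

lemma simple_apply_member:
  assumes "orth_family m E" "k < m"
  shows "blinfun_apply (\<Sum>l<m. h l *\<^sub>R E l) (E k x) = h k *\<^sub>R E k x"
proof -
  have "blinfun_apply (\<Sum>l<m. h l *\<^sub>R E l) (E k x) = (\<Sum>l<m. h l *\<^sub>R E l (E k x))"
    by (rule simple_apply)
  also have "\<dots> = (\<Sum>l<m. if l = k then h k *\<^sub>R E k x else 0)"
    using assms orth_familyD[OF assms(1)] by (intro sum.cong) (auto simp: prj_apply)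
  finally show ?thesis using assms(2) by simp
qed

lemma simple_closed: "orth_family n P \<Longrightarrow> (\<Sum>l<n. h l *\<^sub>R P l) \<in> M"
  by (intro sum_closed scaleR_closed) (auto dest: orth_familyD)

lemma simple_selfadjoint: "orth_family n P \<Longrightarrow> selfadjoint (\<Sum>l<n. h l *\<^sub>R P l)"
  by (intro selfadjoint_sum selfadjoint_intros) (auto dest: orth_familyD prj_selfadjoint)

lemma positive_op_sum: "(\<And>i. i \<in> I \<Longrightarrow> positive_op (f i)) \<Longrightarrow> positive_op (\<Sum>i\<in>I. f i)"
  by (induction I rule: infinite_finite_induct) (auto intro: positive_op_intros)

lemma simple_positive:
  "orth_family n P \<Longrightarrow> (\<And>l. l < n \<Longrightarrow> 0 \<le> h l) \<Longrightarrow> positive_op (\<Sum>l<n. h l *\<^sub>R P l)"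
  by (intro positive_op_sum positive_op_intros) (auto dest: orth_familyD prj_positive)

lemma orth_family_projection:
  assumes "orth_family n P"
  shows "prj (\<Sum>l<n. P l)" "tr (\<Sum>l<n. P l) = (\<Sum>l<n. tr (P l))"
proof -
  have "blinfun_apply (\<Sum>l<n. P l) x = (\<Sum>l<n. P l x)" for x by (simp add: blinfun.sum_left)
  moreover have "P l (\<Sum>k<n. P k x) = P l x" if "l < n" for l x
    using orth_family_apply[OF assms that, of "\<lambda>_. 1"] by simp
  ultimately show "prj (\<Sum>l<n. P l)"
    using assms by (intro prjI sum_closed selfadjoint_sum) (auto dest: orth_familyD prj_selfadjoint)
  show "tr (\<Sum>l<n. P l) = (\<Sum>l<n. tr (P l))"
    using tau_sum[of "{..<n}" P] orth_familyD(3)[OF assms] by (simp add: tr_def)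
qed

lemma op_power_simple:
  fixes R :: "'h op"
  assumes P: "orth_family n P" and RP: "\<And>l x. l < n \<Longrightarrow> R (P l x) = 0"
    and PR: "\<And>l x. l < n \<Longrightarrow> P l (R x) = 0"
  shows "op_power (R + (\<Sum>l<n. h l *\<^sub>R P l)) (Suc k) =
    op_power R (Suc k) + (\<Sum>l<n. h l ^ Suc k *\<^sub>R P l)"
proof (induction k)
  case (Suc k)
  show ?case
  proof (rule blinfun_eqI)
    fix x
    define y where "y = op_power R (Suc k) x"
    have y: "P l y = 0" if "l < n" for l using PR[OF that] by (simp add: y_def op_power_simps)
    have R0: "R (\<Sum>l<n. c l *\<^sub>R P l x) = 0" for c
      by (simp add: blinfun.sum_right blinfun.scaleR_right RP)
    have PP: "(\<Sum>l<n. h l *\<^sub>R P l (y + (\<Sum>l<n. h l ^ Suc k *\<^sub>R P l x))) =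
        (\<Sum>l<n. h l ^ Suc (Suc k) *\<^sub>R P l x)"
    proof (intro sum.cong refl)
      fix l assume "l \<in> {..<n}"
      then have "P l (y + (\<Sum>l<n. h l ^ Suc k *\<^sub>R P l x)) = h l ^ Suc k *\<^sub>R P l x"
        using y[of l] orth_family_apply[OF P, of l "\<lambda>l. h l ^ Suc k" x] by (simp add: blinfun.add_right)
      then show "h l *\<^sub>R P l (y + (\<Sum>l<n. h l ^ Suc k *\<^sub>R P l x)) = h l ^ Suc (Suc k) *\<^sub>R P l x"
        by simp
    qed
    let ?X = "R + (\<Sum>l<n. h l *\<^sub>R P l)"
    have "blinfun_apply (op_power ?X (Suc (Suc k))) x = ?X (op_power ?X (Suc k) x)"
      by (subst op_power_simps(2)) simp
    also have "\<dots> = ?X (y + (\<Sum>l<n. h l ^ Suc k *\<^sub>R P l x))"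
      by (simp only: Suc blinfun.add_left simple_apply y_def)
    also have "\<dots> = R y + (\<Sum>l<n. h l ^ Suc (Suc k) *\<^sub>R P l x)"
      by (simp only: blinfun.add_left simple_apply PP blinfun.add_right[of R] R0 add_0_right)
    also have "R y = op_power R (Suc (Suc k)) x"
      unfolding y_def by (subst (2) op_power_simps(2)) simp
    finally show "blinfun_apply (op_power ?X (Suc (Suc k))) x =
        blinfun_apply (op_power R (Suc (Suc k)) + (\<Sum>l<n. h l ^ Suc (Suc k) *\<^sub>R P l)) x"
      by (simp only: blinfun.add_left simple_apply)
  qed
qed (auto intro!: blinfun_eqI simp: op_power_simps blinfun.add_left)

text \<open>
  The powers of a simple operator are taken value by value, so their traces depend only on the values
  and on the traces of the projections. The orthogonal summand \<open>R\<close> collects the values that stay fixed.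
\<close>

lemma equi_measurable_simple:
  assumes R: "R \<in> M" "positive_op R"
    and P: "orth_family n P" "\<And>l x. l < n \<Longrightarrow> R (P l x) = 0" "\<And>l. l < n \<Longrightarrow> 0 \<le> h l"
    and Q: "orth_family n Q" "\<And>l x. l < n \<Longrightarrow> R (Q l x) = 0" "\<And>l. l < n \<Longrightarrow> 0 \<le> h' l"
    and eq: "\<And>k. (\<Sum>l<n. h l ^ Suc k * tr (P l)) = (\<Sum>l<n. h' l ^ Suc k * tr (Q l))"
  shows "equi_measurable M \<tau> (R + (\<Sum>l<n. h l *\<^sub>R P l)) (R + (\<Sum>l<n. h' l *\<^sub>R Q l))"
  unfolding equi_measurable_def
proof (intro conjI allI)
  show "R + (\<Sum>l<n. h l *\<^sub>R P l) \<in> M" "R + (\<Sum>l<n. h' l *\<^sub>R Q l) \<in> M"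
    using R P Q by (auto intro!: add_closed simple_closed)
  show "positive_op (R + (\<Sum>l<n. h l *\<^sub>R P l))" "positive_op (R + (\<Sum>l<n. h' l *\<^sub>R Q l))"
    using R P Q by (auto intro!: positive_op_intros simple_positive)
  have sR: "selfadjoint R" by (rule positive_opD[OF R(2)])
  have PR: "P l (R x) = 0" "Q l (R x) = 0" if "l < n" for l x
    using selfadjoint_annihilate_sym[OF sR prj_selfadjoint[OF orth_familyD(1)[OF P(1) that]] P(2)[OF that]]
      selfadjoint_annihilate_sym[OF sR prj_selfadjoint[OF orth_familyD(1)[OF Q(1) that]] Q(2)[OF that]]
    by blast+
  fix k
  show "\<tau> (op_power (R + (\<Sum>l<n. h l *\<^sub>R P l)) k) = \<tau> (op_power (R + (\<Sum>l<n. h' l *\<^sub>R Q l)) k)"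
  proof (cases k)
    case 0
    then show ?thesis by (simp add: op_power_simps)
  next
    case (Suc k)
    have t: "\<tau> (\<Sum>l<n. c l *\<^sub>R P l) = of_real (\<Sum>l<n. c l * tr (P l))" if P: "orth_family n P" for P c
    proof -
      have "\<tau> (\<Sum>l<n. c l *\<^sub>R P l) = (\<Sum>l<n. \<tau> (c l *\<^sub>R P l))"
        using orth_familyD(3)[OF P] by (intro tau_sum scaleR_closed) auto
      also have "\<dots> = (\<Sum>l<n. of_real (c l * tr (P l)))"
        using orth_familyD[OF P] by (intro sum.cong) (auto simp: tau_scaleR tau_positive prj_positive)
      finally show ?thesis by simp
    qed
    have s: "(\<Sum>l<n. c l *\<^sub>R P l) \<in> M" "(\<Sum>l<n. c l *\<^sub>R Q l) \<in> M" for c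
      using P Q by (auto intro: simple_closed)
    have "\<tau> (op_power (R + (\<Sum>l<n. h l *\<^sub>R P l)) (Suc k)) =
        \<tau> (op_power R (Suc k)) + of_real (\<Sum>l<n. h l ^ Suc k * tr (P l))"
      using op_power_simple[OF P(1,2) PR(1), of h k] trace_add[OF op_power_closed[OF R(1)] s(1)]
        t[OF P(1)] by metis
    moreover have "\<tau> (op_power (R + (\<Sum>l<n. h' l *\<^sub>R Q l)) (Suc k)) =
        \<tau> (op_power R (Suc k)) + of_real (\<Sum>l<n. h' l ^ Suc k * tr (Q l))"
      using op_power_simple[OF Q(1,2) PR(2), of h' k] trace_add[OF op_power_closed[OF R(1)] s(2)]
        t[OF Q(1)] by metis
    ultimately show ?thesis by (simp only: Suc eq)
  qed
qed

end

locale gauged_algebra = weak_dixmier_algebra M \<tau> + tracial_gauge_norm M \<tau> N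
  for M :: "'h::complex_hilbert op set" and \<tau> :: "'h op \<Rightarrow> complex" and N :: "'h op \<Rightarrow> real"
begin

lemma gauge_scaleR: "A \<in> M \<Longrightarrow> N (r *\<^sub>R A) = \<bar>r\<bar> * N A"
  by (simp add: scaleR_eq_scaleC_op gauge_scale)

lemma gauge_zero: "N 0 = 0"
  using gauge_eq_zero[OF zero_closed] by simp

text \<open>
  The gauge norm of \<open>A\<close> is that of \<open>|A|\<close>, which is determined by \<open>A\<^sup>* A\<close>.
\<close>

lemma gauge_eq_of_abs:
  assumes "A \<in> M" "B \<in> M" "op_adjoint A o\<^sub>L A = op_adjoint B o\<^sub>L B"
  shows "N A = N B"
  using gauge_abs[OF assms(1)] gauge_abs[OF assms(2)] assms(3) by (simp add: op_abs_def)

lemma gauge_convex: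
  assumes "A \<in> M" "B \<in> M" "0 \<le> u" "u \<le> 1" "N A \<le> c" "N B \<le> c"
  shows "N (u *\<^sub>R A + (1 - u) *\<^sub>R B) \<le> c"
proof -
  have "N (u *\<^sub>R A + (1 - u) *\<^sub>R B) \<le> u * N A + (1 - u) * N B"
    using gauge_triangle[of "u *\<^sub>R A" "(1 - u) *\<^sub>R B"] assms by (simp add: scaleR_closed gauge_scaleR)
  also have "\<dots> \<le> u * c + (1 - u) * c" using assms by (intro add_mono mult_left_mono) auto
  finally show ?thesis by (simp add: algebra_simps)
qed

lemma gauge_sum_le:
  assumes "\<And>i. i \<in> I \<Longrightarrow> f i \<in> M"
  shows "N (\<Sum>i\<in>I. f i) \<le> (\<Sum>i\<in>I. N (f i))"
  using assms
proof (induction I rule: infinite_finite_induct)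
  case (insert i I)
  have "N (f i + sum f I) \<le> N (f i) + N (sum f I)"
    using insert by (intro gauge_triangle sum_closed) auto
  then show ?case using insert by simp
qed (simp_all add: gauge_zero)

text \<open>
  A self-adjoint contraction \<open>X\<close> is the mean of the unitaries \<open>X \<plusminus> i (1 - X\<^sup>2)\<^sup>1\<^sup>/\<^sup>2\<close>, each with the
  same absolute value as the identity.
\<close>

lemma gauge_contraction_le:
  assumes X: "X \<in> M" "selfadjoint X" and n1: "norm X \<le> 1"
  shows "N X \<le> N id_blinfun"
proof -
  define A where "A = id_blinfun - (X o\<^sub>L X)"
  have "A \<in> M" by (simp add: A_def diff_closed compose_closed id_closed X)
  moreover have "positive_op A"
    unfolding positive_op_iff
  proof (intro conjI allI)
    show "clinear_op A" using \<open>A \<in> M\<close> by (rule clinear)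
    show "selfadjoint A" by (simp add: A_def selfadjoint_intros selfadjoint_compose_commute X)
    fix x
    have "norm (X x) \<le> norm X * norm x" by (rule norm_blinfun)
    also have "\<dots> \<le> 1 * norm x" using n1 by (intro mult_right_mono) auto
    finally have "(norm (X x))\<^sup>2 \<le> (norm x)\<^sup>2" by (intro power_mono) auto
    moreover have "inner (X (X x)) x = inner (X x) (X x)" by (rule selfadjointD[OF X(2)])
    ultimately show "0 \<le> inner (A x) x"
      by (simp add: A_def blinfun.diff_left inner_diff_left power2_norm_eq_inner)
  qed
  ultimately obtain C where C: "C \<in> M" "positive_op C" "C o\<^sub>L C = A"
    "\<And>Y. Y o\<^sub>L A = A o\<^sub>L Y \<Longrightarrow> Y o\<^sub>L C = C o\<^sub>L Y"
    using sqrt_closed by blast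
  have "X o\<^sub>L A = A o\<^sub>L X" by (rule blinfun_eqI) (simp add: A_def blinfun.bilinear_simps)
  from commute_apply[OF C(4)[OF this]] have XC: "X (C x) = C (X x)" for x .
  have CC: "C (C x) = x - X (X x)" for x
  proof -
    have "(C o\<^sub>L C) x = A x" by (simp only: C(3))
    then show ?thesis by (simp add: A_def blinfun.diff_left)
  qed
  define U where "U = X + scaleC_op \<i> C"
  define U' where "U' = X - scaleC_op \<i> C"
  have UM: "U \<in> M" "U' \<in> M" using X C(1) by (simp_all add: U_def U'_def add_closed diff_closed scaleC_closed)
  have cl: "X (\<i> *\<^sub>C x) = \<i> *\<^sub>C X x" "C (\<i> *\<^sub>C x) = \<i> *\<^sub>C C x" for x
    using clinear[OF X(1)] clinear[OF C(1)] by (simp_all add: clinear_op_iff)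
  have i: "inner (\<i> *\<^sub>C C x) y = - inner x (\<i> *\<^sub>C C y)" for x y
    using selfadjointD[OF positive_opD(2)[OF C(2)], of x "\<i> *\<^sub>C y"] by (simp add: inner_i_left cl)
  have Xsa: "inner (X x) y = inner x (X y)" for x y by (rule selfadjointD[OF X(2)])
  have adj: "op_adjoint U = U'" "op_adjoint U' = U"
  proof -
    have 1: "inner (U x) y = inner x (U' y)" for x y
      by (simp add: U_def U'_def blinfun.bilinear_simps inner_add_left inner_diff_right
          scaleC_op_apply i Xsa)
    then show "op_adjoint U = U'" by (intro adjoint_unique clinear UM)
    have "inner (U' x) y = inner x (U y)" for x y using 1[of y x] by (simp add: inner_commute)
    then show "op_adjoint U' = U" by (intro adjoint_unique clinear UM)
  qed
  have inv: "U' o\<^sub>L U = id_blinfun" "U o\<^sub>L U' = id_blinfun"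
    by (simp_all add: compose_eq_iff U_def U'_def blinfun.bilinear_simps scaleC_op_apply cl XC CC
      scaleC_add_right scaleC_simps i_i)
  have "op_adjoint id_blinfun = (id_blinfun :: 'h op)"
    using prj_one by (simp add: prj_def projection_op_def)
  then have one: "op_adjoint id_blinfun o\<^sub>L id_blinfun = (id_blinfun :: 'h op)"
    by (auto intro: blinfun_eqI)
  have N1: "N U = N id_blinfun" "N U' = N id_blinfun"
    by (simp_all add: gauge_eq_of_abs[OF _ id_closed] UM adj inv one)
  have "X = (1/2) *\<^sub>R U + (1 - 1/2) *\<^sub>R U'"
    by (rule blinfun_eqI) (simp add: U_def U'_def blinfun.bilinear_simps scaleC_op_apply
      scaleR_add_right[symmetric] scaleR_2[symmetric])
  then show ?thesis using gauge_convex[OF UM, of "1/2" "N id_blinfun"] N1 by simp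
qed

lemma gauge_le_norm:
  assumes X: "X \<in> M" "selfadjoint X"
  shows "N X \<le> norm X * N id_blinfun"
proof (cases "X = 0")
  case True
  then show ?thesis by (simp add: gauge_zero)
next
  case False
  have "N ((1 / norm X) *\<^sub>R X) \<le> N id_blinfun"
    using X False by (intro gauge_contraction_le scaleR_closed selfadjoint_intros) auto
  then show ?thesis using X False by (simp add: gauge_scaleR field_simps)
qed

text \<open>\<open>R + c E\<close> is a convex combination of \<open>R + p E\<close> and \<open>R - p E\<close>, whose absolute values agree.\<close>

lemma gauge_lower:
  assumes R: "R \<in> M" "positive_op R" and E: "prj E" and RE: "\<And>x. R (E x) = 0"
    and c: "0 \<le> c" "c \<le> p"
  shows "N (R + c *\<^sub>R E) \<le> N (R + p *\<^sub>R E)"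
proof (cases "p = 0")
  case True
  then show ?thesis using c by simp
next
  case False
  then have p: "0 < p" using c by simp
  have sR: "selfadjoint R" by (rule positive_opD[OF R(2)])
  have ER: "E (R x) = 0" for x
    by (rule selfadjoint_annihilate_sym[OF sR prj_selfadjoint[OF E] RE])
  define A where "A = R + p *\<^sub>R E"
  define B where "B = R - p *\<^sub>R E"
  have AB: "A \<in> M" "B \<in> M" "selfadjoint A" "selfadjoint B"
    using R E sR by (auto simp: A_def B_def prjD prj_selfadjoint
        intro!: add_closed diff_closed scaleR_closed selfadjoint_intros)
  then have "op_adjoint A = A" "op_adjoint B = B" using selfadjoint_iff clinear by blast+
  moreover have "A o\<^sub>L A = B o\<^sub>L B"
    by (rule blinfun_eqI) (simp add: A_def B_def blinfun.bilinear_simps RE ER)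
  ultimately have NB: "N B = N A" using AB by (intro gauge_eq_of_abs) auto
  \<comment> \<open>the weight with \<open>u p - (1 - u) p = c\<close>\<close>
  define u where "u = (1 + c / p) / 2"
  have u: "0 \<le> u" "u \<le> 1" and up: "u * p - (1 - u) * p = c"
    using c p by (auto simp: u_def field_simps)
  have "R + c *\<^sub>R E = u *\<^sub>R A + (1 - u) *\<^sub>R B"
  proof -
    have "u *\<^sub>R (a + b) + (1 - u) *\<^sub>R (a - b) = a + (u - (1 - u)) *\<^sub>R b" for a b :: "'h op"
      by (simp add: algebra_simps flip: scaleR_2)
    then have "u *\<^sub>R A + (1 - u) *\<^sub>R B = R + ((u - (1 - u)) * p) *\<^sub>R E"
      by (simp only: A_def B_def scaleR_scaleR)
    then show ?thesis using up by (simp only: left_diff_distrib)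
  qed
  then show ?thesis using gauge_convex[OF AB(1,2) u, of "N A"] NB by (simp add: A_def)
qed

text \<open>Averaging over the cyclic permutations of the values, all of which have the same norm.\<close>

lemma gauge_equal_average:
  fixes R :: "'h op" and P :: "nat \<Rightarrow> 'h op" and h :: "nat \<Rightarrow> real"
  assumes R: "R \<in> M" "positive_op R"
    and P: "orth_family n P" "\<And>l x. l < n \<Longrightarrow> R (P l x) = 0" "\<And>l. l < n \<Longrightarrow> tr (P l) = c"
    and h: "\<And>l. l < n \<Longrightarrow> 0 \<le> h l" and n: "0 < n"
  shows "N (R + ((\<Sum>l<n. h l) / real n) *\<^sub>R (\<Sum>l<n. P l)) \<le> N (R + (\<Sum>l<n. h l *\<^sub>R P l))"
proof -
  define X where "X j = R + (\<Sum>l<n. h ((l + j) mod n) *\<^sub>R P l)" for j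
  have shift: "(\<Sum>j<n. f ((l + j) mod n)) = (\<Sum>j<n. f j)" for l and f :: "nat \<Rightarrow> real"
  proof -
    have "inj_on (\<lambda>j. (l + j) mod n) {..<n}"
    proof (rule linorder_inj_onI)
      fix j k assume "j < k" "j \<in> {..<n}" "k \<in> {..<n}"
      show "(l + j) mod n \<noteq> (l + k) mod n"
      proof
        assume "(l + j) mod n = (l + k) mod n"
        then have "n dvd (l + k) - (l + j)" using \<open>j < k\<close> by (metis mod_eq_dvd_iff_nat add_le_cancel_left less_imp_le)
        then have "n dvd k - j" by simp
        then show False using \<open>j < k\<close> \<open>k \<in> {..<n}\<close> by (auto dest: dvd_imp_le)
      qed
    qed auto
    moreover have "(\<lambda>j. (l + j) mod n) ` {..<n} \<subseteq> {..<n}" using n by auto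
    ultimately have "bij_betw (\<lambda>j. (l + j) mod n) {..<n} {..<n}"
      by (simp add: bij_betw_def endo_inj_surj)
    then show ?thesis by (rule sum.reindex_bij_betw)
  qed
  have XM: "X j \<in> M" for j using R P by (auto simp: X_def intro!: add_closed simple_closed)
  have NX: "N (X j) = N (R + (\<Sum>l<n. h l *\<^sub>R P l))" for j
    unfolding X_def
  proof (rule gauge_equi_measurable, rule equi_measurable_simple[OF R P(1,2) _ P(1,2) h])
    show "0 \<le> h ((l + j) mod n)" for l using h n by simp
    fix k
    have "(\<Sum>l<n. h ((l + j) mod n) ^ Suc k * tr (P l)) = (\<Sum>l<n. h ((j + l) mod n) ^ Suc k) * c"
      using P(3) by (simp add: sum_distrib_right add.commute)
    also have "\<dots> = (\<Sum>l<n. h l ^ Suc k) * c" by (subst shift) simp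
    also have "\<dots> = (\<Sum>l<n. h l ^ Suc k * tr (P l))" using P(3) by (simp add: sum_distrib_right)
    finally show "(\<Sum>l<n. h ((l + j) mod n) ^ Suc k * tr (P l)) = (\<Sum>l<n. h l ^ Suc k * tr (P l))" .
  qed
  have "(\<Sum>j<n. X j) = real n *\<^sub>R R + (\<Sum>l<n. (\<Sum>j<n. h ((l + j) mod n)) *\<^sub>R P l)"
    by (simp add: X_def sum.distrib sum_constant_scaleR scaleR_sum_left) (rule sum.swap)
  then have "(\<Sum>j<n. X j) = real n *\<^sub>R R + (\<Sum>l<n. h l) *\<^sub>R (\<Sum>l<n. P l)"
    by (simp add: shift scaleR_sum_right)
  then have "R + ((\<Sum>l<n. h l) / real n) *\<^sub>R (\<Sum>l<n. P l) = (1 / real n) *\<^sub>R (\<Sum>j<n. X j)"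
    using n by (simp add: scaleR_add_right)
  then have "N (R + ((\<Sum>l<n. h l) / real n) *\<^sub>R (\<Sum>l<n. P l)) = (1 / real n) * N (\<Sum>j<n. X j)"
    using XM by (simp add: gauge_scaleR sum_closed)
  also have "\<dots> \<le> (1 / real n) * (\<Sum>j<n. N (X j))"
    using XM by (intro mult_left_mono gauge_sum_le) auto
  also have "\<dots> = N (R + (\<Sum>l<n. h l *\<^sub>R P l))" using n by (simp add: NX)
  finally show ?thesis .
qed

end

section \<open>Averages and transfers of values\<close>

context weak_dixmier_algebra
begin

text \<open>
  With a minimal projection, its trace measures \<open>E\<close> and \<open>F\<close> without remainder. Without one, \<open>F\<close> is
  divided into so many equal parts that the remainder of \<open>E\<close> is small.
\<close>

lemma common_pieces:
  assumes E: "prj E" and F: "prj F" "F \<noteq> 0" and e: "0 < e"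
  shows "\<exists>c m r. 0 < c \<and> admissible c \<and> tr F = real m * c \<and> real r * c \<le> tr E \<and> tr E - real r * c \<le> e"
proof (cases "\<exists>G. minimal_prj G")
  case True
  then obtain G where G: "minimal_prj G" by blast
  obtain m r :: nat where "tr F = real m * tr G" "tr E = real r * tr G"
    using admissible_prj[OF F(1)] admissible_prj[OF E] G unfolding admissible_def by blast
  then show ?thesis
    using minimal_prjD[OF G] admissible_prj[of G] e
    by (intro exI[of _ "tr G"] exI[of _ m] exI[of _ r]) auto
next
  case False
  have tF: "0 < tr F" by (rule tr_prj_pos[OF F])
  obtain m :: nat where m: "tr F / e < real m" using reals_Archimedean2 by blast
  have m0: "0 < real m" using m tF e by (meson divide_pos_pos less_trans)
  define c where "c = tr F / real m"
  have c: "0 < c" "c \<le> e" using m m0 tF e by (auto simp: c_def field_simps)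
  define r where "r = nat \<lfloor>tr E / c\<rfloor>"
  have "0 \<le> tr E / c" using tr_prj_nonneg[OF E] c by simp
  then have "real r \<le> tr E / c" "tr E / c < real r + 1"
    unfolding r_def by linarith+
  then have "real r * c \<le> tr E" "tr E - real r * c \<le> c" using c by (auto simp: field_simps)
  moreover have "admissible c" using False c by (auto simp: admissible_def)
  moreover have "tr F = real m * c" using m0 by (simp add: c_def)
  ultimately show ?thesis using c by (intro exI[of _ c] exI[of _ m] exI[of _ r]) auto
qed

lemma orth_family_sub:
  assumes P: "orth_family n P" and E: "prj E" and sub: "\<And>l. l < n \<Longrightarrow> E o\<^sub>L P l = P l"
  shows "E o\<^sub>L (\<Sum>l<n. P l) = (\<Sum>l<n. P l)"
  using sub by (intro blinfun_eqI) (simp add: blinfun.sum_left blinfun.sum_right compose_eq_iff)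

lemma orth_family_exhausts:
  assumes P: "orth_family n P" and E: "prj E" and sub: "\<And>l. l < n \<Longrightarrow> E o\<^sub>L P l = P l"
    and t: "(\<Sum>l<n. tr (P l)) = tr E"
  shows "(\<Sum>l<n. P l) = E"
proof -
  note EP = sub_prj[OF E orth_family_projection(1)[OF P] orth_family_sub[OF P E sub]]
  have "E - (\<Sum>l<n. P l) = 0"
    using EP(3) EP(4) t orth_family_projection(2)[OF P] by (intro tr_prj_eq_zero) auto
  then show ?thesis by simp
qed

end

lemma sum_lessThan_add:
  fixes f :: "nat \<Rightarrow> 'a::comm_monoid_add"
  shows "(\<Sum>l<m + r. f l) = (\<Sum>l<m. f l) + (\<Sum>l<r. f (m + l))"
  by (induction r) (simp_all add: add.assoc)

context gauged_algebra
begin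

text \<open>
  Cut \<open>F\<close> into pieces of one trace \<open>c\<close> and \<open>E\<close> into pieces of trace \<open>c\<close> up to a remainder, and
  average over all the pieces. The remainder is left in \<open>E\<close>, where it keeps the larger value \<open>p\<close>,
  because this value may be lowered to the average. Here \<open>x\<close> is the trace of \<open>E\<close> without the
  remainder; the value tends to the weighted mean as \<open>x\<close> tends to \<open>\<tau> E\<close>.
\<close>

lemma gauge_average_approx:
  assumes R: "R \<in> M" "positive_op R" and E: "prj E" and F: "prj F" "F \<noteq> 0"
    and EF: "E o\<^sub>L F = 0" and RE: "\<And>x. R (E x) = 0" and RF: "\<And>x. R (F x) = 0"
    and pq: "0 \<le> q" "q \<le> p" and e: "0 < e"
  shows "\<exists>x. 0 \<le> x \<and> x \<le> tr E \<and> tr E - x \<le> e \<and>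
    N (R + ((tr F * q + x * p) / (tr F + x)) *\<^sub>R (E + F)) \<le> N (R + p *\<^sub>R E + q *\<^sub>R F)"
proof -
  obtain c m r where c: "0 < c" "admissible c" "tr F = real m * c" "real r * c \<le> tr E"
    "tr E - real r * c \<le> e"
    using common_pieces[OF E F e] by blast
  obtain A where A: "\<And>l. l < m \<Longrightarrow> prj (A l)" "\<And>l. l < m \<Longrightarrow> tr (A l) = c"
    "\<And>l. l < m \<Longrightarrow> F o\<^sub>L A l = A l" "\<And>l k. l < m \<Longrightarrow> k < m \<Longrightarrow> l \<noteq> k \<Longrightarrow> A l o\<^sub>L A k = 0"
    using orthogonal_sub_prjs[OF c(2) F(1), of m] c(3) by auto
  obtain B where B: "\<And>l. l < r \<Longrightarrow> prj (B l)" "\<And>l. l < r \<Longrightarrow> tr (B l) = c"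
    "\<And>l. l < r \<Longrightarrow> E o\<^sub>L B l = B l" "\<And>l k. l < r \<Longrightarrow> k < r \<Longrightarrow> l \<noteq> k \<Longrightarrow> B l o\<^sub>L B k = 0"
    using orthogonal_sub_prjs[OF c(2) E, of r] c(4) by blast
  have oA: "orth_family m A" and oB: "orth_family r B" using A B by (auto simp: orth_family_def)
  have sA: "(\<Sum>l<m. A l) = F" using A c(3) by (intro orth_family_exhausts oA F) auto
  have FA: "F (A l x) = A l x" "A l (F x) = A l x" if "l < m" for l x
    using sub_prj[OF F(1) A(1) A(3)] that by auto
  have EB: "E (B l x) = B l x" "B l (E x) = B l x" if "l < r" for l x
    using sub_prj[OF E B(1) B(3)] that by auto
  have EF0: "E (F x) = 0" "F (E x) = 0" for x using orth_prj[OF E F(1) EF] by auto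
  have EA: "E (A l x) = 0" if "l < m" for l x using EF0(1)[of "A l x"] FA(1)[OF that] by simp
  have FB: "F (B l x) = 0" if "l < r" for l x using EF0(2)[of "B l x"] EB(1)[OF that] by simp
  have AB: "A l o\<^sub>L B k = 0" "B k o\<^sub>L A l = 0" if "l < m" "k < r" for l k
  proof -
    have "A l (B k x) = 0" for x using FA(2)[OF that(1), of "B k x"] FB[OF that(2), of x]
      by (simp add: blinfun.zero_right)
    moreover have "B k (A l x) = 0" for x using EB(2)[OF that(2), of "A l x"] EA[OF that(1), of x]
      by (simp add: blinfun.zero_right)
    ultimately show "A l o\<^sub>L B k = 0" "B k o\<^sub>L A l = 0" by (simp_all add: compose_eq_iff)
  qed
  have RA: "R (A l x) = 0" if "l < m" for l x using RF[of "A l x"] FA(1)[OF that] by simp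
  have RB: "R (B l x) = 0" if "l < r" for l x using RE[of "B l x"] EB(1)[OF that] by simp
  define G where "G = (\<Sum>l<r. B l)"
  define E0 where "E0 = E - G"
  have G: "prj G" "E o\<^sub>L G = G"
    using orth_family_projection[OF oB] orth_family_sub[OF oB E B(3)] by (simp_all add: G_def)
  note EG = sub_prj[OF E G, folded E0_def]
  have GB: "G (B l x) = B l x" if "l < r" for l x
    using orth_family_apply[OF oB that, of "\<lambda>_. 1"] orth_familyD(2)[OF oB] prj_apply(1)[OF B(1)] that
    by (simp add: G_def blinfun.sum_left)
      (subst sum.remove[of _ l]; auto intro!: sum.neutral)
  define Q where "Q l = (if l < m then A l else B (l - m))" for l
  define h where "h l = (if l < m then q else p)" for l
  have oQ: "orth_family (m + r) Q"
    using A B AB by (auto simp: orth_family_def Q_def)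
  \<comment> \<open>the remainder \<open>E0\<close> takes no part in the averaging and belongs to the fixed summand\<close>
  define R' where "R' = R + p *\<^sub>R E0"
  have R': "R' \<in> M" "positive_op R'"
    using R EG(3) pq by (auto simp: R'_def prjD prj_positive intro!: add_closed scaleR_closed positive_op_intros)
  have R'Q: "R' (Q l x) = 0" if "l < m + r" for l x
  proof (cases "l < m")
    case True
    have "G (A l x) = 0" using AB(2)[OF True] by (simp add: G_def blinfun.sum_left compose_eq_iff)
    then show ?thesis using True by (simp add: Q_def R'_def E0_def blinfun.bilinear_simps RA EA)
  next
    case False
    then have "l - m < r" using that by simp
    then show ?thesis using False by (simp add: Q_def R'_def E0_def blinfun.bilinear_simps RB EB GB)
  qed
  have m0: "0 < m" using c(3) tr_prj_pos[OF F] by (cases m) auto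
  have trQ: "tr (Q l) = c" if "l < m + r" for l using that A(2) B(2) by (auto simp: Q_def)
  have sQ: "(\<Sum>l<m + r. Q l) = F + G" by (simp add: sum_lessThan_add Q_def G_def sA)
  have shQ: "(\<Sum>l<m + r. h l *\<^sub>R Q l) = q *\<^sub>R F + p *\<^sub>R G"
    by (simp add: sum_lessThan_add Q_def h_def G_def sA[symmetric] scaleR_sum_right)
  have sh: "(\<Sum>l<m + r. h l) = real m * q + real r * p" by (simp add: sum_lessThan_add h_def)
  define t where "t = (real m * q + real r * p) / real (m + r)"
  have t: "0 \<le> t" "t \<le> p"
  proof -
    show "0 \<le> t" using pq by (simp add: t_def)
    have "real m * q \<le> real m * p" using pq by (intro mult_left_mono) auto
    then show "t \<le> p" using m0 by (simp add: t_def field_simps)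
  qed
  have "N (R' + t *\<^sub>R (F + G)) \<le> N (R' + (q *\<^sub>R F + p *\<^sub>R G))"
    using gauge_equal_average[OF R' oQ R'Q trQ, of h] pq m0
    unfolding sQ shQ sh by (auto simp: h_def t_def)
  moreover have "R' + (q *\<^sub>R F + p *\<^sub>R G) = R + p *\<^sub>R E + q *\<^sub>R F"
    by (simp add: R'_def E0_def algebra_simps)
  moreover have "N ((R + t *\<^sub>R (F + G)) + t *\<^sub>R E0) \<le> N ((R + t *\<^sub>R (F + G)) + p *\<^sub>R E0)"
  proof (rule gauge_lower[OF _ _ EG(3) _ t])
    show "R + t *\<^sub>R (F + G) \<in> M" "positive_op (R + t *\<^sub>R (F + G))"
      using R F G t by (auto simp: prjD prj_positive intro!: add_closed scaleR_closed positive_op_intros)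
    show "(R + t *\<^sub>R (F + G)) (E0 x) = 0" for x
    proof -
      have 1: "E (E0 x) = E0 x" using prj_apply(1)[OF E] EG(2) by (simp add: E0_def blinfun.bilinear_simps)
      have "R (E0 x) = 0" "F (E0 x) = 0" using RE[of "E0 x"] EF0(2)[of "E0 x"] by (simp_all add: 1)
      moreover have "G (E0 x) = 0" using EG(7) by (simp add: compose_eq_iff)
      ultimately show ?thesis by (simp add: blinfun.bilinear_simps)
    qed
  qed
  moreover have "(R + t *\<^sub>R (F + G)) + t *\<^sub>R E0 = R + t *\<^sub>R (E + F)"
    by (simp add: E0_def algebra_simps)
  moreover have "(R + t *\<^sub>R (F + G)) + p *\<^sub>R E0 = R' + t *\<^sub>R (F + G)"
    by (simp add: R'_def algebra_simps)
  ultimately have "N (R + t *\<^sub>R (E + F)) \<le> N (R + p *\<^sub>R E + q *\<^sub>R F)" by simp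
  moreover have "t = (tr F * q + (real r * c) * p) / (tr F + real r * c)"
  proof -
    have "(tr F * q + (real r * c) * p) / (tr F + real r * c) =
        (c * (real m * q + real r * p)) / (c * real (m + r))"
      by (simp add: c(3) algebra_simps)
    then show ?thesis using c(1) by (simp add: t_def)
  qed
  ultimately show ?thesis using c by (intro exI[of _ "real r * c"]) auto
qed

lemma gauge_average:
  assumes R: "R \<in> M" "positive_op R" and E: "prj E" and F: "prj F" "F \<noteq> 0"
    and EF: "E o\<^sub>L F = 0" and RE: "\<And>x. R (E x) = 0" and RF: "\<And>x. R (F x) = 0"
    and pq: "0 \<le> q" "q \<le> p"
  shows "N (R + ((tr F * q + tr E * p) / (tr F + tr E)) *\<^sub>R (E + F)) \<le> N (R + p *\<^sub>R E + q *\<^sub>R F)"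
proof (rule field_le_epsilon)
  fix d :: real assume d: "0 < d"
  define a where "a = tr E"
  define b where "b = tr F"
  have ab: "0 \<le> a" "0 < b" using tr_prj_nonneg[OF E] tr_prj_pos[OF F] by (simp_all add: a_def b_def)
  have NEF: "0 \<le> N (E + F)" using E F by (intro gauge_nonneg add_closed prjD)
  \<comment> \<open>the bound \<open>(p - q) e / b\<close> for \<open>s - t\<close> below, times \<open>N (E + F)\<close>, is then less than \<open>d\<close>\<close>
  define e where "e = d * b / ((p - q) * N (E + F) + 1)"
  have den: "0 < (p - q) * N (E + F) + 1" using NEF pq by (intro add_nonneg_pos mult_nonneg_nonneg) auto
  have e: "0 < e" using d ab den by (simp add: e_def)
  obtain x where x: "0 \<le> x" "x \<le> a" "a - x \<le> e"
    "N (R + ((b * q + x * p) / (b + x)) *\<^sub>R (E + F)) \<le> N (R + p *\<^sub>R E + q *\<^sub>R F)"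
    using gauge_average_approx[OF R E F EF RE RF pq e] by (auto simp: a_def b_def)
  define s where "s = (b * q + a * p) / (b + a)"
  define t where "t = (b * q + x * p) / (b + x)"
  define z where "z = (b / (b + a)) * ((a - x) / (b + x))"
  have sz: "s - t = (p - q) * z"
    using ab x by (simp add: s_def t_def z_def field_simps)
  have "0 \<le> z" using ab x by (simp add: z_def)
  moreover have "z \<le> 1 * (e / b)"
    unfolding z_def using ab x by (intro mult_mono frac_le) auto
  ultimately have st: "0 \<le> s - t" "s - t \<le> (p - q) * (e / b)"
    unfolding sz using pq by (auto intro!: mult_left_mono mult_nonneg_nonneg simp del: times_divide_eq_right)
  have "R + s *\<^sub>R (E + F) = (R + t *\<^sub>R (E + F)) + (s - t) *\<^sub>R (E + F)"
    by (simp add: algebra_simps)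
  then have "N (R + s *\<^sub>R (E + F)) \<le> N (R + t *\<^sub>R (E + F)) + (s - t) * N (E + F)"
    using gauge_triangle[of "R + t *\<^sub>R (E + F)" "(s - t) *\<^sub>R (E + F)"] st(1) R E F
    by (simp add: gauge_scaleR add_closed scaleR_closed prjD add.assoc)
  also have "(s - t) * N (E + F) \<le> (p - q) * (e / b) * N (E + F)"
    using st(2) NEF by (rule mult_right_mono)
  also have "(p - q) * (e / b) * N (E + F) = d * (((p - q) * N (E + F)) / ((p - q) * N (E + F) + 1))"
    using ab by (simp add: e_def)
  also have "\<dots> \<le> d * 1" using d den by (intro mult_left_mono) (auto simp: divide_le_eq_1)
  finally show "N (R + ((tr F * q + tr E * p) / (tr F + tr E)) *\<^sub>R (E + F)) \<le>
      N (R + p *\<^sub>R E + q *\<^sub>R F) + d"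
    using x(4) by (simp add: s_def t_def a_def b_def)
qed

text \<open>
  A transfer moves the two values towards their weighted mean \<open>t\<close>, so its result is a convex
  combination of the given operator and of the one with both values replaced by \<open>t\<close>.
\<close>

lemma gauge_transfer:
  assumes R: "R \<in> M" "positive_op R" and E: "prj E" and F: "prj F" "F \<noteq> 0"
    and EF: "E o\<^sub>L F = 0" and RE: "\<And>x. R (E x) = 0" and RF: "\<And>x. R (F x) = 0"
    and ab: "0 \<le> q" "q \<le> b" "b \<le> a" "a \<le> p" and mean: "tr E * a + tr F * b = tr E * p + tr F * q"
  shows "N (R + a *\<^sub>R E + b *\<^sub>R F) \<le> N (R + p *\<^sub>R E + q *\<^sub>R F)"
proof (cases "p = q")
  case True
  then have "a = p" "b = q" using ab by auto
  then show ?thesis by simp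
next
  case False
  then have pq: "q < p" using ab by simp
  have tF: "0 < tr F" and tE: "0 \<le> tr E" using tr_prj_pos[OF F] tr_prj_nonneg[OF E] by auto
  define t where "t = (tr F * q + tr E * p) / (tr F + tr E)"
  have tt: "tr E * t + tr F * t = tr E * p + tr F * q"
  proof -
    have "(tr F + tr E) * t = tr F * q + tr E * p" using tF tE by (simp add: t_def)
    then show ?thesis by (simp add: algebra_simps)
  qed
  have "tr F * (p - t) + tr E * (p - t) = tr F * (p - q)" using tt by (simp add: algebra_simps)
  moreover have "0 < tr F * (p - q)" using tF pq by simp
  ultimately have "0 < (tr F + tr E) * (p - t)" by (simp add: algebra_simps)
  then have tp: "t < p" using tF tE by (simp add: zero_less_mult_iff)
  have "(tr F + tr E) * t = tr F * b + tr E * a" using tt mean by (simp add: algebra_simps)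
  also have "\<dots> \<le> tr F * a + tr E * a" using ab(3) tF by simp
  also have "\<dots> = (tr F + tr E) * a" by (simp add: algebra_simps)
  finally have ta: "t \<le> a" using tF tE by simp
  define u where "u = (a - t) / (p - t)"
  have u: "0 \<le> u" "u \<le> 1" using ta tp ab by (auto simp: u_def)
  have ua: "u * p + (1 - u) * t = a"
  proof -
    have "u * (p - t) = a - t" using tp by (simp add: u_def)
    then show ?thesis by (simp add: algebra_simps)
  qed
  have ub: "u * q + (1 - u) * t = b"
  proof -
    have "tr F * (u * q + (1 - u) * t) = u * (tr E * p + tr F * q) + (1 - u) * (tr E * t + tr F * t)
        - tr E * (u * p + (1 - u) * t)"
      by (simp add: algebra_simps)
    also have "\<dots> = tr F * b" unfolding ua tt using mean by (simp add: algebra_simps)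
    finally show ?thesis using tF by simp
  qed
  have "R + a *\<^sub>R E + b *\<^sub>R F =
      u *\<^sub>R (R + p *\<^sub>R E + q *\<^sub>R F) + (1 - u) *\<^sub>R (R + t *\<^sub>R (E + F))"
    unfolding ua[symmetric] ub[symmetric] by (simp add: algebra_simps)
  moreover have "N (R + t *\<^sub>R (E + F)) \<le> N (R + p *\<^sub>R E + q *\<^sub>R F)"
    unfolding t_def using gauge_average[OF R E F EF RE RF ab(1)] pq by simp
  ultimately show ?thesis
    using gauge_convex[OF _ _ u, of "R + p *\<^sub>R E + q *\<^sub>R F" "R + t *\<^sub>R (E + F)"] R E F
    by (simp add: add_closed scaleR_closed prjD)
qed

text \<open>
  Lowering and transfer, applied to the coefficients of a simple operator, are the two moves of
  \<open>submajorization_induct\<close>.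
\<close>

lemma gauge_simple_mono:
  fixes f g :: "nat \<Rightarrow> real"
  assumes E: "orth_family m E" "\<And>k. k < m \<Longrightarrow> E k \<noteq> 0"
    and f: "\<And>k. k < m \<Longrightarrow> 0 \<le> f k" "\<And>k l. k \<le> l \<Longrightarrow> l < m \<Longrightarrow> f l \<le> f k"
    and g: "\<And>k. k < m \<Longrightarrow> 0 \<le> g k" "\<And>k l. k \<le> l \<Longrightarrow> l < m \<Longrightarrow> g l \<le> g k"
    and sums: "\<And>k. k \<le> m \<Longrightarrow> (\<Sum>l<k. tr (E l) * f l) \<le> (\<Sum>l<k. tr (E l) * g l)"
  shows "N (\<Sum>k<m. f k *\<^sub>R E k) \<le> N (\<Sum>k<m. g k *\<^sub>R E k)"
proof -
  define \<nu> where "\<nu> g = N (\<Sum>k<m. g k *\<^sub>R E k)" for g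
  have prjE: "prj (E k)" if "k < m" for k using orth_familyD(1)[OF E(1) that] .
  have "\<nu> f \<le> \<nu> g"
  proof (rule submajorization_induct[where \<nu> = \<nu> and w = "\<lambda>k. tr (E k)" and m = m and f = f and g = g])
    show "0 < tr (E k)" if "k < m" for k using tr_prj_pos[OF prjE[OF that] E(2)[OF that]] .
    show "\<nu> f = \<nu> g" if "\<And>k. k < m \<Longrightarrow> f k = g k" for f g using that by (simp add: \<nu>_def)
  next
    fix g :: "nat \<Rightarrow> real" and k c
    assume g: "\<And>k. k < m \<Longrightarrow> 0 \<le> g k" and k: "k < m" and c: "0 \<le> c" "c \<le> g k"
    define r where "r = g(k := 0)"
    define R where "R = (\<Sum>l<m. r l *\<^sub>R E l)"
    have split: "(\<Sum>l<m. (g(k := a)) l *\<^sub>R E l) = R + a *\<^sub>R E k" for a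
    proof -
      have "(g(k := a)) l *\<^sub>R E l = r l *\<^sub>R E l + (if l = k then a *\<^sub>R E k else 0)" for l
        by (simp add: r_def)
      then show ?thesis using k by (simp add: R_def sum.distrib)
    qed
    have R: "R \<in> M" "positive_op R"
      using g by (auto simp: R_def r_def intro!: simple_closed simple_positive E)
    have "N (R + c *\<^sub>R E k) \<le> N (R + g k *\<^sub>R E k)"
      using simple_apply_member[OF E(1) k, of r] c
      by (intro gauge_lower[OF R prjE[OF k]]) (auto simp: R_def r_def)
    then show "\<nu> (g(k := c)) \<le> \<nu> g" using split[of c] split[of "g k"] by (simp add: \<nu>_def)
  next
    fix g :: "nat \<Rightarrow> real" and i j a b
    assume g: "\<And>k. k < m \<Longrightarrow> 0 \<le> g k" and ij: "i < j" "j < m"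
      and ab: "g j \<le> b" "b \<le> a" "a \<le> g i"
      and mean: "tr (E i) * a + tr (E j) * b = tr (E i) * g i + tr (E j) * g j"
    define r where "r = g(i := 0, j := 0)"
    define R where "R = (\<Sum>l<m. r l *\<^sub>R E l)"
    have split: "(\<Sum>l<m. (g(i := a, j := b)) l *\<^sub>R E l) = R + a *\<^sub>R E i + b *\<^sub>R E j" for a b
    proof -
      have "(g(i := a, j := b)) l *\<^sub>R E l =
          r l *\<^sub>R E l + (if l = i then a *\<^sub>R E i else 0) + (if l = j then b *\<^sub>R E j else 0)" for l
        using ij by (simp add: r_def)
      then show ?thesis using ij by (simp add: R_def sum.distrib)
    qed
    have R: "R \<in> M" "positive_op R"
      using g by (auto simp: R_def r_def intro!: simple_closed simple_positive E)
    have "N (R + a *\<^sub>R E i + b *\<^sub>R E j) \<le> N (R + g i *\<^sub>R E i + g j *\<^sub>R E j)"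
    proof (rule gauge_transfer[OF R prjE prjE E(2)])
      show "i < m" "j < m" "j < m" using ij by auto
      show "E i o\<^sub>L E j = 0" using E(1) ij by (simp add: orth_family_def)
      show "R (E i x) = 0" "R (E j x) = 0" for x
        using simple_apply_member[OF E(1), of i r] simple_apply_member[OF E(1), of j r] ij
        by (simp_all add: R_def r_def)
      show "0 \<le> g j" using g ij by simp
    qed (use ab mean in auto)
    then show "\<nu> (g(i := a, j := b)) \<le> \<nu> g"
      using split[of a b] split[of "g i" "g j"] by (simp add: \<nu>_def)
  qed (use f g sums in auto)
  then show ?thesis by (simp add: \<nu>_def)
qed

end

section \<open>Approximation by simple operators and common partitions\<close>

context finite_von_neumann_algebra
begin

text \<open>
  Peeling off one projection at a time makes the projections orthogonal and lets the leading one be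
  cut in two without touching the others. Zero projections are excluded to keep all traces positive.
\<close>

primrec partition_list :: "(real \<times> 'h op) list \<Rightarrow> 'h op \<Rightarrow> bool"
  where
    "partition_list [] Q \<longleftrightarrow> Q = 0"
  | "partition_list (z # xs) Q \<longleftrightarrow> prj Q \<and> prj (snd z) \<and> snd z \<noteq> 0 \<and> Q o\<^sub>L snd z = snd z \<and>
      partition_list xs (Q - snd z)"

definition list_op :: "(real \<times> 'h op) list \<Rightarrow> 'h op"
  where "list_op xs = (\<Sum>z\<leftarrow>xs. fst z *\<^sub>R snd z)"

definition decreasing_values :: "(real \<times> 'h op) list \<Rightarrow> bool"
  where "decreasing_values xs \<longleftrightarrow> sorted_wrt (\<ge>) (map fst xs)"

lemma list_op_simps: "list_op [] = 0" "list_op (z # xs) = fst z *\<^sub>R snd z + list_op xs"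
  by (simp_all add: list_op_def)

lemma decreasing_values_simps:
  "decreasing_values []"
  "decreasing_values (z # xs) \<longleftrightarrow> (\<forall>s\<in>fst ` set xs. s \<le> fst z) \<and> decreasing_values xs"
  by (auto simp: decreasing_values_def)

lemma list_op_closed:
  "partition_list xs Q \<Longrightarrow> list_op xs \<in> M \<and> selfadjoint (list_op xs)"
  by (induction xs arbitrary: Q)
    (auto simp: list_op_simps prjD prj_selfadjoint
      intro!: zero_closed add_closed scaleR_closed selfadjoint_intros)

lemma partition_list_orth_family:
  assumes "partition_list xs Q"
  shows "orth_family (length xs) (\<lambda>k. snd (xs ! k))" "\<And>k. k < length xs \<Longrightarrow> snd (xs ! k) \<noteq> 0"
    "(\<Sum>k<length xs. snd (xs ! k)) = Q"
    "list_op xs = (\<Sum>k<length xs. fst (xs ! k) *\<^sub>R snd (xs ! k))"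
proof -
  have "orth_family (length xs) (\<lambda>k. snd (xs ! k)) \<and> (\<forall>k<length xs. snd (xs ! k) \<noteq> 0) \<and>
      (\<forall>k<length xs. Q o\<^sub>L snd (xs ! k) = snd (xs ! k)) \<and>
      (\<Sum>k<length xs. snd (xs ! k)) = Q \<and>
      list_op xs = (\<Sum>k<length xs. fst (xs ! k) *\<^sub>R snd (xs ! k))"
    using assms
  proof (induction xs arbitrary: Q)
    case Nil
    then show ?case by (simp add: orth_family_def list_op_simps)
  next
    case (Cons z xs)
    define E where "E = snd z"
    have z: "prj Q" "prj E" "E \<noteq> 0" "Q o\<^sub>L E = E" "partition_list xs (Q - E)"
      using Cons.prems by (simp_all add: E_def)
    note QE = sub_prj[OF z(1,2,4)]
    note IH = Cons.IH[OF z(5)]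
    have sub: "Q (snd (xs ! k) x) = snd (xs ! k) x" "E (snd (xs ! k) x) = 0" "snd (xs ! k) (E x) = 0"
      if k: "k < length xs" for k x
    proof -
      have p: "prj (snd (xs ! k))" using IH k by (simp add: orth_family_def)
      have Qk: "(Q - E) (snd (xs ! k) y) = snd (xs ! k) y" for y
        using IH k by (metis blinfun_apply_blinfun_compose)
      have "E ((Q - E) y) = 0" for y using QE(7) by (metis blinfun_apply_blinfun_compose zero_blinfun.rep_eq)
      then show E0: "E (snd (xs ! k) x) = 0" for x using Qk[of x] by metis
      then show "Q (snd (xs ! k) x) = snd (xs ! k) x" using Qk[of x] by (simp add: blinfun.diff_left)
      have "E o\<^sub>L snd (xs ! k) = 0" using E0 by (simp add: compose_eq_iff)
      then show "snd (xs ! k) (E x) = 0" using orth_prj(2)[OF z(2) p] by blast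
    qed
    have "orth_family (length (z # xs)) (\<lambda>k. snd ((z # xs) ! k))"
      unfolding orth_family_def
    proof (intro conjI allI impI)
      show "prj (snd ((z # xs) ! l))" if "l < length (z # xs)" for l
        using that z IH by (cases l) (auto simp: orth_family_def E_def)
      show "snd ((z # xs) ! l) o\<^sub>L snd ((z # xs) ! k) = 0"
        if "l < length (z # xs)" "k < length (z # xs)" "l \<noteq> k" for l k
        using that sub IH by (cases l; cases k) (auto simp: orth_family_def compose_eq_iff E_def[symmetric])
    qed
    moreover have "\<forall>k<length (z # xs). snd ((z # xs) ! k) \<noteq> 0"
      using z IH by (auto simp: nth_Cons' E_def)
    moreover have "\<forall>k<length (z # xs). Q o\<^sub>L snd ((z # xs) ! k) = snd ((z # xs) ! k)"
      using z sub by (auto simp: nth_Cons' E_def compose_eq_iff)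
    ultimately show ?case
      using IH unfolding length_Cons sum.lessThan_Suc_shift by (simp add: list_op_simps E_def)
  qed
  then show "orth_family (length xs) (\<lambda>k. snd (xs ! k))" "\<And>k. k < length xs \<Longrightarrow> snd (xs ! k) \<noteq> 0"
    "(\<Sum>k<length xs. snd (xs ! k)) = Q"
    "list_op xs = (\<Sum>k<length xs. fst (xs ! k) *\<^sub>R snd (xs ! k))" by blast+
qed

lemma decreasing_values_nth:
  "decreasing_values xs \<Longrightarrow> k \<le> l \<Longrightarrow> l < length xs \<Longrightarrow> fst (xs ! l) \<le> fst (xs ! k)"
  using sorted_wrt_nth_less[of "(\<ge>)" "map fst xs" k l]
  by (cases "k = l") (auto simp: decreasing_values_def)

text \<open>
  Values are assigned in steps of \<open>e\<close>. On \<open>Q\<close>, where \<open>T \<ge> k e\<close>, nothing has been assigned yet. The next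
  step splits \<open>Q\<close> by the spectral projection \<open>P\<close> of \<open>T - (k + 1) e\<close>: the part \<open>Q (1 - P)\<close>, on which
  \<open>k e \<le> T \<le> (k + 1) e\<close>, receives the value \<open>k e\<close>. As \<open>Q\<close> commutes with \<open>T\<close>, it commutes with \<open>P\<close>.
\<close>

lemma spectral_approximation_step:
  assumes T: "T \<in> M" "positive_op T" and e: "0 < e"
  shows "\<exists>Q xs. prj Q \<and> Q o\<^sub>L T = T o\<^sub>L Q \<and>
    (\<forall>x. real k * e * inner (Q x) x \<le> inner (T (Q x)) (Q x)) \<and>
    partition_list xs (id_blinfun - Q) \<and> decreasing_values xs \<and>
    (\<forall>s\<in>fst ` set xs. 0 \<le> s \<and> s \<le> real k * e) \<and>
    (\<forall>x. 0 \<le> inner (T (x - Q x) - list_op xs x) x \<and>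
      inner (T (x - Q x) - list_op xs x) x \<le> e * inner (x - Q x) x)"
proof (induction k)
  case 0
  show ?case
    using positive_opD(3)[OF T(2)]
    by (intro exI[of _ id_blinfun] exI[of _ "[]"])
      (auto simp: prj_one list_op_simps decreasing_values_simps blinfun.zero_right intro: blinfun_eqI)
next
  case (Suc k)
  then obtain Q xs where Q: "prj Q" "Q o\<^sub>L T = T o\<^sub>L Q"
    "\<And>x. real k * e * inner (Q x) x \<le> inner (T (Q x)) (Q x)"
    and xs: "partition_list xs (id_blinfun - Q)" "decreasing_values xs"
    "\<And>s. s \<in> fst ` set xs \<Longrightarrow> 0 \<le> s \<and> s \<le> real k * e"
    and diff: "\<And>x. 0 \<le> inner (T (x - Q x) - list_op xs x) x"
      "\<And>x. inner (T (x - Q x) - list_op xs x) x \<le> e * inner (x - Q x) x"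
    by blast
  define c where "c = real k * e"
  define A where "A = T - (c + e) *\<^sub>R id_blinfun"
  have sT: "selfadjoint T" by (rule positive_opD[OF T(2)])
  have "A \<in> M" "selfadjoint A"
    using T sT by (auto simp: A_def intro!: diff_closed scaleR_closed id_closed selfadjoint_intros)
  then obtain P where P: "P \<in> M" "projection_op P"
    "\<And>x. 0 \<le> inner (A (P x)) (P x)" "\<And>x. inner (A (x - P x)) (x - P x) \<le> 0"
    "\<And>X. clinear_op X \<Longrightarrow> selfadjoint X \<Longrightarrow> X o\<^sub>L A = A o\<^sub>L X \<Longrightarrow> X o\<^sub>L P = P o\<^sub>L X"
    using spectral_projection by metis
  have pP: "prj P" using P by (simp add: prj_def)
  have QT: "Q (T x) = T (Q x)" for x using Q(2) by (rule commute_apply)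
  have "Q o\<^sub>L A = A o\<^sub>L Q" by (rule blinfun_eqI) (simp add: A_def blinfun.bilinear_simps QT)
  then have "Q o\<^sub>L P = P o\<^sub>L Q" using Q by (intro P(5)) (auto simp: clinear prjD prj_selfadjoint)
  then have QP: "Q (P x) = P (Q x)" for x by (rule commute_apply)
  have "T o\<^sub>L P = P o\<^sub>L T"
    by (rule P(5)[OF clinear[OF T(1)] sT]) (auto intro!: blinfun_eqI simp: A_def blinfun.bilinear_simps)
  then have TP: "P (T x) = T (P x)" for x by (metis blinfun_apply_blinfun_compose)
  have QQ: "Q (Q x) = Q x" and PP: "P (P x) = P x" for x using Q(1) pP by (simp_all add: prj_apply)
  define Q' where "Q' = Q o\<^sub>L P"
  define E where "E = Q - Q'"
  have Q': "prj Q'"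
    unfolding Q'_def using Q pP \<open>Q o\<^sub>L P = P o\<^sub>L Q\<close>
    by (intro prjI compose_closed selfadjoint_compose_commute)
      (auto simp: prjD prj_selfadjoint QP[symmetric] QQ PP)
  have "Q o\<^sub>L Q' = Q'" by (rule blinfun_eqI) (simp add: Q'_def QQ)
  note QQ' = sub_prj[OF Q(1) Q' this, folded E_def]
  have Ex: "E x = Q x - P (Q x)" for x by (simp add: E_def Q'_def blinfun.diff_left QP)
  have QE: "Q (E x) = E x" for x by (simp add: Ex blinfun.diff_right QQ QP)
  have TE: "E (T x) = T (E x)" for x by (simp add: Ex QT TP blinfun.diff_right)
  have Aval: "inner (A y) y = inner (T y) y - (c + e) * inner y y" for y
    by (simp add: A_def blinfun.bilinear_simps inner_diff_left)
  have Einner: "inner (T (E x)) x = inner (T (E x)) (E x)" "inner (E x) x = inner (E x) (E x)" for x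
    using prj_apply(1,2)[OF QQ'(3)] by (metis TE)+
  have lowE: "c * inner (E x) x \<le> inner (T (E x)) x" for x
    using Q(3)[of "E x"] by (simp add: QE Einner c_def)
  have upE: "inner (T (E x)) x \<le> (c + e) * inner (E x) x" for x
    using P(4)[of "Q x"] Aval[of "E x"] by (simp add: Einner Ex[symmetric])
  have lowQ': "real (Suc k) * e * inner (Q' x) x \<le> inner (T (Q' x)) (Q' x)" for x
  proof -
    have "inner (Q' x) x = inner (Q' x) (Q' x)" using prj_apply(1,2)[OF Q'] by metis
    moreover have "0 \<le> inner (A (Q' x)) (Q' x)" using P(3)[of "Q x"] by (simp add: Q'_def QP)
    ultimately show ?thesis using Aval[of "Q' x"] by (simp add: c_def algebra_simps)
  qed
  define ys where "ys = (if E = 0 then xs else (c, E) # xs)"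
  have list_ys: "list_op ys = c *\<^sub>R E + list_op xs" by (simp add: ys_def list_op_simps)
  have "partition_list ys (id_blinfun - Q')"
  proof (cases "E = 0")
    case True
    then show ?thesis using xs(1) by (simp add: ys_def E_def)
  next
    case False
    have eq: "(id_blinfun - Q') - E = id_blinfun - Q" by (simp add: E_def)
    have "(id_blinfun - Q') o\<^sub>L E = E"
      using QQ'(7) by (simp add: compose_eq_iff blinfun.diff_left)
    moreover have "ys = (c, E) # xs" using False by (simp add: ys_def)
    ultimately show ?thesis
      using False xs(1) prj_compl(1)[OF Q'] QQ'(3)
      by (simp only: partition_list.simps snd_conv eq) blast
  qed
  moreover have "decreasing_values ys" using xs by (auto simp: ys_def decreasing_values_simps c_def)
  moreover have "0 \<le> s \<and> s \<le> real (Suc k) * e" if "s \<in> fst ` set ys" for s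
  proof -
    have "s \<in> fst ` set xs \<or> s = c" using that by (auto simp: ys_def split: if_splits)
    then have "0 \<le> s \<and> s \<le> c" using xs(3)[of s] e by (auto simp: c_def)
    moreover have "c \<le> real (Suc k) * e" using e by (simp add: c_def algebra_simps)
    ultimately show ?thesis by linarith
  qed
  moreover have "0 \<le> inner (T (x - Q' x) - list_op ys x) x \<and>
      inner (T (x - Q' x) - list_op ys x) x \<le> e * inner (x - Q' x) x" for x
  proof -
    have Q'E: "x - Q' x = (x - Q x) + E x" by (simp add: E_def blinfun.diff_left)
    have "inner (T (x - Q' x) - list_op ys x) x =
        inner (T (x - Q x) - list_op xs x) x + (inner (T (E x)) x - c * inner (E x) x)"
      unfolding Q'E list_ys by (simp add: blinfun.bilinear_simps inner_add_left inner_diff_left)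
    moreover have "e * inner (x - Q' x) x = e * inner (x - Q x) x + e * inner (E x) x"
      unfolding Q'E by (simp add: inner_add_left distrib_left)
    moreover have "inner (T (E x)) x \<le> c * inner (E x) x + e * inner (E x) x"
      using upE[of x] by (simp add: distrib_right)
    ultimately show ?thesis using diff[of x] lowE[of x] by linarith
  qed
  moreover have "Q' o\<^sub>L T = T o\<^sub>L Q'" by (rule blinfun_eqI) (simp add: Q'_def QT TP)
  ultimately show ?case using Q' lowQ' by (intro exI[of _ Q'] exI[of _ ys]) blast
qed

lemma spectral_approximation:
  assumes T: "T \<in> M" "positive_op T" and e: "0 < e"
  obtains xs where "partition_list xs id_blinfun" "decreasing_values xs"
    "\<And>s. s \<in> fst ` set xs \<Longrightarrow> 0 \<le> s" "norm (T - list_op xs) \<le> e"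
proof -
  obtain k :: nat where "norm T / e < real k" using reals_Archimedean2 by blast
  then have k: "norm T < real k * e" using e by (simp add: pos_divide_less_eq)
  obtain Q xs where Q: "prj Q" "\<And>x. real k * e * inner (Q x) x \<le> inner (T (Q x)) (Q x)"
    and xs: "partition_list xs (id_blinfun - Q)" "decreasing_values xs" "\<And>s. s \<in> fst ` set xs \<Longrightarrow> 0 \<le> s"
    and diff: "\<And>x. 0 \<le> inner (T (x - Q x) - list_op xs x) x"
      "\<And>x. inner (T (x - Q x) - list_op xs x) x \<le> e * inner (x - Q x) x"
    using spectral_approximation_step[OF T e, of k] by blast
  have "Q x = 0" for x
  proof (rule ccontr)
    assume "Q x \<noteq> 0"
    then have "norm T * (norm (Q x))\<^sup>2 < real k * e * (norm (Q x))\<^sup>2" using k by simp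
    moreover have "real k * e * (norm (Q x))\<^sup>2 \<le> norm T * (norm (Q x))\<^sup>2"
      using Q(2)[of x] inner_le_norm_op[of T "Q x"] prj_apply(3)[OF Q(1), of x] by simp
    ultimately show False by simp
  qed
  then have Q0: "Q = 0" by (intro blinfun_eqI) simp
  have p: "partition_list xs id_blinfun" using xs(1) by (simp add: Q0)
  have "norm (T - list_op xs) \<le> e"
  proof (rule norm_selfadjoint_le)
    show "selfadjoint (T - list_op xs)"
      using list_op_closed[OF p] positive_opD(2)[OF T(2)] by (intro selfadjoint_intros) auto
    show "\<bar>inner ((T - list_op xs) x) x\<bar> \<le> e * (norm x)\<^sup>2" for x
      using diff[of x] by (simp add: Q0 blinfun.diff_left power2_norm_eq_inner)
  qed (use e in simp)
  then show thesis using that p xs(2,3) by blast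
qed

end

context weak_dixmier_algebra
begin

text \<open>
  Equal traces make the two partitions interchangeable up to equi-measurability. The sets of values and
  their order are preserved because the comparison of partial sums needs decreasing nonnegative values.
\<close>

definition common_refinement ::
    "(real \<times> 'h op) list \<Rightarrow> 'h op \<Rightarrow> (real \<times> 'h op) list \<Rightarrow> 'h op \<Rightarrow> bool"
  where "common_refinement xs P ys P' \<longleftrightarrow>
    (\<exists>xs' ys'. partition_list xs' P \<and> partition_list ys' P' \<and>
      list_op xs' = list_op xs \<and> list_op ys' = list_op ys \<and>
      fst ` set xs' \<subseteq> fst ` set xs \<and> fst ` set ys' \<subseteq> fst ` set ys \<and>
      (decreasing_values xs \<longrightarrow> decreasing_values xs') \<and>
      (decreasing_values ys \<longrightarrow> decreasing_values ys') \<and>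
      map (\<lambda>z. tr (snd z)) xs' = map (\<lambda>z. tr (snd z)) ys')"

lemma common_refinement_sym: "common_refinement xs P ys P' \<Longrightarrow> common_refinement ys P' xs P"
  unfolding common_refinement_def by metis

lemma common_refinement_Cons:
  assumes x: "prj P" "prj E" "E \<noteq> 0" "P o\<^sub>L E = E"
    and y: "prj P'" "prj F" "F \<noteq> 0" "P' o\<^sub>L F = F"
    and t: "tr E = tr F" and IH: "common_refinement xs (P - E) ys (P' - F)"
  shows "common_refinement ((s, E) # xs) P ((t, F) # ys) P'"
proof -
  obtain xs' ys' where r: "partition_list xs' (P - E)" "partition_list ys' (P' - F)"
    "list_op xs' = list_op xs" "list_op ys' = list_op ys"
    "fst ` set xs' \<subseteq> fst ` set xs" "fst ` set ys' \<subseteq> fst ` set ys"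
    "decreasing_values xs \<longrightarrow> decreasing_values xs'" "decreasing_values ys \<longrightarrow> decreasing_values ys'"
    "map (\<lambda>z. tr (snd z)) xs' = map (\<lambda>z. tr (snd z)) ys'"
    using IH unfolding common_refinement_def by blast
  show ?thesis
    unfolding common_refinement_def
  proof (intro exI conjI)
    show "partition_list ((s, E) # xs') P" "partition_list ((t, F) # ys') P'" using x y r by auto
    show "list_op ((s, E) # xs') = list_op ((s, E) # xs)" "list_op ((t, F) # ys') = list_op ((t, F) # ys)"
      using r by (simp_all add: list_op_simps)
    show "fst ` set ((s, E) # xs') \<subseteq> fst ` set ((s, E) # xs)"
      "fst ` set ((t, F) # ys') \<subseteq> fst ` set ((t, F) # ys)" using r(5,6) by auto
    show "decreasing_values ((s, E) # xs) \<longrightarrow> decreasing_values ((s, E) # xs')"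
      "decreasing_values ((t, F) # ys) \<longrightarrow> decreasing_values ((t, F) # ys')"
      using r(5,6,7,8) unfolding decreasing_values_simps fst_conv by blast+
    show "map (\<lambda>z. tr (snd z)) ((s, E) # xs') = map (\<lambda>z. tr (snd z)) ((t, F) # ys')"
      using r(9) t by simp
  qed
qed

lemma common_refinement_split:
  assumes "common_refinement xs P ((t, G) # (t, F - G) # ys) P'"
  shows "common_refinement xs P ((t, F) # ys) P'"
proof -
  have "list_op ((t, G) # (t, F - G) # ys) = list_op ((t, F) # ys)"
    by (simp add: list_op_simps scaleR_diff_right)
  moreover have "fst ` set ((t, G) # (t, F - G) # ys) = fst ` set ((t, F) # ys)" by simp
  moreover have "decreasing_values ((t, G) # (t, F - G) # ys) = decreasing_values ((t, F) # ys)"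
    by (auto simp: decreasing_values_simps)
  ultimately show ?thesis using assms unfolding common_refinement_def by metis
qed

lemma partition_list_split:
  assumes part: "partition_list ((t, F) # ys) P'" and G: "prj G" "F o\<^sub>L G = G" "G \<noteq> F"
  shows "P' o\<^sub>L G = G" "partition_list ((t, F - G) # ys) (P' - G)"
proof -
  have F: "prj P'" "prj F" "P' o\<^sub>L F = F" "partition_list ys (P' - F)" using part by auto
  show P'G: "P' o\<^sub>L G = G" using sub_prj_trans[OF F(1,2,3) G(2)] .
  note FG = sub_prj[OF F(2) G(1,2)] and PG = sub_prj[OF F(1) G(1) P'G] and PF = sub_prj[OF F(1,2,3)]
  have "(P' - G) o\<^sub>L (F - G) = F - G"
    unfolding compose_eq_iff
    by (simp add: blinfun.bilinear_simps PF(2) PG(2) FG(1) prj_apply(1)[OF G(1)])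
  moreover have "(P' - G) - (F - G) = P' - F" by simp
  ultimately show "partition_list ((t, F - G) # ys) (P' - G)"
    using PG(3) FG(3) G(3) F(4) by simp
qed

text \<open>
  Of the two leading projections the one of larger trace is cut so that the traces of the leading
  pieces agree; merging then continues with what is left of it.
\<close>

lemma common_refinement_exists:
  "partition_list xs P \<Longrightarrow> partition_list ys P' \<Longrightarrow> tr P = tr P' \<Longrightarrow> common_refinement xs P ys P'"
proof (induction "length xs + length ys" arbitrary: xs ys P P' rule: less_induct)
  case less
  have zero: "R = 0" if "partition_list zs R" "tr R = 0" for zs R
    using that tr_prj_eq_zero[of R] by (cases zs) auto
  have nil: "zs = []" if "partition_list zs 0" for zs
    using that by (cases zs) (auto simp: compose_eq_iff blinfun_eqI)
  show ?case
  proof (cases "xs = [] \<or> ys = []")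
    case True
    then have "tr P = 0" "tr P' = 0" using less.prems by (auto simp: tr_zero)
    then have "P = 0" "P' = 0" using zero less.prems by auto
    then have "xs = []" "ys = []" using nil less.prems by auto
    then show ?thesis using less.prems
      unfolding common_refinement_def by (intro exI[of _ "[]"]) simp
  next
    case False
    have cut: "common_refinement ((s, E) # us) R ((t, F) # vs) R'"
      if part: "partition_list ((s, E) # us) R" "partition_list ((t, F) # vs) R'" and tr: "tr R = tr R'"
        and lt: "tr E < tr F"
        and small: "length us + length ((t, F) # vs) < length xs + length ys"
      for s t E F us vs R R'
    proof -
      have E: "prj R" "prj E" "E \<noteq> 0" "R o\<^sub>L E = E" "partition_list us (R - E)" using part(1) by auto
      have F: "prj R'" "prj F" using part(2) by auto
      obtain G where G: "prj G" "F o\<^sub>L G = G" "tr G = tr E"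
        using sub_prj_of_trace[OF F(2) admissible_prj[OF E(2)]] lt by auto
      have G0: "G \<noteq> 0" "G \<noteq> F" using G lt tr_prj_pos[OF E(2,3)] by (auto simp: tr_zero)
      note sp = partition_list_split[OF part(2) G(1,2) G0(2)]
      have "tr (R - E) = tr (R' - G)"
        using sub_prj(4)[OF E(1,2,4)] sub_prj(4)[OF F(1) G(1) sp(1)] tr G(3) by simp
      then have "common_refinement us (R - E) ((t, F - G) # vs) (R' - G)"
        using small by (intro less.hyps E(5) sp(2)) auto
      then have "common_refinement ((s, E) # us) R ((t, G) # (t, F - G) # vs) R'"
        using E F G G0 sp(1) by (intro common_refinement_Cons) auto
      then show ?thesis by (rule common_refinement_split)
    qed
    obtain s E us where xs: "xs = (s, E) # us" using False by (cases xs) auto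
    obtain t F vs where ys: "ys = (t, F) # vs" using False by (cases ys) auto
    show ?thesis
    proof (cases "tr E" "tr F" rule: linorder_cases)
      case less
      then show ?thesis using cut[of s E us P t F vs P'] less.prems by (simp add: xs ys)
    next
      case greater
      then have "common_refinement ys P' xs P"
        using cut[of t F vs P' s E us P] less.prems by (simp add: xs ys)
      then show ?thesis by (rule common_refinement_sym)
    next
      case equal
      have E: "prj P" "prj E" "E \<noteq> 0" "P o\<^sub>L E = E" "partition_list us (P - E)"
        using less.prems(1) by (auto simp: xs)
      have F: "prj P'" "prj F" "F \<noteq> 0" "P' o\<^sub>L F = F" "partition_list vs (P' - F)"
        using less.prems(2) by (auto simp: ys)
      have "common_refinement us (P - E) vs (P' - F)"
        using sub_prj(4)[OF E(1,2,4)] sub_prj(4)[OF F(1,2,4)] less.prems(3) equal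
        by (intro less.hyps E F) (auto simp: xs ys)
      then show ?thesis unfolding xs ys using E F equal by (intro common_refinement_Cons) auto
    qed
  qed
qed

end

section \<open>Singular numbers and Ky Fan norms\<close>

text \<open>
  The singular numbers of a simple operator are constant only on half-open intervals, so the bound is
  not available at the right end point.
\<close>

lemma integral_ge_const:
  fixes f :: "real \<Rightarrow> real"
  assumes f: "f integrable_on {a..b}" and ab: "a \<le> b" and le: "\<And>x. a \<le> x \<Longrightarrow> x < b \<Longrightarrow> c \<le> f x"
  shows "(b - a) * c \<le> integral {a..b} f"
proof -
  define g where "g = f(b := c)"
  have eq: "integral {a..b} f = integral {a..b} g"
    by (rule integral_spike[of "{b}"]) (auto simp: g_def)
  have "g integrable_on {a..b}"
    by (rule integrable_spike_finite[OF _ _ f, of "{b}"]) (auto simp: g_def)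
  then have "integral {a..b} (\<lambda>_. c) \<le> integral {a..b} g"
    using le by (intro integral_le) (auto simp: g_def)
  then show ?thesis using ab eq by simp
qed

context finite_von_neumann_algebra
begin

abbreviation mu :: "real \<Rightarrow> 'h op \<Rightarrow> real"
  where "mu s T \<equiv> singular_number M \<tau> s T"

lemma mu_set_eq:
  "{norm (T o\<^sub>L E) | E. E \<in> M \<and> projection_op E \<and> Re (\<tau> (id_blinfun - E)) \<le> s} =
    {norm (T o\<^sub>L E) | E. prj E \<and> 1 - tr E \<le> s}"
  by (auto simp: prj_def tr_diff id_closed tr_one tr_def[symmetric])

lemma mu_le: "prj E \<Longrightarrow> 1 - tr E \<le> s \<Longrightarrow> mu s T \<le> norm (T o\<^sub>L E)"
  unfolding singular_number_def mu_set_eq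
  by (intro cInf_lower bdd_belowI[of _ 0]) auto

lemma mu_ge:
  assumes "0 \<le> s" "\<And>E. prj E \<Longrightarrow> 1 - tr E \<le> s \<Longrightarrow> c \<le> norm (T o\<^sub>L E)"
  shows "c \<le> mu s T"
  unfolding singular_number_def mu_set_eq
proof (rule cInf_greatest)
  have "norm (T o\<^sub>L id_blinfun) \<in> {norm (T o\<^sub>L E) |E. prj E \<and> 1 - tr E \<le> s}"
    using assms(1) prj_one tr_one by force
  then show "{norm (T o\<^sub>L E) |E. prj E \<and> 1 - tr E \<le> s} \<noteq> {}" by blast
qed (use assms(2) in auto)

lemma mu_antimono: "0 \<le> s \<Longrightarrow> s \<le> s' \<Longrightarrow> mu s' T \<le> mu s T"
  by (intro mu_ge mu_le) auto

lemma mu_integrable: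
  assumes "0 \<le> a"
  shows "(\<lambda>s. mu s T) integrable_on {a..b}"
proof -
  have "mono_on {a..b} (\<lambda>s. - mu s T)"
    using assms by (auto simp: mono_on_def intro: mu_antimono)
  then show ?thesis using integrable_on_mono_on integrable_neg_iff by blast
qed

lemma mu_perturb:
  assumes "0 \<le> s"
  shows "mu s S \<le> mu s T + norm (S - T)"
proof -
  have "mu s S - norm (S - T) \<le> mu s T"
  proof (rule mu_ge[OF assms])
    fix E assume E: "prj E" "1 - tr E \<le> s"
    have "norm E \<le> 1" using prj_apply(4)[OF E(1)] by (intro norm_blinfun_bound) auto
    then have "norm (S - T) * norm E \<le> norm (S - T)" by (simp add: mult_left_le)
    then have "norm ((S - T) o\<^sub>L E) \<le> norm (S - T)"
      using norm_blinfun_compose[of "S - T" E] by simp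
    moreover have "S o\<^sub>L E = (T o\<^sub>L E) + ((S - T) o\<^sub>L E)"
      by (rule blinfun_eqI) (simp add: blinfun.bilinear_simps)
    then have "norm (S o\<^sub>L E) \<le> norm (T o\<^sub>L E) + norm ((S - T) o\<^sub>L E)"
      using norm_triangle_ineq by metis
    ultimately show "mu s S - norm (S - T) \<le> norm (T o\<^sub>L E)" using mu_le[OF E, of S] by linarith
  qed
  then show ?thesis by simp
qed

lemma mu_op_abs:
  assumes "T \<in> M"
  shows "mu s (op_abs T) = mu s T"
proof -
  have "norm (op_abs T o\<^sub>L E) = norm (T o\<^sub>L E)" for E :: "'h op"
    by (simp add: norm_blinfun_def norm_blinfun.rep_eq onorm_def norm_op_abs_apply[OF clinear[OF assms]])
  then show ?thesis by (simp add: singular_number_def)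
qed

lemma simple_inner:
  assumes "orth_family m E"
  shows "inner (blinfun_apply (\<Sum>l<m. h l *\<^sub>R E l) x) x = (\<Sum>l<m. h l * (norm (E l x))\<^sup>2)"
  using orth_familyD(1)[OF assms] by (simp add: simple_apply inner_sum_left prj_apply(3))

lemma partition_norm:
  assumes "orth_family m E" "(\<Sum>l<m. E l) = id_blinfun"
  shows "(\<Sum>l<m. (norm (E l x))\<^sup>2) = (norm x)\<^sup>2"
  using simple_inner[OF assms(1), of "\<lambda>_. 1" x] assms(2) by (simp add: power2_norm_eq_inner)

text \<open>
  The sum of the \<open>E l\<close> with \<open>l \<ge> k\<close> is a projection on which the operator is at most \<open>s k\<close>.
\<close>

lemma mu_simple_le:
  assumes E: "orth_family m E" "(\<Sum>l<m. E l) = id_blinfun"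
    and s: "\<And>l. l < m \<Longrightarrow> 0 \<le> s l" "\<And>k l. k \<le> l \<Longrightarrow> l < m \<Longrightarrow> s l \<le> s k"
    and k: "k < m" and x: "(\<Sum>l<k. tr (E l)) \<le> x"
  shows "mu x (\<Sum>l<m. s l *\<^sub>R E l) \<le> s k"
proof -
  define F where "F = (\<Sum>l<k. E l)"
  have oF: "orth_family k E" using E(1) k by (auto simp: orth_family_def)
  have F: "prj F" "tr F = (\<Sum>l<k. tr (E l))"
    using orth_family_projection[OF oF] by (simp_all add: F_def)
  define T where "T = (\<Sum>l<m. s l *\<^sub>R E l)"
  define h where "h l = (if l < k then 0 else s l)" for l
  have "T o\<^sub>L (id_blinfun - F) = (\<Sum>l<m. h l *\<^sub>R E l)"
  proof (rule blinfun_eqI)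
    fix y
    have "blinfun_apply F y = (\<Sum>l<k. E l y)" by (simp add: F_def blinfun.sum_left)
    then have "T (F y) = (\<Sum>l<k. T (E l y))" by (simp add: blinfun.sum_right)
    also have "\<dots> = (\<Sum>l<k. s l *\<^sub>R E l y)"
      using k simple_apply_member[OF E(1)] by (simp add: T_def)
    also have "\<dots> = (\<Sum>l<m. (if l < k then s l else 0) *\<^sub>R E l y)"
      using k by (intro sum.mono_neutral_cong_left) auto
    finally have "T y - T (F y) = (\<Sum>l<m. s l *\<^sub>R E l y - (if l < k then s l else 0) *\<^sub>R E l y)"
      by (simp add: T_def simple_apply sum_subtractf)
    also have "\<dots> = (\<Sum>l<m. h l *\<^sub>R E l y)" by (intro sum.cong) (auto simp: h_def)
    finally show "(T o\<^sub>L (id_blinfun - F)) y = blinfun_apply (\<Sum>l<m. h l *\<^sub>R E l) y"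
      by (simp add: blinfun.diff_left blinfun.diff_right simple_apply)
  qed
  moreover have "norm (\<Sum>l<m. h l *\<^sub>R E l) \<le> s k"
  proof (rule norm_selfadjoint_le[OF simple_selfadjoint[OF E(1)] _ s(1)[OF k]])
    fix y
    have h: "0 \<le> h l" "h l \<le> s k" if "l < m" for l using s k that by (auto simp: h_def)
    have "(\<Sum>l<m. h l * (norm (E l y))\<^sup>2) \<le> (\<Sum>l<m. s k * (norm (E l y))\<^sup>2)"
      using h by (intro sum_mono mult_right_mono) auto
    also have "\<dots> = s k * (norm y)\<^sup>2" by (simp add: sum_distrib_left[symmetric] partition_norm[OF E])
    finally have "inner (blinfun_apply (\<Sum>l<m. h l *\<^sub>R E l) y) y \<le> s k * (norm y)\<^sup>2"
      by (simp add: simple_inner[OF E(1)])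
    moreover have "0 \<le> inner (blinfun_apply (\<Sum>l<m. h l *\<^sub>R E l) y) y"
      unfolding simple_inner[OF E(1)] using h by (intro sum_nonneg mult_nonneg_nonneg) auto
    ultimately show "\<bar>inner (blinfun_apply (\<Sum>l<m. h l *\<^sub>R E l) y) y\<bar> \<le> s k * (norm y)\<^sup>2" by simp
  qed
  moreover have "mu x T \<le> norm (T o\<^sub>L (id_blinfun - F))"
    using prj_compl[OF F(1)] F(2) x by (intro mu_le) auto
  ultimately show ?thesis by (simp add: T_def)
qed

text \<open>
  If \<open>\<parallel>T P\<parallel> < s k\<close>, then \<open>1 - P\<close> is bounded below on the range of \<open>F = E 0 + \<dots> + E k\<close>, where \<open>T \<ge> s k\<close>;
  so \<open>1 - P\<close> has at least the trace of \<open>F\<close>, which exceeds \<open>x\<close>.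
\<close>

lemma mu_simple_ge:
  assumes E: "orth_family m E"
    and s: "\<And>k l. k \<le> l \<Longrightarrow> l < m \<Longrightarrow> s l \<le> s k"
    and k: "k < m" and x: "0 \<le> x" "x < (\<Sum>l<Suc k. tr (E l))"
  shows "s k \<le> mu x (\<Sum>l<m. s l *\<^sub>R E l)"
proof (rule mu_ge[OF x(1)])
  fix P assume P: "prj P" "1 - tr P \<le> x"
  define T where "T = (\<Sum>l<m. s l *\<^sub>R E l)"
  have oF: "orth_family (Suc k) E" using E k by (auto simp: orth_family_def)
  define F where "F = (\<Sum>l<Suc k. E l)"
  have F: "prj F" "tr F = (\<Sum>l<Suc k. tr (E l))"
    using orth_family_projection[OF oF] by (simp_all add: F_def)
  have "s k \<le> norm (T o\<^sub>L P)"
  proof (rule ccontr)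
    assume "\<not> ?thesis"
    then have c: "norm (T o\<^sub>L P) < s k" by simp
    \<comment> \<open>for \<open>y\<close> in the range of \<open>F\<close>: \<open>s k \<parallel>y\<parallel> \<le> \<parallel>T y\<parallel> \<le> \<parallel>T P\<parallel> \<parallel>y\<parallel> + \<parallel>T\<parallel> \<parallel>y - P y\<parallel>\<close>\<close>
    define d where "d = (s k - norm (T o\<^sub>L P)) / (norm T + 1)"
    have nT: "0 < norm T + 1" by (simp add: add_nonneg_pos)
    have d: "0 < d" using c nT by (simp add: d_def)
    have "tr F \<le> tr (id_blinfun - P)"
    proof (rule tr_le_of_bounded_below[OF F(1) prj_compl(1)[OF P(1)]])
      show "0 < d\<^sup>2" using d by simp
      fix y assume Fy: "F y = y"
      have "F y = (\<Sum>l<Suc k. E l y)" unfolding F_def by (rule blinfun.sum_left)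
      then have y: "y = (\<Sum>l<Suc k. E l y)" using Fy by metis
      have El: "E l y = 0" if "k < l" "l < m" for l
      proof -
        have "E l y = (\<Sum>j<Suc k. E l (E j y))" by (subst y) (simp only: blinfun.sum_right)
        also have "\<dots> = 0" using orth_familyD(2)[OF E] that by (intro sum.neutral) auto
        finally show ?thesis .
      qed
      have ny: "inner y y = (\<Sum>l<Suc k. (norm (E l y))\<^sup>2)"
      proof -
        have "inner y y = inner (F y) y" by (simp add: Fy)
        also have "\<dots> = (\<Sum>l<Suc k. (norm (E l y))\<^sup>2)"
          using simple_inner[OF oF, of "\<lambda>_. 1" y] by (simp add: F_def)
        finally show ?thesis .
      qed
      have "s k * (norm y)\<^sup>2 = (\<Sum>l<Suc k. s k * (norm (E l y))\<^sup>2)"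
        unfolding power2_norm_eq_inner[of y] ny by (rule sum_distrib_left)
      also have "\<dots> \<le> (\<Sum>l<Suc k. s l * (norm (E l y))\<^sup>2)"
        using s k by (intro sum_mono mult_right_mono) auto
      also have "\<dots> = (\<Sum>l<m. s l * (norm (E l y))\<^sup>2)"
        using k El by (intro sum.mono_neutral_left) auto
      also have "\<dots> = inner (T y) y" by (simp add: T_def simple_inner[OF E])
      also have "\<dots> \<le> norm (T y) * norm y" by (rule norm_cauchy_schwarz)
      finally have Ty: "s k * norm y \<le> norm (T y)"
        by (cases "y = 0") (auto simp: power2_eq_square)
      have "T y = (T o\<^sub>L P) y + T (y - P y)" by (simp add: blinfun.diff_right)
      then have "norm (T y) \<le> norm ((T o\<^sub>L P) y) + norm (T (y - P y))"
        using norm_triangle_ineq by metis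
      also have "\<dots> \<le> norm (T o\<^sub>L P) * norm y + norm T * norm (y - P y)"
        by (intro add_mono norm_blinfun)
      also have "\<dots> \<le> norm (T o\<^sub>L P) * norm y + (norm T + 1) * norm (y - P y)"
        by (simp add: distrib_right)
      finally have "(s k - norm (T o\<^sub>L P)) * norm y \<le> (norm T + 1) * norm (y - P y)"
        using Ty by (simp add: left_diff_distrib)
      then have "d * norm y \<le> norm (y - P y)"
        using nT by (simp add: d_def pos_divide_le_eq mult.commute)
      then have "(d * norm y)\<^sup>2 \<le> (norm (y - P y))\<^sup>2" using d by (intro power_mono) auto
      then show "d\<^sup>2 * (norm y)\<^sup>2 \<le> (norm ((id_blinfun - P) y))\<^sup>2"
        by (simp add: power_mult_distrib blinfun.diff_left)
    qed
    then show False using prj_compl(2)[OF P(1)] P(2) F(2) x(2) by simp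
  qed
  then show "s k \<le> norm ((\<Sum>l<m. s l *\<^sub>R E l) o\<^sub>L P)" by (simp add: T_def)
qed

lemma integral_mu_combine:
  assumes "0 \<le> a" "a \<le> b"
  shows "integral {0..b} (\<lambda>s. mu s T) = integral {0..a} (\<lambda>s. mu s T) + integral {a..b} (\<lambda>s. mu s T)"
  using Henstock_Kurzweil_Integration.integral_combine[OF assms mu_integrable] by simp

lemma integral_mu_simple_ge:
  assumes E: "orth_family m E"
    and s: "\<And>k l. k \<le> l \<Longrightarrow> l < m \<Longrightarrow> s l \<le> s k"
  shows "k \<le> m \<Longrightarrow> (\<Sum>l<k. tr (E l) * s l) \<le>
    integral {0..\<Sum>l<k. tr (E l)} (\<lambda>x. mu x (\<Sum>l<m. s l *\<^sub>R E l))"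
proof (induction k)
  case (Suc k)
  define a where "a = (\<Sum>l<k. tr (E l))"
  have nn: "0 \<le> tr (E l)" if "l < m" for l using orth_familyD(1)[OF E that] by (rule tr_prj_nonneg)
  have a: "0 \<le> a" using Suc.prems nn by (auto simp: a_def intro!: sum_nonneg)
  have b: "(\<Sum>l<Suc k. tr (E l)) = a + tr (E k)" by (simp add: a_def)
  have tk: "0 \<le> tr (E k)" using nn Suc.prems by simp
  have "(a + tr (E k) - a) * s k \<le> integral {a..a + tr (E k)} (\<lambda>x. mu x (\<Sum>l<m. s l *\<^sub>R E l))"
    using a tk Suc.prems b by (intro integral_ge_const mu_integrable mu_simple_ge[OF E s]) auto
  then show ?case
    using Suc integral_mu_combine[of a "a + tr (E k)" "\<Sum>l<m. s l *\<^sub>R E l"] a tk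
    unfolding b by (simp add: a_def[symmetric])
qed simp

lemma integral_mu_simple_le:
  assumes E: "orth_family m E" "(\<Sum>l<m. E l) = id_blinfun"
    and s: "\<And>l. l < m \<Longrightarrow> 0 \<le> s l" "\<And>k l. k \<le> l \<Longrightarrow> l < m \<Longrightarrow> s l \<le> s k"
  shows "k \<le> m \<Longrightarrow> integral {0..\<Sum>l<k. tr (E l)} (\<lambda>x. mu x (\<Sum>l<m. s l *\<^sub>R E l)) \<le>
    (\<Sum>l<k. tr (E l) * s l)"
proof (induction k)
  case (Suc k)
  let ?T = "\<Sum>l<m. s l *\<^sub>R E l"
  define a where "a = (\<Sum>l<k. tr (E l))"
  have nn: "0 \<le> tr (E l)" if "l < m" for l using orth_familyD(1)[OF E(1) that] by (rule tr_prj_nonneg)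
  have a: "0 \<le> a" using Suc.prems nn by (auto simp: a_def intro!: sum_nonneg)
  have b: "(\<Sum>l<Suc k. tr (E l)) = a + tr (E k)" by (simp add: a_def)
  have tk: "0 \<le> tr (E k)" using nn Suc.prems by simp
  have "integral {a..a + tr (E k)} (\<lambda>x. mu x ?T) \<le> integral {a..a + tr (E k)} (\<lambda>x. s k)"
    using a Suc.prems by (intro integral_le mu_integrable mu_simple_le[OF E s]) (auto simp: a_def)
  then show ?case
    using Suc integral_mu_combine[of a "a + tr (E k)" ?T] a tk
    unfolding b by (simp add: a_def[symmetric])
qed simp

lemma integral_mu_perturb:
  assumes "0 \<le> b" "norm (S - T) \<le> e"
  shows "integral {0..b} (\<lambda>s. mu s S) \<le> integral {0..b} (\<lambda>s. mu s T) + e * b"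
proof -
  have "integral {0..b} (\<lambda>s. mu s S) \<le> integral {0..b} (\<lambda>s. mu s T + e)"
  proof (intro integral_le mu_integrable integrable_add)
    show "mu s S \<le> mu s T + e" if "s \<in> {0..b}" for s
      using mu_perturb[of s S T] assms(2) that by simp
  qed auto
  also have "\<dots> = integral {0..b} (\<lambda>s. mu s T) + e * b"
    using assms(1) by (subst integral_add) (auto intro: mu_integrable)
  finally show ?thesis .
qed

end

section \<open>Ky Fan dominance\<close>

context gauged_algebra
begin

text \<open>
  Both operators are replaced by simple operators over partitions with equal traces. Each replacement
  changes the integral of \<open>\<mu>\<close> over \<open>[0, w]\<close> by at most \<open>e w\<close>. Adding \<open>2 e\<close> to all values of the second
  operator restores the inequalities between the partial sums.
\<close>

lemma gauge_le_of_integral_mu_le: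
  assumes S: "S \<in> M" "positive_op S" and T: "T \<in> M" "positive_op T"
    and le: "\<And>t. 0 < t \<Longrightarrow> t \<le> 1 \<Longrightarrow> integral {0..t} (\<lambda>s. mu s S) \<le> integral {0..t} (\<lambda>s. mu s T)"
    and e: "0 < e"
  shows "N S \<le> N T + 4 * e * N id_blinfun"
proof -
  obtain xs0 where xs0: "partition_list xs0 id_blinfun" "decreasing_values xs0"
    "\<And>s. s \<in> fst ` set xs0 \<Longrightarrow> 0 \<le> s" "norm (S - list_op xs0) \<le> e"
    using spectral_approximation[OF S e] by blast
  obtain ys0 where ys0: "partition_list ys0 id_blinfun" "decreasing_values ys0"
    "\<And>s. s \<in> fst ` set ys0 \<Longrightarrow> 0 \<le> s" "norm (T - list_op ys0) \<le> e"
    using spectral_approximation[OF T e] by blast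
  obtain xs ys where xs: "partition_list xs id_blinfun" "list_op xs = list_op xs0"
      "fst ` set xs \<subseteq> fst ` set xs0" "decreasing_values xs"
    and ys: "partition_list ys id_blinfun" "list_op ys = list_op ys0"
      "fst ` set ys \<subseteq> fst ` set ys0" "decreasing_values ys"
    and tr_eq: "map (\<lambda>z. tr (snd z)) xs = map (\<lambda>z. tr (snd z)) ys"
    using common_refinement_exists[OF xs0(1) ys0(1) refl] xs0(2) ys0(2)
    unfolding common_refinement_def by blast
  define m where "m = length xs"
  have m: "length xs = m" "length ys = m" using map_eq_imp_length_eq[OF tr_eq] by (simp_all add: m_def)
  define E where "E = (\<lambda>k. snd (xs ! k))"
  define F where "F = (\<lambda>k. snd (ys ! k))"
  define s where "s = (\<lambda>k. fst (xs ! k))"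
  define t where "t = (\<lambda>k. fst (ys ! k))"
  have E: "orth_family m E" "\<And>k. k < m \<Longrightarrow> E k \<noteq> 0" "(\<Sum>k<m. E k) = id_blinfun"
      "list_op xs0 = (\<Sum>k<m. s k *\<^sub>R E k)"
    using partition_list_orth_family[OF xs(1)] xs(2) by (simp_all add: m E_def s_def)
  have F: "orth_family m F" "(\<Sum>k<m. F k) = id_blinfun" "list_op ys0 = (\<Sum>k<m. t k *\<^sub>R F k)"
    using partition_list_orth_family[OF ys(1)] ys(2) by (simp_all add: m F_def t_def)
  have trEF: "tr (E k) = tr (F k)" if "k < m" for k
    using arg_cong[OF tr_eq, of "\<lambda>zs. zs ! k"] that by (simp add: E_def F_def m)
  have s: "\<And>k. k < m \<Longrightarrow> 0 \<le> s k" "\<And>k l. k \<le> l \<Longrightarrow> l < m \<Longrightarrow> s l \<le> s k"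
    using xs0(3) xs(3) decreasing_values_nth[OF xs(4)] by (auto simp: s_def m subset_eq)
  have t: "\<And>k. k < m \<Longrightarrow> 0 \<le> t k" "\<And>k l. k \<le> l \<Longrightarrow> l < m \<Longrightarrow> t l \<le> t k"
    using ys0(3) ys(3) decreasing_values_nth[OF ys(4)] by (auto simp: t_def m subset_eq)
  define S' where "S' = (\<Sum>k<m. s k *\<^sub>R E k)"
  define T' where "T' = (\<Sum>k<m. t k *\<^sub>R F k)"
  have nS: "norm (S - S') \<le> e" and nT: "norm (T - T') \<le> e"
    using xs0(4) ys0(4) E(4) F(3) by (simp_all add: S'_def T'_def)
  have S'M: "S' \<in> M" "selfadjoint S'" and T'M: "T' \<in> M" "selfadjoint T'"
    by (simp_all add: S'_def T'_def simple_closed simple_selfadjoint E(1) F(1))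
  have sums: "(\<Sum>l<k. tr (E l) * s l) \<le> (\<Sum>l<k. tr (E l) * (t l + 2 * e))" if k: "k \<le> m" for k
  proof (cases "k = 0")
    case False
    define w where "w = (\<Sum>l<k. tr (E l))"
    have wF: "(\<Sum>l<k. tr (F l)) = w" using trEF k by (simp add: w_def)
    have pos: "0 < tr (E l)" if "l < m" for l
      using tr_prj_pos[OF orth_familyD(1)[OF E(1) that] E(2)[OF that]] .
    have w0: "0 < w" unfolding w_def using False k pos by (intro sum_pos) auto
    have "w \<le> (\<Sum>l<m. tr (E l))"
      unfolding w_def using k pos by (intro sum_mono2) (auto intro: less_imp_le)
    also have "\<dots> = 1" using orth_family_projection(2)[OF E(1)] E(3) by (simp add: tr_one)
    finally have w1: "w \<le> 1" .
    have "(\<Sum>l<k. tr (E l) * s l) \<le> integral {0..w} (\<lambda>x. mu x S')"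
      using integral_mu_simple_ge[OF E(1) s(2) k] by (simp add: w_def S'_def)
    also have "\<dots> \<le> integral {0..w} (\<lambda>x. mu x S) + e * w"
      using integral_mu_perturb[of w S' S e] w0 nS by (simp add: norm_minus_commute)
    also have "integral {0..w} (\<lambda>x. mu x S) \<le> integral {0..w} (\<lambda>x. mu x T)" by (rule le[OF w0 w1])
    also have "integral {0..w} (\<lambda>x. mu x T) \<le> integral {0..w} (\<lambda>x. mu x T') + e * w"
      using integral_mu_perturb[of w T T' e] w0 nT by simp
    also have "integral {0..w} (\<lambda>x. mu x T') \<le> (\<Sum>l<k. tr (F l) * t l)"
      using integral_mu_simple_le[OF F(1,2) t k] by (simp add: wF T'_def)
    also have "(\<Sum>l<k. tr (F l) * t l) = (\<Sum>l<k. tr (E l) * t l)" using trEF k by simp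
    also have "(\<Sum>l<k. tr (E l) * t l) + e * w + e * w = (\<Sum>l<k. tr (E l) * (t l + 2 * e))"
      by (simp add: w_def distrib_left sum.distrib sum_distrib_right[symmetric])
    finally show ?thesis by simp
  qed simp
  have "N S' \<le> N (\<Sum>k<m. (t k + 2 * e) *\<^sub>R E k)"
    unfolding S'_def using s t e sums by (intro gauge_simple_mono E) auto
  also have "\<dots> = N (0 + (\<Sum>k<m. (t k + 2 * e) *\<^sub>R E k))" by simp
  also have "\<dots> = N (0 + (\<Sum>k<m. (t k + 2 * e) *\<^sub>R F k))"
    using t e trEF
    by (intro gauge_equi_measurable equi_measurable_simple zero_closed positive_op_intros E(1) F(1)) auto
  also have "0 + (\<Sum>k<m. (t k + 2 * e) *\<^sub>R F k) = T' + (2 * e) *\<^sub>R id_blinfun"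
    by (simp add: T'_def F(2)[symmetric] scaleR_add_left sum.distrib scaleR_sum_right)
  also have "N (T' + (2 * e) *\<^sub>R id_blinfun) \<le> N T' + (2 * e) * N id_blinfun"
    using gauge_triangle[OF T'M(1) scaleR_closed[OF id_closed], of "2 * e"] e
    by (simp add: gauge_scaleR id_closed)
  finally have mid: "N S' \<le> N T' + (2 * e) * N id_blinfun" .
  have near: "N A \<le> N B + e * N id_blinfun"
    if "A \<in> M" "B \<in> M" "selfadjoint A" "selfadjoint B" "norm (A - B) \<le> e" for A B
  proof -
    have "N A \<le> N B + N (A - B)" using gauge_triangle[of B "A - B"] that by (simp add: diff_closed)
    also have "N (A - B) \<le> norm (A - B) * N id_blinfun"
      using that by (intro gauge_le_norm diff_closed selfadjoint_intros)
    also have "\<dots> \<le> e * N id_blinfun" using that by (intro mult_right_mono gauge_nonneg id_closed)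
    finally show ?thesis by simp
  qed
  have "N S \<le> N S' + e * N id_blinfun"
    using near[OF S(1) S'M(1) positive_opD(2)[OF S(2)] S'M(2) nS] .
  moreover have "N T' \<le> N T + e * N id_blinfun"
    using near[OF T'M(1) T(1) T'M(2) positive_opD(2)[OF T(2)]] nT by (simp add: norm_minus_commute)
  ultimately show ?thesis using mid by linarith
qed

lemma gauge_le_of_ky_fan_le:
  assumes S: "S \<in> M" and T: "T \<in> M"
    and le: "\<And>t. 0 < t \<Longrightarrow> t \<le> 1 \<Longrightarrow> ky_fan_norm M \<tau> t S \<le> ky_fan_norm M \<tau> t T"
  shows "N S \<le> N T"
proof (rule field_le_epsilon)
  fix d :: real assume d: "0 < d"
  have N1: "0 \<le> N id_blinfun" by (intro gauge_nonneg id_closed)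
  define e where "e = d / (4 * N id_blinfun + 1)"
  have e: "0 < e" "4 * e * N id_blinfun \<le> d" using d N1 by (auto simp: e_def field_simps)
  have "integral {0..t} (\<lambda>s. mu s (op_abs S)) \<le> integral {0..t} (\<lambda>s. mu s (op_abs T))"
    if t: "0 < t" "t \<le> 1" for t
    using le[OF t] t by (simp add: ky_fan_norm_def mu_op_abs S T divide_le_cancel)
  then have "N (op_abs S) \<le> N (op_abs T) + 4 * e * N id_blinfun"
    using S T e(1)
    by (intro gauge_le_of_integral_mu_le op_abs_closed op_abs_exists(1) clinear) auto
  then show "N S \<le> N T + d" using e(2) gauge_abs[OF S] gauge_abs[OF T] by linarith
qed

end

theorem theoremF:
  fixes M :: "'h::complex_hilbert op set"
    and \<tau> :: "'h op \<Rightarrow> complex"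
    and S T :: "'h op"
  assumes "finite_von_neumann_algebra M \<tau>"
    and "weak_dixmier_property M \<tau>"
    and "S \<in> M" and "T \<in> M"
    and "\<And>t. 0 \<le> t \<Longrightarrow> t \<le> 1 \<Longrightarrow> ky_fan_norm M \<tau> t S \<le> ky_fan_norm M \<tau> t T"
  shows "\<forall>N. tracial_gauge_norm M \<tau> N \<longrightarrow> N S \<le> N T"
proof (intro allI impI)
  fix N assume "tracial_gauge_norm M \<tau> N"
  then interpret gauged_algebra M \<tau> N
    using assms(1,2)
    by (simp add: gauged_algebra_def weak_dixmier_algebra_def weak_dixmier_algebra_axioms_def)
  show "N S \<le> N T" by (rule gauge_le_of_ky_fan_le[OF assms(3,4)]) (use assms(5) in auto)
qed

end
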